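(* Let $X$ be a complex Banach space, let $p>0$, let $(\mathcal{I},\|\cdot\|_{\mathcal{I}})$ be an $l_p$-ideal in $\mathcal{B}(X)$ with eigenvalue constant $\gamma_p$, and let $A\in\mathcal{B}(X)$ and $K\in\mathcal{I}$. If $s>\|A\|$, then $$n_{A+K}(s)\le\gamma_p^p\,\Gamma_p\,\frac{(p+1)^{p+1}}{p^p}\,\frac{s}{(s-\|A\|)^{p+1}}\,\|K\|_{\mathcal{I}}^p.$$
   Context: $\mathcal{B}(X)$ denotes the bounded linear operators on $X$ with operator norm $\|\cdot\|$, $\mathcal{F}(X)$ the finite rank operators, $I$ the identity. Discrete eigenvalues: isolated points of the spectrum that are eigenvalues of finite algebraic multiplicity, the algebraic multiplicity being the rank of the associated Riesz projection. $n_{A+K}(s)$ is the number of discrete eigenvalues of $A+K$ in $\{\lambda\in\mathbb{C}:|\lambda|>s\}$, counted with algebraic multiplicity. Quasi-norm: a map $\|\cdot\|_V:V\to[0,\infty)$ on a complex vector space with $\|x\|_V=0\iff x=0$, $\|\lambda x\|_V=|\lambda|\|x\|_V$, and $\|x+y\|_V\le q(\|x\|_V+\|y\|_V)$ for some $q\ge1$. $V$ carries the metrizable vector topology for which the sets $\{x:\|x\|_V\le 1/n\}$, $n\in\mathbb{N}$, form a fundamental system of neighbourhoods of $0$. $l_p$-ideal: a linear subspace $\mathcal{I}\subset\mathcal{B}(X)$ with a quasi-norm $\|\cdot\|_{\mathcal{I}}$ such that: (A1) $\mathcal{F}(X)\subset\mathcal{I}$ is dense in $(\mathcal{I},\|\cdot\|_{\mathcal{I}})$;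 (A2) $\|L\|\le\|L\|_{\mathcal{I}}$ for $L\in\mathcal{I}$; (A3) if $L\in\mathcal{I}$ and $A,B\in\mathcal{B}(X)$, then $ALB\in\mathcal{I}$ and $\|ALB\|_{\mathcal{I}}\le\|A\|\|L\|_{\mathcal{I}}\|B\|$; (A4) there is a constant $\gamma_p$ (the eigenvalue constant) with $\left(\sum_j|\lambda_j(L)|^p\right)^{1/p}\le\gamma_p\|L\|_{\mathcal{I}}$ for all $L\in\mathcal{I}$, where $(\lambda_j(L))$ are the discrete eigenvalues of $L$ counted with algebraic multiplicity. $\Gamma_p>0$ is a constant such that $|\det_p(I-F)|\le\exp\left(\Gamma_p\sum_k|\lambda_k(F)|^p\right)$ for every $F\in\mathcal{F}(X)$ (discrete eigenvalues counted with algebraic multiplicity); it is a known fact that such a constant exists. Here, for $F\in\mathcal{F}(X)$ with range $R$ and restriction $F_R:R\to R$, $\det(I-F):=\det(I_R-F_R)$, $\operatorname{tr}(F):=\operatorname{tr}(F_R)$, and $\det_p(I-F):=\det(I-F)\exp\left(\sum_{k=1}^{\lceil p\rceil-1}\frac1k\operatorname{tr}(F^k)\right)$, with $\lceil p\rceil=\min\{n\in\mathbb{N}:n\ge p\}$ and an empty sum equal to $0$. *)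

theory Defs
  imports
    "HOL-Complex_Analysis.Complex_Analysis"
    "Jordan_Normal_Form.Determinant"
begin

section \<open>Complex Banach spaces\<close>

class complex_vector = real_vector +
  fixes scaleC :: "complex \<Rightarrow> 'a \<Rightarrow> 'a"  (infixr \<open>*\<^sub>C\<close> 75)
  assumes scaleC_add_right: "c *\<^sub>C (x + y) = c *\<^sub>C x + c *\<^sub>C y"
    and scaleC_add_left: "(c + d) *\<^sub>C x = c *\<^sub>C x + d *\<^sub>C x"
    and scaleC_scaleC: "c *\<^sub>C (d *\<^sub>C x) = (c * d) *\<^sub>C x"
    and scaleC_one: "1 *\<^sub>C x = x"
    and scaleR_scaleC: "scaleR r x = complex_of_real r *\<^sub>C x"

class complex_normed_vector = complex_vector + real_normed_vector +
  assumes norm_scaleC: "norm (c *\<^sub>C x) = cmod c * norm x"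

class complex_banach = complex_normed_vector + banach

global_interpretation complex_vector:
  vector_space "scaleC :: complex \<Rightarrow> 'a \<Rightarrow> 'a::complex_vector"
  by unfold_locales (simp_all add: scaleC_add_right scaleC_add_left scaleC_scaleC scaleC_one)

lemma bounded_linear_scaleC_comp:
  fixes f :: "'a::real_normed_vector \<Rightarrow> 'b::complex_normed_vector"
  assumes "bounded_linear f"
  shows "bounded_linear (\<lambda>x. c *\<^sub>C f x)"
proof -
  interpret f: bounded_linear f by fact
  obtain B where B: "\<And>x. norm (f x) \<le> norm x * B" using f.bounded by blast
  show ?thesis
  proof (rule bounded_linear_intro[where K = "cmod c * B"])
    show "c *\<^sub>C f (x + y) = c *\<^sub>C f x + c *\<^sub>C f y" for x y
      by (simp add: f.add scaleC_add_right)
    show "c *\<^sub>C f (r *\<^sub>R x) = r *\<^sub>R (c *\<^sub>C f x)" for r x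
      by (simp add: f.scaleR scaleR_scaleC scaleC_scaleC mult.commute)
    show "norm (c *\<^sub>C f x) \<le> norm x * (cmod c * B)" for x
      using mult_left_mono[OF B[of x], of "cmod c"] by (simp add: norm_scaleC mult_ac)
  qed
qed

instantiation blinfun :: (real_normed_vector, complex_normed_vector) complex_normed_vector
begin

lift_definition scaleC_blinfun :: "complex \<Rightarrow> 'a \<Rightarrow>\<^sub>L 'b \<Rightarrow> 'a \<Rightarrow>\<^sub>L 'b"
  is "\<lambda>c f x. c *\<^sub>C f x"
  by (rule bounded_linear_scaleC_comp)

instance
proof
  fix c d :: complex and r :: real and f g :: "'a \<Rightarrow>\<^sub>L 'b"
  show "c *\<^sub>C (f + g) = c *\<^sub>C f + c *\<^sub>C g" by transfer (simp add: scaleC_add_right)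
  show "(c + d) *\<^sub>C f = c *\<^sub>C f + d *\<^sub>C f" by transfer (simp add: scaleC_add_left)
  show "c *\<^sub>C d *\<^sub>C f = (c * d) *\<^sub>C f" by transfer (simp add: scaleC_scaleC)
  show "1 *\<^sub>C f = f" by transfer (simp add: scaleC_one)
  show "r *\<^sub>R f = complex_of_real r *\<^sub>C f" by transfer (simp add: scaleR_scaleC)
  have le: "norm (c *\<^sub>C f) \<le> cmod c * norm f" for c and f :: "'a \<Rightarrow>\<^sub>L 'b"
  proof (rule norm_blinfun_bound)
    show "norm (blinfun_apply (c *\<^sub>C f) x) \<le> cmod c * norm f * norm x" for x
      using mult_left_mono[OF norm_blinfun[of f x], of "cmod c"]
      by (simp add: scaleC_blinfun.rep_eq norm_scaleC mult.assoc)
  qed simp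
  show "norm (c *\<^sub>C f) = cmod c * norm f"
  proof (cases "c = 0")
    case True
    then show ?thesis using le[of 0 f] by simp
  next
    case False
    have "inverse c *\<^sub>C c *\<^sub>C f = f"
      using False by transfer (simp add: scaleC_scaleC scaleC_one)
    then have "norm f \<le> cmod (inverse c) * norm (c *\<^sub>C f)"
      using le[of "inverse c" "c *\<^sub>C f"] by simp
    then have "cmod c * norm f \<le> norm (c *\<^sub>C f)"
      using False by (simp add: norm_divide field_simps)
    then show ?thesis using le[of c f] by simp
  qed
qed

end

instance blinfun :: (real_normed_vector, complex_banach) complex_banach ..

section \<open>Bounded and finite rank operators\<close>

text \<open>The type \<^typ>\<open>'a \<Rightarrow>\<^sub>L 'a\<close> consists of the real-linear bounded maps; its norm is the
  operator norm.\<close>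

definition bounded_ops :: "('a::complex_normed_vector \<Rightarrow>\<^sub>L 'a) set" where
  "bounded_ops = {T. \<forall>c x. blinfun_apply T (c *\<^sub>C x) = c *\<^sub>C blinfun_apply T x}"

definition finite_rank :: "('a::complex_normed_vector \<Rightarrow>\<^sub>L 'a) \<Rightarrow> bool" where
  "finite_rank T \<longleftrightarrow> (\<exists>S. finite S \<and> range (blinfun_apply T) \<subseteq> complex_vector.span S)"

definition op_rank :: "('a::complex_normed_vector \<Rightarrow>\<^sub>L 'a) \<Rightarrow> nat" where
  "op_rank T = complex_vector.dim (range (blinfun_apply T))"

definition finite_rank_ops :: "('a::complex_normed_vector \<Rightarrow>\<^sub>L 'a) set" where
  "finite_rank_ops = {F \<in> bounded_ops. finite_rank F}"

definition op_power :: "('a::complex_normed_vector \<Rightarrow>\<^sub>L 'a) \<Rightarrow> nat \<Rightarrow> ('a \<Rightarrow>\<^sub>L 'a)" where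
  "op_power T k = (blinfun_compose T ^^ k) id_blinfun"

section \<open>Spectrum, Riesz projections and discrete eigenvalues\<close>

definition is_inverse_op :: "('a::complex_normed_vector \<Rightarrow>\<^sub>L 'a) \<Rightarrow> ('a \<Rightarrow>\<^sub>L 'a) \<Rightarrow> bool" where
  "is_inverse_op T S \<longleftrightarrow> S \<in> bounded_ops \<and> S o\<^sub>L T = id_blinfun \<and> T o\<^sub>L S = id_blinfun"

definition spectrum :: "('a::complex_normed_vector \<Rightarrow>\<^sub>L 'a) \<Rightarrow> complex set" where
  "spectrum T = {z. \<nexists>S. is_inverse_op (z *\<^sub>C id_blinfun - T) S}"

definition resolvent :: "('a::complex_normed_vector \<Rightarrow>\<^sub>L 'a) \<Rightarrow> complex \<Rightarrow> ('a \<Rightarrow>\<^sub>L 'a)" where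
  "resolvent T z = (THE S. is_inverse_op (z *\<^sub>C id_blinfun - T) S)"

text \<open>The library's \<^const>\<open>contour_integral\<close> is restricted to scalar integrands.\<close>

definition op_contour_integral ::
    "(real \<Rightarrow> complex) \<Rightarrow> (complex \<Rightarrow> ('a::complex_normed_vector \<Rightarrow>\<^sub>L 'a)) \<Rightarrow> ('a \<Rightarrow>\<^sub>L 'a)" where
  "op_contour_integral g f =
     integral {0..1} (\<lambda>t. vector_derivative g (at t within {0..1}) *\<^sub>C f (g t))"

text \<open>For an isolated point of the spectrum the integral does not depend on the choice of the
  circle.\<close>

definition riesz_projection ::
    "('a::complex_normed_vector \<Rightarrow>\<^sub>L 'a) \<Rightarrow> complex \<Rightarrow> ('a \<Rightarrow>\<^sub>L 'a)" where
  "riesz_projection T z =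
     (let r = (SOME r. 0 < r \<and> cball z r \<inter> spectrum T \<subseteq> {z})
      in (1 / (2 * of_real pi * \<i>)) *\<^sub>C op_contour_integral (circlepath z r) (resolvent T))"

definition algebraic_multiplicity :: "('a::complex_normed_vector \<Rightarrow>\<^sub>L 'a) \<Rightarrow> complex \<Rightarrow> nat" where
  "algebraic_multiplicity T z = op_rank (riesz_projection T z)"

definition discrete_eigenvalues :: "('a::complex_normed_vector \<Rightarrow>\<^sub>L 'a) \<Rightarrow> complex set" where
  "discrete_eigenvalues T =
     {z. z isolated_in (spectrum T) \<and> (\<exists>x. x \<noteq> 0 \<and> blinfun_apply T x = z *\<^sub>C x)
       \<and> finite_rank (riesz_projection T z)}"

text \<open>With values in \<^typ>\<open>ennreal\<close>, so that a finite bound on the count entails that there are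
  only finitely many such eigenvalues.\<close>

definition eigenvalue_count :: "('a::complex_normed_vector \<Rightarrow>\<^sub>L 'a) \<Rightarrow> real \<Rightarrow> ennreal" where
  "eigenvalue_count T s =
     (\<Sum>\<^sub>\<infinity>z\<in>{z \<in> discrete_eigenvalues T. cmod z > s}. of_nat (algebraic_multiplicity T z))"

definition eigenvalues_p_summable :: "real \<Rightarrow> ('a::complex_normed_vector \<Rightarrow>\<^sub>L 'a) \<Rightarrow> bool" where
  "eigenvalues_p_summable p T \<longleftrightarrow>
     (\<lambda>z. real (algebraic_multiplicity T z) * cmod z powr p) summable_on discrete_eigenvalues T"

definition eigenvalue_power_sum :: "real \<Rightarrow> ('a::complex_normed_vector \<Rightarrow>\<^sub>L 'a) \<Rightarrow> real" where
  "eigenvalue_power_sum p T =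
     (\<Sum>\<^sub>\<infinity>z\<in>discrete_eigenvalues T. real (algebraic_multiplicity T z) * cmod z powr p)"

section \<open>Trace and regularized determinant of finite rank operators\<close>

definition range_basis :: "('a::complex_normed_vector \<Rightarrow>\<^sub>L 'a) \<Rightarrow> 'a list" where
  "range_basis F =
     (SOME bs. distinct bs \<and> \<not> complex_vector.dependent (set bs)
        \<and> complex_vector.span (set bs) = range (blinfun_apply F))"

text \<open>The matrix, in a basis of the range of \<open>F\<close>, of the restriction of \<open>F\<close> to its range.\<close>

definition range_matrix :: "('a::complex_normed_vector \<Rightarrow>\<^sub>L 'a) \<Rightarrow> complex mat" where
  "range_matrix F =
     (let bs = range_basis F; n = length bs
      in Matrix.mat n n (\<lambda>(i, j).
           complex_vector.representation (set bs) (blinfun_apply F (bs ! j)) (bs ! i)))"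

definition op_trace :: "('a::complex_normed_vector \<Rightarrow>\<^sub>L 'a) \<Rightarrow> complex" where
  "op_trace F = (\<Sum>i<dim_row (range_matrix F). range_matrix F $$ (i, i))"

definition det_id_minus :: "('a::complex_normed_vector \<Rightarrow>\<^sub>L 'a) \<Rightarrow> complex" where
  "det_id_minus F = Determinant.det (1\<^sub>m (dim_row (range_matrix F)) - range_matrix F)"

definition det_p_id_minus :: "real \<Rightarrow> ('a::complex_normed_vector \<Rightarrow>\<^sub>L 'a) \<Rightarrow> complex" where
  "det_p_id_minus p F =
     det_id_minus F * exp (\<Sum>k = 1..nat \<lceil>p\<rceil> - 1. 1 / of_nat k * op_trace (op_power F k))"

section \<open>Quasi-norms and \<open>l\<^sub>p\<close>-ideals\<close>

locale quasi_norm =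
  fixes V :: "'v::complex_vector set" and qn :: "'v \<Rightarrow> real"
  assumes subspace: "complex_vector.subspace V"
    and nonneg: "x \<in> V \<Longrightarrow> 0 \<le> qn x"
    and eq_zero_iff: "x \<in> V \<Longrightarrow> qn x = 0 \<longleftrightarrow> x = 0"
    and homogeneous: "x \<in> V \<Longrightarrow> qn (c *\<^sub>C x) = cmod c * qn x"
    and quasi_triangle: "\<exists>q\<ge>1. \<forall>x\<in>V. \<forall>y\<in>V. qn (x + y) \<le> q * (qn x + qn y)"

definition quasi_norm_topology :: "'v::complex_vector set \<Rightarrow> ('v \<Rightarrow> real) \<Rightarrow> 'v topology" where
  "quasi_norm_topology V qn =
     topology (\<lambda>U. U \<subseteq> V \<and> (\<forall>x\<in>U. \<exists>n. {y \<in> V. qn (y - x) \<le> 1 / real (Suc n)} \<subseteq> U))"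

lemma openin_quasi_norm_topology:
  "openin (quasi_norm_topology V qn) U \<longleftrightarrow>
     U \<subseteq> V \<and> (\<forall>x\<in>U. \<exists>n. {y \<in> V. qn (y - x) \<le> 1 / real (Suc n)} \<subseteq> U)"
proof -
  let ?op = "\<lambda>U. U \<subseteq> V \<and> (\<forall>x\<in>U. \<exists>n. {y \<in> V. qn (y - x) \<le> 1 / real (Suc n)} \<subseteq> U)"
  have "istopology ?op"
    unfolding istopology_def
  proof (intro conjI allI impI)
    fix S T assume S: "?op S" and T: "?op T"
    show "S \<inter> T \<subseteq> V" using S by blast
    show "\<forall>x\<in>S \<inter> T. \<exists>n. {y \<in> V. qn (y - x) \<le> 1 / real (Suc n)} \<subseteq> S \<inter> T"
    proof
      fix x assume "x \<in> S \<inter> T"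
      then obtain m n where m: "{y \<in> V. qn (y - x) \<le> 1 / real (Suc m)} \<subseteq> S"
        and n: "{y \<in> V. qn (y - x) \<le> 1 / real (Suc n)} \<subseteq> T" using S T by blast
      have "1 / real (Suc (max m n)) \<le> 1 / real (Suc m)"
        "1 / real (Suc (max m n)) \<le> 1 / real (Suc n)"
        by (auto intro!: divide_left_mono)
      then have "{y \<in> V. qn (y - x) \<le> 1 / real (Suc (max m n))} \<subseteq> S \<inter> T"
        using m n by (force intro: order_trans)
      then show "\<exists>n. {y \<in> V. qn (y - x) \<le> 1 / real (Suc n)} \<subseteq> S \<inter> T" by blast
    qed
  next
    fix \<K> assume K: "\<forall>U\<in>\<K>. ?op U"
    show "\<Union>\<K> \<subseteq> V" using K by blast
    show "\<forall>x\<in>\<Union>\<K>. \<exists>n. {y \<in> V. qn (y - x) \<le> 1 / real (Suc n)} \<subseteq> \<Union>\<K>"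
      using K by (meson Union_iff Union_upper order_trans)
  qed
  then show ?thesis
    unfolding quasi_norm_topology_def by (simp add: topology_inverse')
qed

locale lp_ideal = quasi_norm \<I> qn
  for p :: real and \<I> :: "('a::complex_banach \<Rightarrow>\<^sub>L 'a) set" and qn :: "('a \<Rightarrow>\<^sub>L 'a) \<Rightarrow> real"
    and \<gamma> :: real +
  assumes subset_bounded_ops: "\<I> \<subseteq> bounded_ops"
    and finite_rank_subset: "finite_rank_ops \<subseteq> \<I>"
    and finite_rank_dense: "(quasi_norm_topology \<I> qn) closure_of finite_rank_ops = \<I>"
    and norm_le: "L \<in> \<I> \<Longrightarrow> norm L \<le> qn L"
    and ideal: "L \<in> \<I> \<Longrightarrow> A \<in> bounded_ops \<Longrightarrow> B \<in> bounded_ops \<Longrightarrow> A o\<^sub>L L o\<^sub>L B \<in> \<I>"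
    and ideal_norm: "L \<in> \<I> \<Longrightarrow> A \<in> bounded_ops \<Longrightarrow> B \<in> bounded_ops \<Longrightarrow>
      qn (A o\<^sub>L L o\<^sub>L B) \<le> norm A * qn L * norm B"
    and eigenvalues_summable: "L \<in> \<I> \<Longrightarrow> eigenvalues_p_summable p L"
    and eigenvalue_bound: "L \<in> \<I> \<Longrightarrow> eigenvalue_power_sum p L powr (1 / p) \<le> \<gamma> * qn L"

end

theory Submission
  imports Defs "Jordan_Normal_Form.Schur_Decomposition"
begin

text \<open>
  Put \<open>T = A + K\<close> and \<open>w = 1 / \<lambda>\<close>. For \<open>cmod w * norm A < 1\<close> the operator \<open>I - w T\<close> is the product of
  \<open>I - w K (I - w A)\<inverse>\<close> and the invertible operator \<open>I - w A\<close>. So the eigenvalues of \<open>T\<close> of modulus greater than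
  \<open>norm A\<close> correspond to zeros of the perturbation determinant of \<open>w K (I - w A)\<inverse>\<close>, which is \<open>1\<close> at \<open>w = 0\<close>.
  On the circle \<open>cmod w = 1 / r\<close> the logarithm of its modulus is at most \<open>M(r) = \<Gamma> (\<gamma> qn(K) / (r - norm A))^p\<close>, by the eigenvalue
  inequality of the ideal. Jensen's inequality gives \<open>(s / r)^N \<le> exp M(r)\<close> for the number \<open>N\<close> of eigenvalues beyond
  \<open>s\<close>. Estimating \<open>ln (s / r)\<close> by \<open>(s - r) / s\<close> and taking \<open>r = norm A + p (s - norm A) / (p + 1)\<close> yields the
  result.

  This argument is carried out with finite rank operators \<open>F'\<close> in the place of \<open>K\<close>. A quasi-norm need not be continuous,
  so the bound \<open>M(r)\<close> with \<open>qn(K)\<close> does not follow from the bounds for the approximants; the naive estimate loses a power of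
  the constant in the quasi-triangle inequality. The sharp bound in the limit is \<open>det_p_limit_bound\<close>. It splits
  an element \<open>L\<close> of the ideal by a Riesz projection. The finite rank part carries the large eigenvalues, and these are
  eigenvalues of \<open>L\<close>, so that the eigenvalue inequality can be used for \<open>L\<close> itself. The other part has only small
  eigenvalues, and its determinant is close to \<open>1\<close>. The last fact is of the type of Lidskii's theorem. It holds because
  the determinants of \<open>I - z L'\<close>, for \<open>L'\<close> of finite rank near \<open>L\<close>, are bounded by \<open>exp (\<delta> |z|^p + C)\<close> for every
  \<open>\<delta> > 0\<close> (\<open>det_p_growth\<close>). This growth forces the logarithm of the product over the small eigenvalues, which
  starts with a term of order at least \<open>p\<close>, to be small (\<open>small_factor_product_bound\<close>). The growth estimate
  itself comes from the decomposition \<open>L' = G + F\<close> with a fixed finite rank operator \<open>F\<close> and a small \<open>G\<close>: the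
  determinant of \<open>I - z G - \<zeta> F\<close> is a polynomial in \<open>\<zeta>\<close> of bounded degree.

  Multiplicities are ranks of Riesz projections. If \<open>T = B + F\<close> with \<open>F\<close> of finite rank, then the resolvent of \<open>T\<close> is
  meromorphic outside the disc of radius \<open>norm B\<close>, and the Riesz projection projects onto the generalized
  eigenspace (\<open>riesz_projection_spectral\<close>). The eigenvalues of \<open>A + K\<close> are not
  approximated but kept: if \<open>P\<close> is the spectral projection of finitely many of them, the approximant \<open>F'\<close> can be chosen to agree
  with \<open>K\<close> on the range of \<open>P\<close>, so that its determinant has the required zeros exactly
  (\<open>perturbation_determinant_factor\<close>).
\<close>

section \<open>Determinants and traces of matrices\<close>

definition mat_trace :: "'b::comm_monoid_add mat \<Rightarrow> 'b" where
  "mat_trace M = (\<Sum>i<dim_row M. M $$ (i, i))"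

lemma mat_trace_mult_commute:
  fixes A B :: "'b::comm_semiring_0 mat"
  assumes A: "A \<in> carrier_mat n m" and B: "B \<in> carrier_mat m n"
  shows "mat_trace (A * B) = mat_trace (B * A)"
proof -
  have "mat_trace (A * B) = (\<Sum>i<n. \<Sum>j<m. A $$ (i, j) * B $$ (j, i))"
    using A B by (auto simp: mat_trace_def scalar_prod_def lessThan_atLeast0 intro!: sum.cong)
  also have "\<dots> = (\<Sum>j<m. \<Sum>i<n. B $$ (j, i) * A $$ (i, j))"
    by (subst sum.swap) (simp add: mult.commute)
  also have "\<dots> = mat_trace (B * A)"
    using A B by (auto simp: mat_trace_def scalar_prod_def lessThan_atLeast0 intro!: sum.cong)
  finally show ?thesis .
qed

text \<open>Both sides are the determinant of the block matrix with blocks \<open>1, A, B, 1\<close>, eliminated from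
  above and from below. This identity makes determinants of finite rank operators independent of the
  space on which they are computed.\<close>

lemma sylvester_determinant:
  fixes A B :: "'b::idom mat"
  assumes A: "A \<in> carrier_mat n m" and B: "B \<in> carrier_mat m n"
  shows "Determinant.det (1\<^sub>m n - A * B) = Determinant.det (1\<^sub>m m - B * A)"
proof -
  have AB: "A * B \<in> carrier_mat n n" and BA: "B * A \<in> carrier_mat m m"
    using A B by auto
  let ?X = "four_block_mat (1\<^sub>m n) A B (1\<^sub>m m)"
  have e1: "?X = four_block_mat (1\<^sub>m n) (0\<^sub>m n m) B (1\<^sub>m m) *
        four_block_mat (1\<^sub>m n) A (0\<^sub>m m n) (1\<^sub>m m - B * A)"
    by (subst mult_four_block_mat[of _ n n _ m _ m _ _ n _ m])
      (use A B BA in \<open>auto intro!: arg_cong2[of _ _ _ _ "four_block_mat (1\<^sub>m n) A"]\<close>)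
  have e2: "?X = four_block_mat (1\<^sub>m n) A (0\<^sub>m m n) (1\<^sub>m m) *
        four_block_mat (1\<^sub>m n - A * B) (0\<^sub>m n m) B (1\<^sub>m m)"
    by (subst mult_four_block_mat[of _ n n _ m _ m _ _ n _ m])
      (use A B AB in \<open>auto intro!: arg_cong2[of _ _ _ _ "\<lambda>x y. four_block_mat x y B (1\<^sub>m m)"]\<close>)
  have d1: "Determinant.det (four_block_mat (1\<^sub>m n) (0\<^sub>m n m) B (1\<^sub>m m)) = 1"
    using det_four_block_mat_upper_right_zero[OF one_carrier_mat refl B one_carrier_mat] by simp
  have d2: "Determinant.det (four_block_mat (1\<^sub>m n) A (0\<^sub>m m n) (1\<^sub>m m - B * A))
      = Determinant.det (1\<^sub>m m - B * A)"
    using det_four_block_mat_lower_left_zero[OF one_carrier_mat A refl minus_carrier_mat[OF BA]] by simp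
  have d3: "Determinant.det (four_block_mat (1\<^sub>m n) A (0\<^sub>m m n) (1\<^sub>m m)) = 1"
    using det_four_block_mat_lower_left_zero[OF one_carrier_mat A refl one_carrier_mat] by simp
  have d4: "Determinant.det (four_block_mat (1\<^sub>m n - A * B) (0\<^sub>m n m) B (1\<^sub>m m))
      = Determinant.det (1\<^sub>m n - A * B)"
    using det_four_block_mat_upper_right_zero[OF minus_carrier_mat[OF AB] refl B one_carrier_mat] by simp
  have "Determinant.det ?X = Determinant.det (1\<^sub>m m - B * A)"
    unfolding e1 using A B BA by (subst det_mult[of _ "n + m"]) (auto simp: d1 d2)
  moreover have "Determinant.det ?X = Determinant.det (1\<^sub>m n - A * B)"
    unfolding e2 using A B AB by (subst det_mult[of _ "n + m"]) (auto simp: d3 d4)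
  ultimately show ?thesis by simp
qed

lemma upper_triangular_mult:
  fixes A B :: "'b::comm_semiring_0 mat"
  assumes A: "A \<in> carrier_mat n n" "upper_triangular A"
    and B: "B \<in> carrier_mat n n" "upper_triangular B"
  shows "upper_triangular (A * B)"
    and "i < n \<Longrightarrow> (A * B) $$ (i, i) = A $$ (i, i) * B $$ (i, i)"
proof -
  have e: "(A * B) $$ (i, j) = (\<Sum>k<n. A $$ (i, k) * B $$ (k, j))" if "i < n" "j < n" for i j
    using A B that by (auto simp: scalar_prod_def lessThan_atLeast0 intro!: sum.cong)
  have z: "A $$ (i, k) * B $$ (k, j) = 0" if "i < n" "j < n" "k < n" "j < i \<or> j = i \<and> k \<noteq> i" for i j k
  proof (cases "k < i")
    case True
    then show ?thesis using upper_triangularD[OF A(2), of k i] that A by simp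
  next
    case False
    then show ?thesis using upper_triangularD[OF B(2), of j k] that B by auto
  qed
  show "upper_triangular (A * B)"
  proof (rule upper_triangularI)
    fix i j assume ij: "j < i" "i < dim_row (A * B)"
    then have i: "i < n" "j < n" using A by auto
    show "(A * B) $$ (i, j) = 0"
      unfolding e[OF i] using z[OF i] ij(1) by (intro sum.neutral) auto
  qed
  show "(A * B) $$ (i, i) = A $$ (i, i) * B $$ (i, i)" if i: "i < n"
  proof -
    have "(A * B) $$ (i, i) = (\<Sum>k\<in>{i}. A $$ (i, k) * B $$ (k, i))"
      unfolding e[OF i i] using z[OF i i] i
      by (intro sum.mono_neutral_right) (auto)
    then show ?thesis by simp
  qed
qed

lemma upper_triangular_power:
  fixes A :: "'b::comm_semiring_1 mat"
  assumes A: "A \<in> carrier_mat n n" "upper_triangular A"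
  shows "upper_triangular (A ^\<^sub>m k) \<and> (\<forall>i<n. (A ^\<^sub>m k) $$ (i, i) = A $$ (i, i) ^ k)"
proof (induction k)
  case 0
  then show ?case using A by (auto intro!: upper_triangularI)
next
  case (Suc k)
  have c: "A ^\<^sub>m k \<in> carrier_mat n n" using A by (simp add: pow_carrier_mat)
  show ?case
    using upper_triangular_mult[OF c _ A] Suc by (auto simp: mult.commute)
qed

text \<open>Everything can be read off from the diagonal of a Schur triangular form.\<close>

lemma eigenvalue_list_matrix:
  fixes M :: "complex mat"
  assumes M: "M \<in> carrier_mat n n"
  shows "\<exists>ls. length ls = n \<and>
    (\<forall>z. Determinant.det (1\<^sub>m n - z \<cdot>\<^sub>m M) = (\<Prod>l\<leftarrow>ls. 1 - z * l)) \<and>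
    (\<forall>k. mat_trace (M ^\<^sub>m k) = (\<Sum>l\<leftarrow>ls. l ^ k)) \<and>
    (\<forall>l\<in>set ls. \<exists>v\<in>carrier_vec n. v \<noteq> 0\<^sub>v n \<and> M *\<^sub>v v = l \<cdot>\<^sub>v v)"
proof -
  obtain ls where ls: "char_poly M = (\<Prod>a\<leftarrow>ls. [:- a, 1:])" "length ls = n"
    using char_poly_factorized[OF M] by blast
  obtain U P Q where sd: "schur_decomposition M ls = (U, P, Q)"
    by (cases "schur_decomposition M ls") auto
  from schur_decomposition[OF M ls(1) sd]
  have sim: "similar_mat_wit M U P Q" and ut: "upper_triangular U" and dg: "diag_mat U = ls" by auto
  have U: "U \<in> carrier_mat n n" and P: "P \<in> carrier_mat n n" and Q: "Q \<in> carrier_mat n n"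
    and PQ: "P * Q = 1\<^sub>m n" and QP: "Q * P = 1\<^sub>m n" and MU: "M = P * U * Q"
    using similar_mat_witD2[OF M sim] by auto
  have lsU: "ls = map (\<lambda>i. U $$ (i, i)) [0..<n]"
    using dg U by (auto simp: diag_mat_def)
  have det: "Determinant.det (1\<^sub>m n - z \<cdot>\<^sub>m M) = (\<Prod>l\<leftarrow>ls. 1 - z * l)" for z
  proof -
    have "z \<cdot>\<^sub>m M = P * ((z \<cdot>\<^sub>m U) * Q)"
      unfolding MU using P U Q
      by (simp add: assoc_mult_mat[of _ n n _ n _ n] mult_smult_distrib[of _ n n _ n]
          mult_smult_assoc_mat[of _ n n _ n])
    then have "Determinant.det (1\<^sub>m n - z \<cdot>\<^sub>m M) = Determinant.det (1\<^sub>m n - ((z \<cdot>\<^sub>m U) * Q) * P)"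
      using sylvester_determinant[OF P, of "(z \<cdot>\<^sub>m U) * Q"] mult_carrier_mat[OF smult_carrier_mat[OF U] Q]
      by simp
    also have "((z \<cdot>\<^sub>m U) * Q) * P = z \<cdot>\<^sub>m U"
      using P U Q QP by (subst assoc_mult_mat[of _ n n _ n _ n]) auto
    also have "Determinant.det (1\<^sub>m n - z \<cdot>\<^sub>m U) = prod_list (diag_mat (1\<^sub>m n - z \<cdot>\<^sub>m U))"
    proof (rule det_upper_triangular)
      show "upper_triangular (1\<^sub>m n - z \<cdot>\<^sub>m U)"
        using ut U by (auto intro!: upper_triangularI dest: upper_triangularD)
    qed (use U in auto)
    also have "diag_mat (1\<^sub>m n - z \<cdot>\<^sub>m U) = map (\<lambda>l. 1 - z * l) ls"
      using U by (auto simp: diag_mat_def lsU)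
    finally show ?thesis .
  qed
  have tr: "mat_trace (M ^\<^sub>m k) = (\<Sum>l\<leftarrow>ls. l ^ k)" for k
  proof -
    have Uk: "U ^\<^sub>m k \<in> carrier_mat n n" using U by (simp add: pow_carrier_mat)
    have "M ^\<^sub>m k = P * (U ^\<^sub>m k * Q)"
      using similar_mat_wit_pow_id[OF sim, of k] P Q Uk by (simp add: assoc_mult_mat[of _ n n _ n _ n])
    then have "mat_trace (M ^\<^sub>m k) = mat_trace ((U ^\<^sub>m k * Q) * P)"
      using mat_trace_mult_commute[of P n n "U ^\<^sub>m k * Q"] P Uk Q by simp
    also have "(U ^\<^sub>m k * Q) * P = U ^\<^sub>m k"
      using P Uk Q QP by (subst assoc_mult_mat[of _ n n _ n _ n]) auto
    also have "mat_trace (U ^\<^sub>m k) = (\<Sum>i<n. U $$ (i, i) ^ k)"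
      using upper_triangular_power[OF U ut, of k] Uk U by (simp add: mat_trace_def)
    also have "\<dots> = (\<Sum>l\<leftarrow>ls. l ^ k)"
      by (simp add: lsU interv_sum_list_conv_sum_set_nat lessThan_atLeast0 o_def)
    finally show ?thesis .
  qed
  have ev: "\<exists>v\<in>carrier_vec n. v \<noteq> 0\<^sub>v n \<and> M *\<^sub>v v = l \<cdot>\<^sub>v v" if "l \<in> set ls" for l
  proof -
    have "poly (char_poly M) l = 0"
      unfolding ls(1) using that by (auto simp: poly_prod_list prod_list_zero_iff)
    then have "eigenvalue M l" using eigenvalue_root_char_poly[OF M] by simp
    then show ?thesis using M by (auto simp: eigenvalue_def eigenvector_def)
  qed
  show ?thesis using ls(2) det tr ev by blast
qed

text \<open>The Leibniz expansion has \<open>n!\<close> terms.\<close>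

lemma det_norm_bound:
  fixes M :: "complex mat"
  assumes M: "M \<in> carrier_mat n n" and B: "\<And>i j. i < n \<Longrightarrow> j < n \<Longrightarrow> cmod (M $$ (i, j)) \<le> B"
  shows "cmod (Determinant.det M) \<le> fact n * B ^ n"
proof -
  have "cmod (Determinant.det M) \<le>
      (\<Sum>p\<in>{p. p permutes {0..<n}}. cmod (signof p * (\<Prod>i = 0..<n. M $$ (i, p i))))"
    unfolding det_def'[OF M] by (rule norm_sum)
  also have "\<dots> \<le> (\<Sum>p\<in>{p. p permutes {0..<n}}. B ^ n)"
  proof (rule sum_mono)
    fix p assume "p \<in> {p. p permutes {0..<n}}"
    then have p: "p permutes {0..<n}" by simp
    have "cmod (signof p :: complex) = 1" by (simp add: sign_def)
    moreover have "(\<Prod>i = 0..<n. cmod (M $$ (i, p i))) \<le> (\<Prod>i = 0..<n. B)"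
    proof (rule prod_mono)
      fix i assume i: "i \<in> {0..<n}"
      then have "p i \<in> {0..<n}" using permutes_in_image[OF p] by blast
      then show "0 \<le> cmod (M $$ (i, p i)) \<and> cmod (M $$ (i, p i)) \<le> B" using B[of i "p i"] i by auto
    qed
    ultimately show "cmod (signof p * (\<Prod>i = 0..<n. M $$ (i, p i))) \<le> B ^ n"
      by (simp add: norm_mult prod_norm)
  qed
  also have "\<dots> = fact n * B ^ n"
    by (simp add: card_permutations[of _ n])
  finally show ?thesis .
qed

text \<open>Cramer's rule: the only loss in the size of the solution is one division by the
  determinant. This is what bounds the order of the poles of a resolvent below.\<close>

lemma matrix_solve_bound:
  fixes M :: "complex mat"
  assumes M: "M \<in> carrier_mat n n" and d: "Determinant.det M \<noteq> 0"
    and B: "\<And>i j. i < n \<Longrightarrow> j < n \<Longrightarrow> cmod (M $$ (i, j)) \<le> B" and B1: "1 \<le> B"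
    and y: "y \<in> carrier_vec n" and yb: "\<And>i. i < n \<Longrightarrow> cmod (vec_index y i) \<le> b"
  shows "\<exists>c\<in>carrier_vec n. M *\<^sub>v c = y \<and>
    (\<forall>i<n. cmod (vec_index c i) \<le> real n * (fact n * B ^ n) * b / cmod (Determinant.det M))"
proof -
  let ?A = "adj_mat M" and ?d = "Determinant.det M"
  have A: "?A \<in> carrier_mat n n" and MA: "M * ?A = ?d \<cdot>\<^sub>m 1\<^sub>m n" using adj_mat[OF M] by auto
  have Ab: "cmod (?A $$ (i, j)) \<le> fact n * B ^ n" if ij: "i < n" "j < n" for i j
  proof -
    have c: "mat_delete M j i \<in> carrier_mat (n - 1) (n - 1)" using mat_delete_carrier[OF M] .
    have "cmod (?A $$ (i, j)) = cmod (Determinant.det (mat_delete M j i))"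
      using M ij by (simp add: adj_mat_def cofactor_def norm_mult norm_power)
    also have "\<dots> \<le> fact (n - 1) * B ^ (n - 1)"
    proof (rule det_norm_bound[OF c])
      fix i' j' assume "i' < n - 1" "j' < n - 1"
      then show "cmod (mat_delete M j i $$ (i', j')) \<le> B"
        using M ij by (auto simp: mat_delete_def intro!: B)
    qed
    also have "\<dots> \<le> fact n * B ^ n"
      using B1 by (intro mult_mono fact_mono power_increasing) auto
    finally show ?thesis .
  qed
  define c where "c = (1 / ?d) \<cdot>\<^sub>v (?A *\<^sub>v y)"
  have "M *\<^sub>v c = (1 / ?d) \<cdot>\<^sub>v (M *\<^sub>v (?A *\<^sub>v y))"
    unfolding c_def using M A y by (subst mult_mat_vec) auto
  also have "M *\<^sub>v (?A *\<^sub>v y) = ?d \<cdot>\<^sub>v y"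
  proof -
    have "M *\<^sub>v (?A *\<^sub>v y) = (?d \<cdot>\<^sub>m 1\<^sub>m n) *\<^sub>v y"
      using assoc_mult_mat_vec[OF M A y] MA by simp
    also have "\<dots> = ?d \<cdot>\<^sub>v y"
      using y by (intro eq_vecI) (auto simp: row_smult)
    finally show ?thesis .
  qed
  finally have Mc: "M *\<^sub>v c = y" using d by (simp add: smult_smult_assoc)
  have "cmod (vec_index c i) \<le> real n * (fact n * B ^ n) * b / cmod ?d" if i: "i < n" for i
  proof -
    have "cmod (vec_index (?A *\<^sub>v y) i) = cmod (\<Sum>j\<in>{0..<n}. ?A $$ (i, j) * vec_index y j)"
      using A y i by (auto simp: scalar_prod_def intro!: arg_cong[of _ _ cmod] sum.cong)
    also have "\<dots> \<le> (\<Sum>j\<in>{0..<n}. cmod (?A $$ (i, j)) * cmod (vec_index y j))"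
      by (rule order_trans[OF norm_sum]) (simp add: norm_mult)
    also have "\<dots> \<le> (\<Sum>j\<in>{0..<n}. (fact n * B ^ n) * b)"
      using Ab[OF i] yb B1 by (intro sum_mono mult_mono) auto
    also have "\<dots> = real n * (fact n * B ^ n) * b" by simp
    finally show ?thesis
      using A y i by (simp add: c_def norm_divide divide_right_mono)
  qed
  moreover have "c \<in> carrier_vec n" using A y by (auto simp: c_def)
  ultimately show ?thesis using Mc by blast
qed

section \<open>Complex linear and finite rank operators\<close>

lemma blinfun_scaleC_apply [simp]: "blinfun_apply (c *\<^sub>C f) x = c *\<^sub>C blinfun_apply f x"
  by (simp add: scaleC_blinfun.rep_eq)

lemma bounded_ops_apply: "T \<in> bounded_ops \<Longrightarrow> blinfun_apply T (c *\<^sub>C x) = c *\<^sub>C blinfun_apply T x"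
  by (simp add: bounded_ops_def)

lemma bounded_opsI: "(\<And>c x. blinfun_apply T (c *\<^sub>C x) = c *\<^sub>C blinfun_apply T x) \<Longrightarrow> T \<in> bounded_ops"
  by (simp add: bounded_ops_def)

lemma bounded_ops_intros [simp, intro]:
  "0 \<in> bounded_ops" "id_blinfun \<in> bounded_ops"
  "T \<in> bounded_ops \<Longrightarrow> S \<in> bounded_ops \<Longrightarrow> T + S \<in> bounded_ops"
  "T \<in> bounded_ops \<Longrightarrow> S \<in> bounded_ops \<Longrightarrow> T - S \<in> bounded_ops"
  "T \<in> bounded_ops \<Longrightarrow> - T \<in> bounded_ops"
  "T \<in> bounded_ops \<Longrightarrow> S \<in> bounded_ops \<Longrightarrow> T o\<^sub>L S \<in> bounded_ops"
  "T \<in> bounded_ops \<Longrightarrow> c *\<^sub>C T \<in> bounded_ops"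
  by (auto simp: bounded_ops_def blinfun.add_left blinfun.diff_left blinfun.minus_left
      complex_vector.scale_right_distrib complex_vector.scale_right_diff_distrib mult.commute)

lemma bounded_ops_apply_sum:
  "T \<in> bounded_ops \<Longrightarrow> blinfun_apply T (\<Sum>i\<in>A. c i *\<^sub>C x i) = (\<Sum>i\<in>A. c i *\<^sub>C blinfun_apply T (x i))"
  by (simp add: blinfun.sum_right bounded_ops_apply)

lemma op_power_simps [simp]: "op_power T 0 = id_blinfun" "op_power T (Suc k) = T o\<^sub>L op_power T k"
  by (simp_all add: op_power_def)

lemma bounded_ops_power [simp, intro]: "T \<in> bounded_ops \<Longrightarrow> op_power T k \<in> bounded_ops"
  by (induction k) auto

lemma compose_add_left: "(S + T) o\<^sub>L U = (S o\<^sub>L U) + (T o\<^sub>L U)"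
  by (rule blinfun_eqI) (simp add: blinfun.add_left)
lemma compose_diff_left: "(S - T) o\<^sub>L U = (S o\<^sub>L U) - (T o\<^sub>L U)"
  by (rule blinfun_eqI) (simp add: blinfun.diff_left)
lemma compose_add_right: "U o\<^sub>L (S + T) = (U o\<^sub>L S) + (U o\<^sub>L T)"
  by (rule blinfun_eqI) (simp add: blinfun.add_left blinfun.add_right)
lemma compose_diff_right: "U o\<^sub>L (S - T) = (U o\<^sub>L S) - (U o\<^sub>L T)"
  by (rule blinfun_eqI) (simp add: blinfun.diff_left blinfun.diff_right)
lemma compose_id [simp]: "id_blinfun o\<^sub>L T = T" "T o\<^sub>L id_blinfun = T"
  by (auto intro!: blinfun_eqI)
lemma compose_zero [simp]: "0 o\<^sub>L T = 0" "T o\<^sub>L 0 = 0"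
  by (auto intro!: blinfun_eqI)
lemma compose_scaleC_left: "(c *\<^sub>C T) o\<^sub>L U = c *\<^sub>C (T o\<^sub>L U)"
  by (rule blinfun_eqI) simp
lemma compose_scaleC_right: "T \<in> bounded_ops \<Longrightarrow> T o\<^sub>L (c *\<^sub>C U) = c *\<^sub>C (T o\<^sub>L U)"
  by (rule blinfun_eqI) (simp add: bounded_ops_apply)
lemma compose_assoc: "(S o\<^sub>L T) o\<^sub>L U = S o\<^sub>L (T o\<^sub>L U)"
  by (rule blinfun_eqI) simp

lemma finite_rank_ops_bounded: "F \<in> finite_rank_ops \<Longrightarrow> F \<in> bounded_ops"
  by (simp add: finite_rank_ops_def)

lemma finite_rank_compose_right: "finite_rank F \<Longrightarrow> finite_rank (F o\<^sub>L T)"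
  unfolding finite_rank_def by (auto simp: image_subset_iff)

lemma finite_rank_compose_left:
  assumes T: "T \<in> bounded_ops" and F: "finite_rank F"
  shows "finite_rank (T o\<^sub>L F)"
proof -
  obtain S where S: "finite S" "range (blinfun_apply F) \<subseteq> complex_vector.span S"
    using F by (auto simp: finite_rank_def)
  have "blinfun_apply T v \<in> complex_vector.span (blinfun_apply T ` S)" if "v \<in> complex_vector.span S" for v
    using that
  proof (induction rule: complex_vector.span_induct_alt)
    case base then show ?case by (simp add: complex_vector.span_zero)
  next
    case (step c x y)
    then have "blinfun_apply T x \<in> complex_vector.span (blinfun_apply T ` S)"
      by (intro complex_vector.span_base) auto
    with step show ?case
      by (auto simp: blinfun.add_right bounded_ops_apply[OF T]
          intro!: complex_vector.span_add complex_vector.span_scale)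
  qed
  then show ?thesis unfolding finite_rank_def
    using S by (intro exI[of _ "blinfun_apply T ` S"]) auto
qed

lemma finite_rank_add:
  assumes "finite_rank F" "finite_rank G" shows "finite_rank (F + G)"
proof -
  obtain S S' where "finite S" "range (blinfun_apply F) \<subseteq> complex_vector.span S"
      "finite S'" "range (blinfun_apply G) \<subseteq> complex_vector.span S'"
    using assms by (auto simp: finite_rank_def)
  moreover have "blinfun_apply F x + blinfun_apply G x \<in> complex_vector.span (S \<union> S')"
    if "blinfun_apply F x \<in> complex_vector.span S" "blinfun_apply G x \<in> complex_vector.span S'" for x
    using that complex_vector.span_mono[of S "S \<union> S'"] complex_vector.span_mono[of S' "S \<union> S'"]
    by (auto intro!: complex_vector.span_add)
  ultimately show ?thesis
    unfolding finite_rank_def by (intro exI[of _ "S \<union> S'"]) (auto simp: blinfun.add_left)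
qed

lemma finite_rank_scaleC: "finite_rank F \<Longrightarrow> finite_rank (c *\<^sub>C F)"
  unfolding finite_rank_def by (auto simp: subset_iff intro: complex_vector.span_scale)

lemma finite_rank_ops_intros [simp, intro]:
  "0 \<in> finite_rank_ops"
  "F \<in> finite_rank_ops \<Longrightarrow> G \<in> finite_rank_ops \<Longrightarrow> F + G \<in> finite_rank_ops"
  "F \<in> finite_rank_ops \<Longrightarrow> c *\<^sub>C F \<in> finite_rank_ops"
  "F \<in> finite_rank_ops \<Longrightarrow> T \<in> bounded_ops \<Longrightarrow> T o\<^sub>L F \<in> finite_rank_ops"
  "F \<in> finite_rank_ops \<Longrightarrow> T \<in> bounded_ops \<Longrightarrow> F o\<^sub>L T \<in> finite_rank_ops"
proof -
  show "0 \<in> finite_rank_ops"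
    by (auto simp: finite_rank_ops_def finite_rank_def complex_vector.span_zero)
qed (auto simp: finite_rank_ops_def finite_rank_add finite_rank_scaleC finite_rank_compose_left
    finite_rank_compose_right)

lemma finite_rank_ops_diff [simp, intro]:
  assumes "F \<in> finite_rank_ops" "G \<in> finite_rank_ops" shows "F - G \<in> finite_rank_ops"
proof -
  have "F - G = F + (-1) *\<^sub>C G"
    by (rule blinfun_eqI) (simp add: blinfun.add_left blinfun.diff_left)
  then show ?thesis using assms by (simp only: finite_rank_ops_intros)
qed

lemma finite_rank_ops_sum [intro]:
  "(\<And>i. i \<in> A \<Longrightarrow> F i \<in> finite_rank_ops) \<Longrightarrow> (\<Sum>i\<in>A. F i) \<in> finite_rank_ops"
  by (induction A rule: infinite_finite_induct) auto

lemma finite_rank_ops_power: "F \<in> finite_rank_ops \<Longrightarrow> 0 < k \<Longrightarrow> op_power F k \<in> finite_rank_ops"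
  by (cases k) (auto simp: finite_rank_ops_bounded)

section \<open>Coordinates in finite dimensional subspaces\<close>

definition basis_list :: "'a::complex_vector list \<Rightarrow> bool" where
  "basis_list bs \<longleftrightarrow> distinct bs \<and> \<not> complex_vector.dependent (set bs)"

abbreviation coord :: "'a::complex_vector list \<Rightarrow> 'a \<Rightarrow> nat \<Rightarrow> complex" where
  "coord bs v i \<equiv> complex_vector.representation (set bs) v (bs ! i)"

abbreviation lspan :: "'a::complex_vector list \<Rightarrow> 'a set" where
  "lspan bs \<equiv> complex_vector.span (set bs)"

lemma sum_coord:
  assumes "basis_list bs" "v \<in> lspan bs"
  shows "(\<Sum>i<length bs. coord bs v i *\<^sub>C bs ! i) = v"
proof -
  have "(\<Sum>i<length bs. coord bs v i *\<^sub>C bs ! i) =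
      (\<Sum>b\<in>set bs. complex_vector.representation (set bs) v b *\<^sub>C b)"
    using assms by (intro sum.reindex_bij_betw bij_betw_nth) (auto simp: basis_list_def)
  also have "\<dots> = v"
    using assms by (intro complex_vector.sum_representation_eq) (auto simp: basis_list_def)
  finally show ?thesis .
qed

lemma coord_basis:
  assumes "basis_list bs" "i < length bs" "j < length bs"
  shows "coord bs (bs ! j) i = (if i = j then 1 else 0)"
  using assms complex_vector.representation_basis[of "set bs" "bs ! j"]
  by (auto simp: basis_list_def nth_eq_iff_index_eq)

lemma coord_sum:
  assumes "basis_list bs" "\<And>k. k \<in> A \<Longrightarrow> v k \<in> lspan bs"
  shows "coord bs (\<Sum>k\<in>A. c k *\<^sub>C v k) i = (\<Sum>k\<in>A. c k * coord bs (v k) i)"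
  using assms
  by (subst complex_vector.representation_sum)
    (auto simp: basis_list_def complex_vector.span_scale complex_vector.representation_scale)

lemma coord_combination:
  assumes "basis_list bs" "i < length bs"
  shows "coord bs (\<Sum>k<length bs. c k *\<^sub>C bs ! k) i = c i"
  using assms by (subst coord_sum) (auto simp: coord_basis complex_vector.span_base if_distrib cong: if_cong)

lemma basis_list_exists:
  assumes "finite S" obtains bs where "basis_list bs" "lspan bs = complex_vector.span S"
proof -
  obtain B where B: "B \<subseteq> S" "\<not> complex_vector.dependent B" "S \<subseteq> complex_vector.span B"
    using complex_vector.basis_exists[of S] by metis
  have "finite B" using B(1) assms finite_subset by auto
  then obtain bs where "set bs = B" "distinct bs" using finite_distinct_list by auto
  moreover have "complex_vector.span B = complex_vector.span S"
    using B by (metis complex_vector.span_mono complex_vector.span_span subset_antisym)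
  ultimately show ?thesis using B that by (auto simp: basis_list_def)
qed

lemma finite_rank_ops_basis:
  assumes "finite \<F>" "\<F> \<subseteq> finite_rank_ops"
  obtains bs where "basis_list bs" "\<And>F. F \<in> \<F> \<Longrightarrow> range (blinfun_apply F) \<subseteq> lspan bs"
proof -
  have "\<forall>F\<in>\<F>. \<exists>S. finite S \<and> range (blinfun_apply F) \<subseteq> complex_vector.span S"
    using assms(2) by (auto simp: finite_rank_ops_def finite_rank_def)
  then obtain S where S: "\<And>F. F \<in> \<F> \<Longrightarrow> finite (S F)"
      "\<And>F. F \<in> \<F> \<Longrightarrow> range (blinfun_apply F) \<subseteq> complex_vector.span (S F)" by metis
  obtain bs where bs: "basis_list bs" "lspan bs = complex_vector.span (\<Union>F\<in>\<F>. S F)"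
    using basis_list_exists[of "\<Union>F\<in>\<F>. S F"] assms(1) S(1) by auto
  show ?thesis
  proof
    fix F assume "F \<in> \<F>"
    then have "complex_vector.span (S F) \<subseteq> lspan bs"
      unfolding bs(2) by (intro complex_vector.span_mono) auto
    then show "range (blinfun_apply F) \<subseteq> lspan bs" using S(2)[OF \<open>F \<in> \<F>\<close>] by blast
  qed (fact bs(1))
qed

lemma subspace_range:
  assumes "T \<in> bounded_ops" shows "complex_vector.subspace (range (blinfun_apply T))"
proof (rule complex_vector.subspaceI)
  show "0 \<in> range (blinfun_apply T)" by (metis blinfun.zero_right rangeI)
  show "x + y \<in> range (blinfun_apply T)"
    if "x \<in> range (blinfun_apply T)" "y \<in> range (blinfun_apply T)" for x y
    using that by (auto simp flip: blinfun.add_right)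
  show "c *\<^sub>C x \<in> range (blinfun_apply T)" if "x \<in> range (blinfun_apply T)" for c x
    using that bounded_ops_apply[OF assms] by (metis rangeE rangeI)
qed

lemma range_basis_list:
  assumes "F \<in> finite_rank_ops"
  shows "basis_list (range_basis F)" "lspan (range_basis F) = range (blinfun_apply F)"
proof -
  obtain S where S: "finite S" "range (blinfun_apply F) \<subseteq> complex_vector.span S"
    using assms by (auto simp: finite_rank_ops_def finite_rank_def)
  obtain B where B: "B \<subseteq> range (blinfun_apply F)" "\<not> complex_vector.dependent B"
      "range (blinfun_apply F) \<subseteq> complex_vector.span B"
    using complex_vector.basis_exists[of "range (blinfun_apply F)"] by metis
  have "finite B"
    using complex_vector.independent_span_bound[OF S(1) B(2)] B(1) S(2) by auto
  then obtain bs where bs: "set bs = B" "distinct bs" using finite_distinct_list by auto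
  have "complex_vector.subspace (range (blinfun_apply F))"
    using assms by (intro subspace_range finite_rank_ops_bounded)
  then have "complex_vector.span B = range (blinfun_apply F)"
    using complex_vector.span_minimal[OF B(1)] B(3) by (intro subset_antisym)
  then have "distinct bs \<and> \<not> complex_vector.dependent (set bs)
        \<and> complex_vector.span (set bs) = range (blinfun_apply F)" using B bs by auto
  then have "distinct (range_basis F) \<and> \<not> complex_vector.dependent (set (range_basis F))
        \<and> complex_vector.span (set (range_basis F)) = range (blinfun_apply F)"
    unfolding range_basis_def by (rule someI)
  then show "basis_list (range_basis F)" "lspan (range_basis F) = range (blinfun_apply F)"
    by (auto simp: basis_list_def)
qed

section \<open>Determinants and traces of finite rank operators\<close>

text \<open>Source and target may carry different bases, so that inclusions between subspaces have
  matrices as well.\<close>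

definition coord_matrix :: "'a::complex_vector list \<Rightarrow> 'a list \<Rightarrow> ('a \<Rightarrow> 'a) \<Rightarrow> complex mat" where
  "coord_matrix cs bs X = Matrix.mat (length cs) (length bs) (\<lambda>(i, j). coord cs (X (bs ! j)) i)"

lemma coord_matrix_carrier [simp]: "coord_matrix cs bs X \<in> carrier_mat (length cs) (length bs)"
  "dim_row (coord_matrix cs bs X) = length cs" "dim_col (coord_matrix cs bs X) = length bs"
  by (simp_all add: coord_matrix_def)

lemma coord_matrix_index [simp]:
  "i < length cs \<Longrightarrow> j < length bs \<Longrightarrow> coord_matrix cs bs X $$ (i, j) = coord cs (X (bs ! j)) i"
  by (simp add: coord_matrix_def)

lemma coord_matrix_compose:
  assumes "basis_list bs" "basis_list cs" "basis_list ds" and Y: "Y \<in> bounded_ops"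
    and X: "\<And>b. b \<in> set bs \<Longrightarrow> X b \<in> lspan cs"
    and YX: "\<And>c. c \<in> set cs \<Longrightarrow> blinfun_apply Y c \<in> lspan ds"
  shows "coord_matrix ds bs (\<lambda>x. blinfun_apply Y (X x)) = coord_matrix ds cs (blinfun_apply Y) * coord_matrix cs bs X"
proof (rule eq_matI)
  fix i j
  assume "i < dim_row (coord_matrix ds cs (blinfun_apply Y) * coord_matrix cs bs X)"
    "j < dim_col (coord_matrix ds cs (blinfun_apply Y) * coord_matrix cs bs X)"
  then have i: "i < length ds" and j: "j < length bs" by auto
  have "blinfun_apply Y (X (bs ! j)) = blinfun_apply Y (\<Sum>k<length cs. coord cs (X (bs ! j)) k *\<^sub>C cs ! k)"
    using sum_coord[OF assms(2) X, of "bs ! j"] j by simp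
  also have "\<dots> = (\<Sum>k<length cs. coord cs (X (bs ! j)) k *\<^sub>C blinfun_apply Y (cs ! k))"
    by (rule bounded_ops_apply_sum[OF Y])
  finally have "coord ds (blinfun_apply Y (X (bs ! j))) i =
      (\<Sum>k<length cs. coord cs (X (bs ! j)) k * coord ds (blinfun_apply Y (cs ! k)) i)"
    using coord_sum[OF assms(3), of "{..<length cs}" "\<lambda>k. blinfun_apply Y (cs ! k)"] YX by simp
  then show "coord_matrix ds bs (\<lambda>x. blinfun_apply Y (X x)) $$ (i, j) =
      (coord_matrix ds cs (blinfun_apply Y) * coord_matrix cs bs X) $$ (i, j)"
    using i j by (auto simp: scalar_prod_def lessThan_atLeast0 mult.commute intro!: sum.cong)
qed auto

lemma range_matrix_eq: "range_matrix F = coord_matrix (range_basis F) (range_basis F) (blinfun_apply F)"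
  by (simp add: range_matrix_def coord_matrix_def Let_def)

definition det_wrt :: "'a::complex_normed_vector list \<Rightarrow> ('a \<Rightarrow>\<^sub>L 'a) \<Rightarrow> complex" where
  "det_wrt bs F = Determinant.det (1\<^sub>m (length bs) - coord_matrix bs bs (blinfun_apply F))"

definition trace_wrt :: "'a::complex_normed_vector list \<Rightarrow> ('a \<Rightarrow>\<^sub>L 'a) \<Rightarrow> complex" where
  "trace_wrt bs F = mat_trace (coord_matrix bs bs (blinfun_apply F))"

text \<open>The two coordinate matrices are \<open>M N\<close> and \<open>N M\<close>, so this is the Sylvester identity. With the
  identity for one of the operators it says that the choice of the space and of its basis is irrelevant.\<close>

lemma det_trace_wrt_commute:
  assumes bs: "basis_list bs" "basis_list cs" and X: "X \<in> bounded_ops" and Y: "Y \<in> bounded_ops"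
    and X': "blinfun_apply X ` set bs \<subseteq> lspan cs" and Y': "blinfun_apply Y ` set cs \<subseteq> lspan bs"
  shows "det_wrt cs (X o\<^sub>L Y) = det_wrt bs (Y o\<^sub>L X)" "trace_wrt cs (X o\<^sub>L Y) = trace_wrt bs (Y o\<^sub>L X)"
proof -
  have c: "coord_matrix cs cs (blinfun_apply (X o\<^sub>L Y)) = coord_matrix cs bs (blinfun_apply X) * coord_matrix bs cs (blinfun_apply Y)"
    using coord_matrix_compose[OF bs(2,1,2) X, of "blinfun_apply Y"] X' Y'
    by (auto simp: blinfun_compose.rep_eq o_def)
  have b: "coord_matrix bs bs (blinfun_apply (Y o\<^sub>L X)) = coord_matrix bs cs (blinfun_apply Y) * coord_matrix cs bs (blinfun_apply X)"
    using coord_matrix_compose[OF bs(1,2,1) Y, of "blinfun_apply X"] X' Y'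
    by (auto simp: blinfun_compose.rep_eq o_def)
  show "det_wrt cs (X o\<^sub>L Y) = det_wrt bs (Y o\<^sub>L X)"
    unfolding det_wrt_def b c by (rule sylvester_determinant) auto
  show "trace_wrt cs (X o\<^sub>L Y) = trace_wrt bs (Y o\<^sub>L X)"
    unfolding trace_wrt_def b c by (rule mat_trace_mult_commute) auto
qed

text \<open>Several operators can thus be treated in one common basis.\<close>

lemma det_id_minus_wrt:
  assumes F: "F \<in> bounded_ops" and bs: "basis_list bs" "range (blinfun_apply F) \<subseteq> lspan bs"
  shows "det_id_minus F = det_wrt bs F" "op_trace F = trace_wrt bs F" "F \<in> finite_rank_ops"
proof -
  show F': "F \<in> finite_rank_ops"
    using assms by (auto simp: finite_rank_ops_def finite_rank_def)
  note r = range_basis_list[OF F']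
  have "det_id_minus F = det_wrt (range_basis F) F" "op_trace F = trace_wrt (range_basis F) F"
    by (simp_all add: det_id_minus_def det_wrt_def op_trace_def trace_wrt_def mat_trace_def range_matrix_eq)
  moreover have "det_wrt bs (id_blinfun o\<^sub>L F) = det_wrt (range_basis F) (F o\<^sub>L id_blinfun)"
    "trace_wrt bs (id_blinfun o\<^sub>L F) = trace_wrt (range_basis F) (F o\<^sub>L id_blinfun)"
    using r bs(2) complex_vector.span_superset[of "set (range_basis F)"]
    by (intro det_trace_wrt_commute r bs F; auto)+
  ultimately show "det_id_minus F = det_wrt bs F" "op_trace F = trace_wrt bs F" by simp_all
qed

lemma op_power_Suc2: "op_power T (Suc k) = (op_power T k) o\<^sub>L T"
proof (induction k)
  case (Suc k)
  have "op_power T (Suc (Suc k)) = (T o\<^sub>L (op_power T k o\<^sub>L T))" using Suc by simp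
  then show ?case by (simp add: compose_assoc)
qed simp

lemma coord_matrix_linear:
  assumes "basis_list bs" "range X \<subseteq> lspan bs" "range Y \<subseteq> lspan bs"
  shows "coord_matrix bs bs (\<lambda>x. X x + Y x) = coord_matrix bs bs X + coord_matrix bs bs Y"
    and "coord_matrix bs bs (\<lambda>x. X x - Y x) = coord_matrix bs bs X - coord_matrix bs bs Y"
    and "coord_matrix bs bs (\<lambda>x. c *\<^sub>C X x) = c \<cdot>\<^sub>m coord_matrix bs bs X"
  using assms
  by (auto intro!: eq_matI simp: basis_list_def complex_vector.representation_add
      complex_vector.representation_diff complex_vector.representation_scale image_subset_iff)

lemma coord_matrix_id: "basis_list bs \<Longrightarrow> coord_matrix bs bs (\<lambda>x. x) = 1\<^sub>m (length bs)"
  by (auto intro!: eq_matI simp: coord_basis)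

text \<open>Multiplicativity, because \<open>I - (F + G - F G) = (I - F)(I - G)\<close>.\<close>

lemma det_id_minus_mult:
  assumes F: "F \<in> finite_rank_ops" and G: "G \<in> finite_rank_ops"
  shows "det_id_minus (F + G - (F o\<^sub>L G)) = det_id_minus F * det_id_minus G"
proof -
  note b = finite_rank_ops_bounded[OF F] finite_rank_ops_bounded[OF G]
  have FG: "F o\<^sub>L G \<in> finite_rank_ops" using F b by auto
  obtain bs where bs: "basis_list bs"
    and r: "range (blinfun_apply F) \<subseteq> lspan bs" "range (blinfun_apply G) \<subseteq> lspan bs"
    using finite_rank_ops_basis[of "{F, G}"] F G
    by (metis empty_subsetI finite.intros insertI1 insertI2 insert_subset)
  have r2: "range (blinfun_apply (F o\<^sub>L G)) \<subseteq> lspan bs" using r by auto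
  have r3: "range (blinfun_apply (F + G - (F o\<^sub>L G))) \<subseteq> lspan bs"
    using r by (auto simp: blinfun.add_left blinfun.diff_left image_subset_iff
        intro!: complex_vector.span_diff complex_vector.span_add)
  let ?F = "coord_matrix bs bs (blinfun_apply F)" and ?G = "coord_matrix bs bs (blinfun_apply G)" and ?n = "length bs"
  have FG: "coord_matrix bs bs (blinfun_apply (F o\<^sub>L G)) = ?F * ?G"
    using coord_matrix_compose[OF bs bs bs b(1), of "blinfun_apply G"] r
    by (auto simp: blinfun_compose.rep_eq o_def image_subset_iff)
  have "coord_matrix bs bs (blinfun_apply (F + G - (F o\<^sub>L G))) =
      coord_matrix bs bs (\<lambda>x. (blinfun_apply F x + blinfun_apply G x) - blinfun_apply (F o\<^sub>L G) x)"
    by (simp add: plus_blinfun.rep_eq minus_blinfun.rep_eq blinfun_compose.rep_eq o_def)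
  also have "\<dots> = ?F + ?G - ?F * ?G"
    using r r2 bs
    by (subst coord_matrix_linear) (auto simp: coord_matrix_linear FG image_subset_iff intro!: complex_vector.span_add)
  finally have m: "coord_matrix bs bs (blinfun_apply (F + G - (F o\<^sub>L G))) = ?F + ?G - ?F * ?G" .
  have c: "?F \<in> carrier_mat ?n ?n" "?G \<in> carrier_mat ?n ?n" by auto
  have "1\<^sub>m ?n - (?F + ?G - ?F * ?G) = (1\<^sub>m ?n - ?F) * (1\<^sub>m ?n - ?G)"
  proof -
    have "(1\<^sub>m ?n - ?F) * (1\<^sub>m ?n - ?G) = (1\<^sub>m ?n - ?F) * 1\<^sub>m ?n - (1\<^sub>m ?n - ?F) * ?G"
      by (rule mult_minus_distrib_mat[of _ ?n ?n]) auto
    also have "(1\<^sub>m ?n - ?F) * ?G = 1\<^sub>m ?n * ?G - ?F * ?G"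
      by (rule minus_mult_distrib_mat[of _ ?n ?n]) auto
    finally show ?thesis by (intro eq_matI) auto
  qed
  then have "det_wrt bs (F + G - (F o\<^sub>L G)) = det_wrt bs F * det_wrt bs G"
    unfolding det_wrt_def m using det_mult[OF minus_carrier_mat[OF c(1)] minus_carrier_mat[OF c(2)]] by simp
  then show ?thesis
    using det_id_minus_wrt[OF _ bs] b r r3 by simp
qed

lemma det_id_minus_trace_commute:
  assumes F: "F \<in> finite_rank_ops" and Y: "Y \<in> bounded_ops"
  shows "det_id_minus (F o\<^sub>L Y) = det_id_minus (Y o\<^sub>L F)" "op_trace (F o\<^sub>L Y) = op_trace (Y o\<^sub>L F)"
proof -
  note b = finite_rank_ops_bounded[OF F]
  obtain bs where bs: "basis_list bs" "lspan bs = range (blinfun_apply F)"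
    using range_basis_list[OF F] by blast
  obtain cs where cs: "basis_list cs" "range (blinfun_apply (Y o\<^sub>L F)) \<subseteq> lspan cs"
    using finite_rank_ops_basis[of "{Y o\<^sub>L F}"] F Y by auto
  have "set bs \<subseteq> range (blinfun_apply F)"
    using bs(2) complex_vector.span_superset[of "set bs"] by simp
  then have 1: "blinfun_apply Y ` set bs \<subseteq> lspan cs" using cs(2) by (auto simp: image_subset_iff)
  have 2: "blinfun_apply F ` set cs \<subseteq> lspan bs" using bs(2) by auto
  have e: "det_id_minus (Y o\<^sub>L F) = det_wrt cs (Y o\<^sub>L F)" "op_trace (Y o\<^sub>L F) = trace_wrt cs (Y o\<^sub>L F)"
    using cs Y b by (auto intro!: det_id_minus_wrt)
  have e': "det_id_minus (F o\<^sub>L Y) = det_wrt bs (F o\<^sub>L Y)" "op_trace (F o\<^sub>L Y) = trace_wrt bs (F o\<^sub>L Y)"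
    using bs Y b by (auto intro!: det_id_minus_wrt)
  show "det_id_minus (F o\<^sub>L Y) = det_id_minus (Y o\<^sub>L F)" "op_trace (F o\<^sub>L Y) = op_trace (Y o\<^sub>L F)"
    unfolding e e' using det_trace_wrt_commute[OF bs(1) cs(1) Y b 1 2] by simp_all
qed

lemma op_trace_linear:
  assumes F: "F \<in> finite_rank_ops" and G: "G \<in> finite_rank_ops"
  shows "op_trace (F + G) = op_trace F + op_trace G" "op_trace (F - G) = op_trace F - op_trace G"
    "op_trace (c *\<^sub>C F) = c * op_trace F"
proof -
  note b = finite_rank_ops_bounded[OF F] finite_rank_ops_bounded[OF G]
  obtain bs where bs: "basis_list bs"
    and r: "range (blinfun_apply F) \<subseteq> lspan bs" "range (blinfun_apply G) \<subseteq> lspan bs"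
    using finite_rank_ops_basis[of "{F, G}"] F G
    by (metis empty_subsetI finite.intros insertI1 insertI2 insert_subset)
  have r': "range (blinfun_apply (F + G)) \<subseteq> lspan bs" "range (blinfun_apply (F - G)) \<subseteq> lspan bs"
     "range (blinfun_apply (c *\<^sub>C F)) \<subseteq> lspan bs"
    using r by (auto simp: blinfun.add_left blinfun.diff_left image_subset_iff
        intro!: complex_vector.span_diff complex_vector.span_add complex_vector.span_scale)
  have "blinfun_apply (c *\<^sub>C F) = (\<lambda>x. c *\<^sub>C blinfun_apply F x)" by auto
  then show "op_trace (F + G) = op_trace F + op_trace G" "op_trace (F - G) = op_trace F - op_trace G"
    "op_trace (c *\<^sub>C F) = c * op_trace F"
    using bs r r' b det_id_minus_wrt(2)[OF _ bs]
    by (simp_all add: trace_wrt_def plus_blinfun.rep_eq minus_blinfun.rep_eq coord_matrix_linear)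
      (simp_all add: mat_trace_def sum.distrib sum_subtractf sum_distrib_left)
qed

lemma op_trace_sum:
  "(\<And>i. i \<in> A \<Longrightarrow> F i \<in> finite_rank_ops) \<Longrightarrow> op_trace (\<Sum>i\<in>A. F i) = (\<Sum>i\<in>A. op_trace (F i))"
proof (induction A rule: infinite_finite_induct)
  case (insert x A)
  then show ?case by (simp add: op_trace_linear finite_rank_ops_sum)
qed (use op_trace_linear(3)[of 0 0 0] in auto)

lemma coord_matrix_power:
  assumes bs: "basis_list bs" and T: "T \<in> bounded_ops" "range (blinfun_apply T) \<subseteq> lspan bs"
  shows "coord_matrix bs bs (blinfun_apply (op_power T k)) = coord_matrix bs bs (blinfun_apply T) ^\<^sub>m k"
proof (induction k)
  case 0
  have "blinfun_apply (op_power T 0) = (\<lambda>x. x)" by (simp add: id_blinfun.rep_eq id_def)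
  then show ?case using coord_matrix_id[OF bs] by simp
next
  case (Suc k)
  have inv: "blinfun_apply (op_power T k) c \<in> lspan bs" if "c \<in> set bs" for c
    using that T by (cases k) (auto intro: complex_vector.span_base)
  have "coord_matrix bs bs (blinfun_apply (op_power T (Suc k))) =
      coord_matrix bs bs (\<lambda>x. blinfun_apply (op_power T k) (blinfun_apply T x))"
    unfolding op_power_Suc2 by (simp add: blinfun_compose.rep_eq o_def)
  also have "\<dots> = coord_matrix bs bs (blinfun_apply (op_power T k)) * coord_matrix bs bs (blinfun_apply T)"
    using inv T bs by (intro coord_matrix_compose) auto
  finally show ?case using Suc by (simp del: op_power_simps)
qed

text \<open>The eigenvalues with multiplicity, characterized by their symmetric functions: the list may
  contain any number of zeros.\<close>

definition eigenvalue_list :: "('a::complex_normed_vector \<Rightarrow>\<^sub>L 'a) \<Rightarrow> complex list \<Rightarrow> bool" where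
  "eigenvalue_list F ls \<longleftrightarrow> (\<forall>z. det_id_minus (z *\<^sub>C F) = (\<Prod>l\<leftarrow>ls. 1 - z * l)) \<and>
     (\<forall>k>0. op_trace (op_power F k) = (\<Sum>l\<leftarrow>ls. l ^ k))"

lemma eigenvalue_list_exists:
  assumes F: "F \<in> bounded_ops" and bs: "basis_list bs" and r: "range (blinfun_apply F) \<subseteq> lspan bs"
  obtains ls where "eigenvalue_list F ls" "length ls = length bs"
    "\<And>l. l \<in> set ls \<Longrightarrow> \<exists>v\<in>lspan bs. v \<noteq> 0 \<and> blinfun_apply F v = l *\<^sub>C v"
proof -
  let ?n = "length bs" and ?M = "coord_matrix bs bs (blinfun_apply F)"
  have M: "?M \<in> carrier_mat ?n ?n" by simp
  obtain ls where ls: "length ls = ?n"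
      "\<And>z. Determinant.det (1\<^sub>m ?n - z \<cdot>\<^sub>m ?M) = (\<Prod>l\<leftarrow>ls. 1 - z * l)"
      "\<And>k. mat_trace (?M ^\<^sub>m k) = (\<Sum>l\<leftarrow>ls. l ^ k)"
      "\<And>l. l \<in> set ls \<Longrightarrow> \<exists>v\<in>carrier_vec ?n. v \<noteq> 0\<^sub>v ?n \<and> ?M *\<^sub>v v = l \<cdot>\<^sub>v v"
    using eigenvalue_list_matrix[OF M] by blast
  have det: "det_id_minus (z *\<^sub>C F) = (\<Prod>l\<leftarrow>ls. 1 - z * l)" for z
  proof -
    have "blinfun_apply (z *\<^sub>C F) = (\<lambda>x. z *\<^sub>C blinfun_apply F x)" by auto
    moreover have "range (blinfun_apply (z *\<^sub>C F)) \<subseteq> lspan bs"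
      using r by (auto simp: image_subset_iff intro: complex_vector.span_scale)
    ultimately show ?thesis
      using ls(2)[of z] F r bs det_id_minus_wrt(1)[of "z *\<^sub>C F" bs]
      by (simp add: det_wrt_def coord_matrix_linear)
  qed
  have tr: "op_trace (op_power F k) = (\<Sum>l\<leftarrow>ls. l ^ k)" if "k > 0" for k
  proof -
    have "range (blinfun_apply (op_power F k)) \<subseteq> lspan bs" using that r by (cases k) auto
    then show ?thesis
      using ls(3)[of k] F bs r det_id_minus_wrt(2)[of "op_power F k" bs]
      by (simp add: trace_wrt_def coord_matrix_power)
  qed
  have ev: "\<exists>v\<in>lspan bs. v \<noteq> 0 \<and> blinfun_apply F v = l *\<^sub>C v" if l: "l \<in> set ls" for l
  proof -
    obtain v where v: "v \<in> carrier_vec ?n" "v \<noteq> 0\<^sub>v ?n" "?M *\<^sub>v v = l \<cdot>\<^sub>v v" using ls(4)[OF l] by blast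
    define x where "x = (\<Sum>j<?n. vec_index v j *\<^sub>C bs ! j)"
    have cx: "coord bs x i = vec_index v i" if "i < ?n" for i
      unfolding x_def using coord_combination[OF bs that] .
    have x: "x \<in> lspan bs"
      unfolding x_def
      by (intro complex_vector.span_sum complex_vector.span_scale complex_vector.span_base) simp
    have "x \<noteq> 0"
    proof
      assume "x = 0"
      then have "vec_index v i = 0" if "i < ?n" for i
        using cx[OF that] by (simp add: complex_vector.representation_zero)
      then have "v = 0\<^sub>v ?n" using v(1) by (intro eq_vecI) auto
      then show False using v(2) by simp
    qed
    have Fx: "blinfun_apply F x = (\<Sum>j<?n. vec_index v j *\<^sub>C blinfun_apply F (bs ! j))"
      unfolding x_def by (rule bounded_ops_apply_sum[OF F])
    have "coord bs (blinfun_apply F x) i = l * vec_index v i" if i: "i < ?n" for i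
    proof -
      have "coord bs (blinfun_apply F x) i = (\<Sum>j<?n. vec_index v j * coord bs (blinfun_apply F (bs ! j)) i)"
        unfolding Fx using r by (intro coord_sum[OF bs]) auto
      also have "\<dots> = vec_index (?M *\<^sub>v v) i"
        using v(1) i by (auto simp: scalar_prod_def lessThan_atLeast0 mult.commute intro!: sum.cong)
      finally show ?thesis using v i by simp
    qed
    then have "blinfun_apply F x = (\<Sum>j<?n. (l * vec_index v j) *\<^sub>C bs ! j)"
      using sum_coord[OF bs, of "blinfun_apply F x"] r by (simp add: image_subset_iff)
    also have "\<dots> = l *\<^sub>C x"
      by (simp add: x_def complex_vector.scale_sum_right)
    finally show ?thesis using x \<open>x \<noteq> 0\<close> by blast
  qed
  show ?thesis using that[of ls] det tr ls(1) ev by (auto simp: eigenvalue_list_def)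
qed

lemma det_id_minus_zero_fixpoint:
  assumes F: "F \<in> finite_rank_ops" and d: "det_id_minus F = 0"
  obtains v where "v \<noteq> 0" "blinfun_apply F v = v"
proof -
  obtain ls where ls: "eigenvalue_list F ls"
    "\<And>l. l \<in> set ls \<Longrightarrow> \<exists>v\<in>lspan (range_basis F). v \<noteq> 0 \<and> blinfun_apply F v = l *\<^sub>C v"
    using eigenvalue_list_exists[OF finite_rank_ops_bounded[OF F] range_basis_list(1)[OF F]]
      range_basis_list(2)[OF F] by (metis subset_refl)
  have "det_id_minus (1 *\<^sub>C F) = (\<Prod>l\<leftarrow>ls. 1 - 1 * l)" using ls(1) unfolding eigenvalue_list_def by blast
  then have "(\<Prod>l\<leftarrow>ls. 1 - l) = 0" using d by simp
  then have "1 \<in> set ls" by (auto simp: prod_list_zero_iff)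
  then show ?thesis using ls(2)[of 1] that by auto
qed

section \<open>Boundedness of coordinates and finite rank inverses\<close>

text \<open>Equivalence of norms in finite dimension, by induction on the basis: a new vector has positive
  distance to the span of the old ones, since by the induction hypothesis the coefficients of a sequence
  in that span converging to it would converge too.\<close>

lemma independent_coefficients_bounded:
  fixes B :: "'a::complex_normed_vector set"
  assumes "finite B" "\<not> complex_vector.dependent B"
  shows "\<exists>C\<ge>0. \<forall>c. (\<Sum>b\<in>B. cmod (c b)) \<le> C * norm (\<Sum>b\<in>B. c b *\<^sub>C b)"
  using assms
proof (induction B)
  case empty
  then show ?case by auto
next
  case (insert b B)
  have ind: "\<not> complex_vector.dependent B" and nb: "b \<notin> complex_vector.span B"
    using insert.prems insert.hyps complex_vector.dependent_insertD[of b B]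
      complex_vector.independent_insert[of b B] by (auto split: if_splits)
  obtain C where C: "C \<ge> 0" "\<And>c. (\<Sum>b\<in>B. cmod (c b)) \<le> C * norm (\<Sum>b\<in>B. c b *\<^sub>C b)"
    using insert.IH ind by blast
  have "\<exists>d>0. \<forall>c. d \<le> norm (b - (\<Sum>x\<in>B. c x *\<^sub>C x))"
  proof (rule ccontr)
    assume "\<not> ?thesis"
    then have "\<forall>d>0. \<exists>c. norm (b - (\<Sum>x\<in>B. c x *\<^sub>C x)) < d" by (auto simp: not_le)
    then have "\<forall>n. \<exists>c. norm (b - (\<Sum>x\<in>B. c x *\<^sub>C x)) < 1 / real (Suc n)" by simp
    then obtain c where c: "\<And>n. norm (b - (\<Sum>x\<in>B. c n x *\<^sub>C x)) < 1 / real (Suc n)" by metis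
    define v where "v n = (\<Sum>x\<in>B. c n x *\<^sub>C x)" for n :: nat
    have vb: "v \<longlonglongrightarrow> b"
    proof (rule LIM_zero_cancel, rule Lim_null_comparison)
      show "\<forall>\<^sub>F n in sequentially. norm (v n - b) \<le> 1 / real (Suc n)"
        using c by (auto simp: v_def norm_minus_commute intro!: always_eventually less_imp_le)
      show "(\<lambda>n. 1 / real (Suc n)) \<longlonglongrightarrow> 0" using LIMSEQ_inverse_real_of_nat by (simp add: inverse_eq_divide)
    qed
    have "Cauchy (\<lambda>n. c n x)" if x: "x \<in> B" for x
    proof (rule CauchyI)
      fix e :: real assume e: "e > 0"
      obtain N where N: "\<And>m n. m \<ge> N \<Longrightarrow> n \<ge> N \<Longrightarrow> norm (v m - v n) < e / (C + 1)"
        using LIMSEQ_imp_Cauchy[OF vb] e C(1) CauchyD[of v "e / (C + 1)"] by auto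
      have "norm (c m x - c n x) < e" if mn: "m \<ge> N" "n \<ge> N" for m n
      proof -
        have "norm (c m x - c n x) \<le> (\<Sum>y\<in>B. cmod (c m y - c n y))"
          using insert.hyps x by (intro member_le_sum) auto
        also have "\<dots> \<le> C * norm (v m - v n)"
          using C(2)[of "\<lambda>y. c m y - c n y"]
          by (simp add: v_def complex_vector.scale_left_diff_distrib sum_subtractf)
        also have "\<dots> \<le> (C + 1) * norm (v m - v n)" by (intro mult_right_mono) auto
        also have "\<dots> < e" using N[OF mn] C(1) by (simp add: field_simps)
        finally show ?thesis .
      qed
      then show "\<exists>M. \<forall>m\<ge>M. \<forall>n\<ge>M. norm (c m x - c n x) < e" by blast
    qed
    then have "\<forall>x\<in>B. \<exists>l. (\<lambda>n. c n x) \<longlonglongrightarrow> l" by (simp add: Cauchy_convergent_iff convergent_def)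
    then obtain l where l: "\<And>x. x \<in> B \<Longrightarrow> (\<lambda>n. c n x) \<longlonglongrightarrow> l x" by metis
    have "(\<lambda>n. c n x *\<^sub>C x) \<longlonglongrightarrow> l x *\<^sub>C x" if "x \<in> B" for x
    proof (rule LIM_zero_cancel, rule Lim_null_comparison)
      show "\<forall>\<^sub>F n in sequentially. norm (c n x *\<^sub>C x - l x *\<^sub>C x) \<le> cmod (c n x - l x) * norm x"
        by (auto simp: norm_scaleC simp flip: complex_vector.scale_left_diff_distrib)
      show "(\<lambda>n. cmod (c n x - l x) * norm x) \<longlonglongrightarrow> 0"
        using l[OF that] by (intro tendsto_mult_left_zero tendsto_norm_zero) (simp add: LIM_zero)
    qed
    then have "v \<longlonglongrightarrow> (\<Sum>x\<in>B. l x *\<^sub>C x)" unfolding v_def by (intro tendsto_sum)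
    then have "b = (\<Sum>x\<in>B. l x *\<^sub>C x)" using vb LIMSEQ_unique by blast
    moreover have "(\<Sum>x\<in>B. l x *\<^sub>C x) \<in> complex_vector.span B"
      by (intro complex_vector.span_sum complex_vector.span_scale complex_vector.span_base)
    ultimately show False using nb by simp
  qed
  then obtain d where d: "d > 0" "\<And>c. d \<le> norm (b - (\<Sum>x\<in>B. c x *\<^sub>C x))" by blast
  show ?case
  proof (intro exI[of _ "1 / d + C * (1 + norm b / d)"] conjI allI)
    show "0 \<le> 1 / d + C * (1 + norm b / d)" using d C(1) by simp
    fix c :: "'a \<Rightarrow> complex"
    define w where "w = (\<Sum>x\<in>B. c x *\<^sub>C x)"
    have "cmod (c b) * d \<le> norm (c b *\<^sub>C b + w)"
    proof (cases "c b = 0")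
      case False
      have "c b *\<^sub>C b + w = c b *\<^sub>C (b - (\<Sum>x\<in>B. (- c x / c b) *\<^sub>C x))"
        using False
        by (simp add: w_def complex_vector.scale_right_distrib complex_vector.scale_sum_right sum_negf)
      then have "norm (c b *\<^sub>C b + w) = cmod (c b) * norm (b - (\<Sum>x\<in>B. (- c x / c b) *\<^sub>C x))"
        by (simp only: norm_scaleC)
      then show ?thesis using d(2)[of "\<lambda>x. - c x / c b"] by (simp add: mult_left_mono)
    qed simp
    then have 1: "cmod (c b) \<le> norm (c b *\<^sub>C b + w) / d" using d(1) by (simp add: field_simps)
    have "norm w \<le> norm (c b *\<^sub>C b + w) + cmod (c b) * norm b"
      using norm_triangle_ineq4[of "c b *\<^sub>C b + w" "c b *\<^sub>C b"] by (simp add: norm_scaleC)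
    also have "\<dots> \<le> norm (c b *\<^sub>C b + w) + norm (c b *\<^sub>C b + w) / d * norm b"
      using 1 by (intro add_left_mono mult_right_mono) auto
    finally have "C * norm w \<le> C * (norm (c b *\<^sub>C b + w) * (1 + norm b / d))"
      using C(1) by (intro mult_left_mono) (auto simp: algebra_simps)
    then have "(\<Sum>x\<in>B. cmod (c x)) \<le> C * (norm (c b *\<^sub>C b + w) * (1 + norm b / d))"
      using C(2)[of c] by (simp add: w_def)
    then show "(\<Sum>x\<in>insert b B. cmod (c x)) \<le>
        (1 / d + C * (1 + norm b / d)) * norm (\<Sum>x\<in>insert b B. c x *\<^sub>C x)"
      using 1 insert.hyps by (simp add: w_def algebra_simps)
  qed
qed

lemma coord_bounded:
  fixes bs :: "'a::complex_normed_vector list"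
  assumes bs: "basis_list bs"
  obtains C where "C > 0" "\<And>v i. v \<in> lspan bs \<Longrightarrow> i < length bs \<Longrightarrow> cmod (coord bs v i) \<le> C * norm v"
proof -
  obtain C where C: "C \<ge> 0" "\<And>c. (\<Sum>b\<in>set bs. cmod (c b)) \<le> C * norm (\<Sum>b\<in>set bs. c b *\<^sub>C b)"
    using independent_coefficients_bounded[of "set bs"] bs unfolding basis_list_def by auto
  show ?thesis
  proof
    show "C + 1 > 0" using C(1) by simp
    fix v i assume v: "v \<in> lspan bs" and i: "i < length bs"
    have "cmod (coord bs v i) \<le> (\<Sum>b\<in>set bs. cmod (complex_vector.representation (set bs) v b))"
      using i by (intro member_le_sum[of "bs ! i" "set bs" "\<lambda>b. cmod (complex_vector.representation (set bs) v b)"]) auto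
    also have "\<dots> \<le> C * norm (\<Sum>b\<in>set bs. complex_vector.representation (set bs) v b *\<^sub>C b)"
      by (rule C(2))
    also have "(\<Sum>b\<in>set bs. complex_vector.representation (set bs) v b *\<^sub>C b) = v"
      using bs v by (intro complex_vector.sum_representation_eq) (auto simp: basis_list_def)
    also have "C * norm v \<le> (C + 1) * norm v" by (intro mult_right_mono) auto
    finally show "cmod (coord bs v i) \<le> (C + 1) * norm v" .
  qed
qed

lemma inverse_opI:
  fixes T :: "'a::complex_normed_vector \<Rightarrow>\<^sub>L 'a"
  assumes T: "T \<in> bounded_ops" and lb: "\<And>x. norm x \<le> C * norm (blinfun_apply T x)"
    and surj: "\<And>y. \<exists>x. blinfun_apply T x = y" and C: "0 \<le> C"
  obtains S where "is_inverse_op T S" "norm S \<le> C"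
proof -
  have inj: "x = y" if "blinfun_apply T x = blinfun_apply T y" for x y
    using lb[of "x - y"] that by (simp add: blinfun.diff_right)
  obtain f where f: "\<And>y. blinfun_apply T (f y) = y" using surj by metis
  have bl: "bounded_linear f"
  proof (rule bounded_linear_intro[where K = C])
    show "f (x + y) = f x + f y" for x y by (rule inj) (simp add: f blinfun.add_right)
    show "f (r *\<^sub>R x) = r *\<^sub>R f x" for r x by (rule inj) (simp add: f blinfun.scaleR_right)
    show "norm (f x) \<le> norm x * C" for x using lb[of "f x"] by (simp add: f mult.commute)
  qed
  define S where "S = Blinfun f"
  have S: "blinfun_apply S = f" unfolding S_def using bl by (rule bounded_linear_Blinfun_apply)
  have "S \<in> bounded_ops"
    by (rule bounded_opsI, rule inj) (simp add: S f bounded_ops_apply[OF T])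
  moreover have "S o\<^sub>L T = id_blinfun" by (rule blinfun_eqI, rule inj) (simp add: S f)
  moreover have "T o\<^sub>L S = id_blinfun" by (rule blinfun_eqI) (simp add: S f)
  moreover have "norm S \<le> C"
    using lb[of "f _"] C by (intro norm_blinfun_bound) (simp_all add: S f)
  ultimately show ?thesis using that by (auto simp: is_inverse_op_def)
qed

text \<open>Solving \<open>x - X x = y\<close> amounts to solving a linear system for the component of \<open>x - y\<close> in the range
  of \<open>X\<close>. The constant depends only on the basis and on a bound for \<open>X\<close>, hence it is uniform along a
  holomorphic family near a zero of the determinant.\<close>

lemma inverse_id_minus_finite_rank:
  fixes bs :: "'a::complex_normed_vector list"
  assumes bs: "basis_list bs" and b: "0 \<le> b"
  obtains K where "K \<ge> 0" "\<And>X. X \<in> bounded_ops \<Longrightarrow> range (blinfun_apply X) \<subseteq> lspan bs \<Longrightarrow> norm X \<le> b \<Longrightarrow>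
    det_id_minus X \<noteq> 0 \<Longrightarrow> \<exists>S. is_inverse_op (id_blinfun - X) S \<and> norm S \<le> 1 + K / cmod (det_id_minus X)"
proof -
  let ?n = "length bs"
  obtain C where C: "C > 0" "\<And>v i. v \<in> lspan bs \<Longrightarrow> i < ?n \<Longrightarrow> cmod (coord bs v i) \<le> C * norm v"
    using coord_bounded[OF bs] by blast
  define L where "L = (\<Sum>i<?n. norm (bs ! i))"
  have L: "0 \<le> L" by (simp add: L_def sum_nonneg)
  have Li: "norm (bs ! i) \<le> L" if "i < ?n" for i unfolding L_def using that by (intro member_le_sum) auto
  define B where "B = 1 + C * (b * L)"
  have B1: "1 \<le> B" using C(1) b L by (simp add: B_def)
  define K0 where "K0 = real ?n * (fact ?n * B ^ ?n) * (C * b)"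
  have K0: "0 \<le> K0" using B1 C(1) b by (simp add: K0_def)
  show ?thesis
  proof
    show "0 \<le> K0 * L" using K0 L by simp
    fix X :: "'a \<Rightarrow>\<^sub>L 'a"
    assume X: "X \<in> bounded_ops" and r: "range (blinfun_apply X) \<subseteq> lspan bs" and nX: "norm X \<le> b"
      and d: "det_id_minus X \<noteq> 0"
    let ?X = "coord_matrix bs bs (blinfun_apply X)" and ?M = "1\<^sub>m ?n - coord_matrix bs bs (blinfun_apply X)"
    have dM: "Determinant.det ?M = det_id_minus X"
      using det_id_minus_wrt(1)[OF X bs r] by (simp add: det_wrt_def)
    have M: "?M \<in> carrier_mat ?n ?n" by (intro minus_carrier_mat) simp
    have rX: "blinfun_apply X y \<in> lspan bs" for y using r by auto
    have Xn: "norm (blinfun_apply X y) \<le> b * norm y" for y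
      using norm_blinfun[of X y] nX by (meson mult_right_mono norm_ge_zero order_trans)
    have Mb: "cmod (?M $$ (i, j)) \<le> B" if ij: "i < ?n" "j < ?n" for i j
    proof -
      have "cmod (coord bs (blinfun_apply X (bs ! j)) i) \<le> C * norm (blinfun_apply X (bs ! j))"
        using C(2)[OF rX] ij by simp
      also have "\<dots> \<le> C * (b * L)"
        using Xn[of "bs ! j"] Li[OF ij(2)] b C(1)
        by (intro mult_left_mono) (auto intro: order_trans mult_left_mono)
      finally have "cmod (coord bs (blinfun_apply X (bs ! j)) i) \<le> C * (b * L)" .
      moreover have "cmod (1\<^sub>m ?n $$ (i, j)) \<le> 1" using ij by simp
      moreover have "?M $$ (i, j) = 1\<^sub>m ?n $$ (i, j) - coord bs (blinfun_apply X (bs ! j)) i" using ij by simp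
      then have "cmod (?M $$ (i, j)) = cmod (1\<^sub>m ?n $$ (i, j) - coord bs (blinfun_apply X (bs ! j)) i)" by (rule arg_cong)
      ultimately show ?thesis
        unfolding B_def using norm_triangle_ineq4[of "1\<^sub>m ?n $$ (i, j)" "coord bs (blinfun_apply X (bs ! j)) i"]
        by linarith
    qed
    have solve: "\<exists>x. x - blinfun_apply X x = y \<and> norm x \<le> (1 + K0 * L / cmod (det_id_minus X)) * norm y" for y
    proof -
      define yv where "yv = Matrix.vec ?n (coord bs (blinfun_apply X y))"
      have "cmod (vec_index yv i) \<le> C * b * norm y" if "i < ?n" for i
      proof -
        have "cmod (vec_index yv i) \<le> C * norm (blinfun_apply X y)"
          using C(2)[OF rX that] that by (simp add: yv_def)
        also have "\<dots> \<le> C * (b * norm y)" using Xn[of y] C(1) by (intro mult_left_mono) auto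
        finally show ?thesis by (simp add: mult.assoc)
      qed
      then obtain c where c: "c \<in> carrier_vec ?n" "?M *\<^sub>v c = yv"
        "\<And>i. i < ?n \<Longrightarrow> cmod (vec_index c i) \<le> real ?n * (fact ?n * B ^ ?n) * (C * b * norm y) / cmod (det_id_minus X)"
        using matrix_solve_bound[OF M _ Mb B1, of yv "C * b * norm y"] d dM
        by (auto simp: yv_def)
      define v where "v = (\<Sum>j<?n. vec_index c j *\<^sub>C bs ! j)"
      have v: "v \<in> lspan bs"
        unfolding v_def
        by (intro complex_vector.span_sum complex_vector.span_scale complex_vector.span_base) simp
      have "v - blinfun_apply X v = blinfun_apply X y"
      proof -
        have Xv: "blinfun_apply X v = (\<Sum>j<?n. vec_index c j *\<^sub>C blinfun_apply X (bs ! j))"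
          unfolding v_def by (rule bounded_ops_apply_sum[OF X])
        have "coord bs (v - blinfun_apply X v) i = coord bs (blinfun_apply X y) i" if i: "i < ?n" for i
        proof -
          have "coord bs (v - blinfun_apply X v) i = vec_index c i - (\<Sum>j<?n. vec_index c j * coord bs (blinfun_apply X (bs ! j)) i)"
          proof -
            have "coord bs (v - blinfun_apply X v) i = coord bs v i - coord bs (blinfun_apply X v) i"
              using bs v rX by (simp add: basis_list_def complex_vector.representation_diff)
            also have "coord bs v i = vec_index c i"
              unfolding v_def by (rule coord_combination[OF bs i])
            also have "coord bs (blinfun_apply X v) i = (\<Sum>j<?n. vec_index c j * coord bs (blinfun_apply X (bs ! j)) i)"
              unfolding Xv by (rule coord_sum[OF bs]) (rule rX)
            finally show ?thesis .
          qed
          also have "\<dots> = vec_index (?M *\<^sub>v c) i"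
          proof -
            have "?M *\<^sub>v c = 1\<^sub>m ?n *\<^sub>v c - ?X *\<^sub>v c"
              using c(1) by (intro minus_mult_distrib_mat_vec[of _ ?n ?n]) auto
            then show ?thesis
              using c(1) i by (auto simp: scalar_prod_def lessThan_atLeast0 mult.commute intro!: sum.cong)
          qed
          finally show ?thesis using i c(2) by (simp add: yv_def)
        qed
        then have "(\<Sum>i<?n. coord bs (v - blinfun_apply X v) i *\<^sub>C bs ! i) =
            (\<Sum>i<?n. coord bs (blinfun_apply X y) i *\<^sub>C bs ! i)" by simp
        then show ?thesis
          using sum_coord[OF bs, of "v - blinfun_apply X v"] sum_coord[OF bs, of "blinfun_apply X y"] v rX
          by (simp add: complex_vector.span_diff)
      qed
      then have "(y + v) - blinfun_apply X (y + v) = y"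
        by (simp add: blinfun.add_right algebra_simps)
      moreover have "norm v \<le> (\<Sum>j<?n. K0 * norm y / cmod (det_id_minus X) * norm (bs ! j))"
        unfolding v_def
      proof (rule order_trans[OF norm_sum], rule sum_mono)
        fix j assume "j \<in> {..<?n}"
        then have "cmod (vec_index c j) \<le> K0 * norm y / cmod (det_id_minus X)"
          using c(3)[of j] by (simp add: K0_def mult_ac)
        then show "norm (vec_index c j *\<^sub>C bs ! j) \<le> K0 * norm y / cmod (det_id_minus X) * norm (bs ! j)"
          unfolding norm_scaleC by (rule mult_right_mono) simp
      qed
      then have "norm v \<le> K0 * L / cmod (det_id_minus X) * norm y"
        by (simp add: L_def mult_ac sum_distrib_left sum_divide_distrib)
      then have "norm (y + v) \<le> (1 + K0 * L / cmod (det_id_minus X)) * norm y"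
        using norm_triangle_ineq[of y v] by (simp add: algebra_simps)
      ultimately show ?thesis by blast
    qed
    have inj: "x = 0" if "x - blinfun_apply X x = 0" for x
    proof -
      have x: "x \<in> lspan bs" using that r by (metis eq_iff_diff_eq_0 rangeI subsetD)
      define c where "c = Matrix.vec ?n (coord bs x)"
      have "?X *\<^sub>v c = c"
      proof (rule eq_vecI)
        fix i assume "i < dim_vec c"
        then have i: "i < ?n" by (simp add: c_def)
        have "blinfun_apply X x = (\<Sum>j<?n. coord bs x j *\<^sub>C blinfun_apply X (bs ! j))"
          using bounded_ops_apply_sum[OF X, of "coord bs x" "\<lambda>j. bs ! j" "{..<?n}"] sum_coord[OF bs x] by simp
        then have "coord bs (blinfun_apply X x) i = (\<Sum>j<?n. coord bs x j * coord bs (blinfun_apply X (bs ! j)) i)"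
          using coord_sum[OF bs, of "{..<?n}" "\<lambda>j. blinfun_apply X (bs ! j)"] rX by simp
        also have "\<dots> = vec_index (?X *\<^sub>v c) i"
          using i by (auto simp: c_def scalar_prod_def lessThan_atLeast0 mult.commute intro!: sum.cong)
        finally show "vec_index (?X *\<^sub>v c) i = vec_index c i" using that i by (simp add: c_def)
      qed (simp add: c_def)
      then have "?M *\<^sub>v c = 0\<^sub>v ?n"
        using minus_mult_distrib_mat_vec[of "1\<^sub>m ?n" ?n ?n ?X c] by (simp add: c_def)
      then have "c = 0\<^sub>v ?n"
        using det_0_iff_vec_prod_zero[OF M] d dM vec_carrier[of ?n "coord bs x"] unfolding c_def by metis
      then have "coord bs x i = 0" if "i < ?n" for i using that unfolding c_def by (metis index_vec index_zero_vec(1))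
      then show ?thesis using sum_coord[OF bs x] by simp
    qed
    have "norm x \<le> (1 + K0 * L / cmod (det_id_minus X)) * norm (blinfun_apply (id_blinfun - X) x)" for x
    proof -
      obtain x' where x': "x' - blinfun_apply X x' = x - blinfun_apply X x"
        "norm x' \<le> (1 + K0 * L / cmod (det_id_minus X)) * norm (x - blinfun_apply X x)"
        using solve[of "x - blinfun_apply X x"] by blast
      have "x' - x - blinfun_apply X (x' - x) = (x' - blinfun_apply X x') - (x - blinfun_apply X x)"
        by (simp add: blinfun.diff_right)
      also have "\<dots> = 0" using x'(1) by (rule right_minus_eq[THEN iffD2])
      finally have "x' - x = 0" by (rule inj)
      then have "x' = x" by simp
      then show ?thesis
        using x'(2) by (simp only: minus_blinfun.rep_eq id_blinfun.rep_eq id_apply)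
    qed
    moreover have "\<exists>x. blinfun_apply (id_blinfun - X) x = y" for y
      using solve[of y] by (auto simp: blinfun.diff_left)
    moreover have "0 \<le> 1 + K0 * L / cmod (det_id_minus X)" using K0 L by simp
    ultimately obtain S where "is_inverse_op (id_blinfun - X) S"
      "norm S \<le> 1 + K0 * L / cmod (det_id_minus X)"
      using inverse_opI[OF bounded_ops_intros(4)[OF bounded_ops_intros(2) X]] by blast
    then show "\<exists>S. is_inverse_op (id_blinfun - X) S \<and> norm S \<le> 1 + K0 * L / cmod (det_id_minus X)"
      by blast
  qed
qed

section \<open>Holomorphic dependence of determinants and traces\<close>

text \<open>Stated with the Frechet derivative, so that its chain and product rules are available for vector valued functions.\<close>

definition has_op_derivative :: "(complex \<Rightarrow> 'b::complex_normed_vector) \<Rightarrow> 'b \<Rightarrow> complex \<Rightarrow> bool" where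
  "has_op_derivative X D w \<longleftrightarrow> (X has_derivative (\<lambda>h. h *\<^sub>C D)) (at w)"

lemma coord_has_field_derivative:
  fixes bs :: "'a::complex_normed_vector list"
  assumes bs: "basis_list bs" and X: "has_op_derivative X D w"
    and r: "\<And>w. range (blinfun_apply (X w)) \<subseteq> lspan bs" "range (blinfun_apply D) \<subseteq> lspan bs"
    and i: "i < length bs"
  shows "((\<lambda>w. coord bs (blinfun_apply (X w) v) i) has_field_derivative coord bs (blinfun_apply D v) i) (at w)"
proof -
  obtain C where C: "C > 0" "\<And>v i. v \<in> lspan bs \<Longrightarrow> i < length bs \<Longrightarrow> cmod (coord bs v i) \<le> C * norm v"
    using coord_bounded[OF bs] by blast
  have ind: "\<not> complex_vector.dependent (set bs)" using bs by (simp add: basis_list_def)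
  have lim: "(\<lambda>h. norm (X (w + h) - X w - h *\<^sub>C D) / norm h) \<midarrow>0\<rightarrow> 0"
    using X by (simp add: has_op_derivative_def has_derivative_at)
  have "(\<lambda>h. norm (coord bs (blinfun_apply (X (w + h)) v) i - coord bs (blinfun_apply (X w) v) i
      - coord bs (blinfun_apply D v) i * h) / norm h) \<midarrow>0\<rightarrow> 0"
  proof (rule Lim_null_comparison)
    show "\<forall>\<^sub>F h in at 0. norm (norm (coord bs (blinfun_apply (X (w + h)) v) i - coord bs (blinfun_apply (X w) v) i
      - coord bs (blinfun_apply D v) i * h) / norm h) \<le> C * norm v * (norm (X (w + h) - X w - h *\<^sub>C D) / norm h)"
    proof (rule always_eventually, intro allI)
      fix h :: complex
      let ?v = "blinfun_apply (X (w + h) - X w - h *\<^sub>C D) v"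
      have sp: "blinfun_apply (X (w + h)) v \<in> lspan bs" "blinfun_apply (X w) v \<in> lspan bs"
        "blinfun_apply D v \<in> lspan bs" using r by auto
      have "coord bs ?v i = coord bs (blinfun_apply (X (w + h)) v) i - coord bs (blinfun_apply (X w) v) i
          - h * coord bs (blinfun_apply D v) i"
        using sp ind
        by (simp add: blinfun.diff_left complex_vector.representation_diff complex_vector.span_diff
            complex_vector.span_scale complex_vector.representation_scale)
      then have "coord bs (blinfun_apply (X (w + h)) v) i - coord bs (blinfun_apply (X w) v) i
          - coord bs (blinfun_apply D v) i * h = coord bs ?v i" by (simp only: mult.commute)
      then have e: "norm (norm (coord bs (blinfun_apply (X (w + h)) v) i - coord bs (blinfun_apply (X w) v) i
          - coord bs (blinfun_apply D v) i * h) / norm h) = cmod (coord bs ?v i) / norm h" by simp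
      have "?v \<in> lspan bs"
        using sp by (simp add: blinfun.diff_left complex_vector.span_diff complex_vector.span_scale)
      then have "cmod (coord bs ?v i) \<le> C * norm ?v" using C(2) i by blast
      also have "\<dots> \<le> C * (norm (X (w + h) - X w - h *\<^sub>C D) * norm v)"
        using C(1) by (intro mult_left_mono norm_blinfun) auto
      finally have "cmod (coord bs ?v i) / norm h \<le> C * (norm (X (w + h) - X w - h *\<^sub>C D) * norm v) / norm h"
        by (intro divide_right_mono) auto
      also have "\<dots> = C * norm v * (norm (X (w + h) - X w - h *\<^sub>C D) / norm h)" by simp
      finally show "norm (norm (coord bs (blinfun_apply (X (w + h)) v) i - coord bs (blinfun_apply (X w) v) i
          - coord bs (blinfun_apply D v) i * h) / norm h) \<le> C * norm v * (norm (X (w + h) - X w - h *\<^sub>C D) / norm h)"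
        unfolding e .
    qed
    show "(\<lambda>h. C * norm v * (norm (X (w + h) - X w - h *\<^sub>C D) / norm h)) \<midarrow>0\<rightarrow> 0"
      by (rule tendsto_mult_right_zero[OF lim])
  qed
  then show ?thesis
    unfolding has_field_derivative_def has_derivative_at by (simp add: bounded_linear_mult_right)
qed

lemma holomorphic_det_mat:
  assumes "\<And>i j. i < n \<Longrightarrow> j < n \<Longrightarrow> (\<lambda>w. M w $$ (i, j)) holomorphic_on S"
    and "\<And>w. M w \<in> carrier_mat n n"
  shows "(\<lambda>w. Determinant.det (M w)) holomorphic_on S"
proof -
  have "(\<lambda>w. \<Sum>p\<in>{p. p permutes {0..<n}}. signof p * (\<Prod>i = 0..<n. M w $$ (i, p i))) holomorphic_on S"
  proof (intro holomorphic_intros)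
    fix p i assume "p \<in> {p. p permutes {0..<n}}" "i \<in> {0..<n}"
    then have "p i < n" "i < n" using permutes_in_image[of p "{0..<n}" i] by auto
    then show "(\<lambda>w. M w $$ (i, p i)) holomorphic_on S" using assms(1) by blast
  qed
  then show ?thesis by (simp add: det_def'[OF assms(2)])
qed

text \<open>All entries of the coordinate matrices are holomorphic, and determinants and traces are
  polynomials in the entries.\<close>

lemma holomorphic_det_trace:
  fixes bs :: "'a::complex_normed_vector list"
  assumes bs: "basis_list bs" and S: "open S"
    and X: "\<And>w. X w \<in> bounded_ops" "\<And>w. range (blinfun_apply (X w)) \<subseteq> lspan bs"
    and D: "\<And>w. w \<in> S \<Longrightarrow> \<exists>D. has_op_derivative X D w \<and> range (blinfun_apply D) \<subseteq> lspan bs"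
  shows "(\<lambda>w. det_id_minus (X w)) holomorphic_on S"
    and "k > 0 \<Longrightarrow> (\<lambda>w. op_trace (op_power (X w) k)) holomorphic_on S"
proof -
  let ?n = "length bs"
  have h: "(\<lambda>w. coord bs (blinfun_apply (X w) v) i) holomorphic_on S" if "i < ?n" for v i
    using coord_has_field_derivative[OF bs _ X(2) _ that] D S
    by (intro holomorphic_onI) (meson field_differentiable_at_within field_differentiable_def)
  show "(\<lambda>w. det_id_minus (X w)) holomorphic_on S"
    unfolding det_id_minus_wrt(1)[OF X(1) bs X(2)] det_wrt_def
  proof (rule holomorphic_det_mat[of ?n])
    show "1\<^sub>m ?n - coord_matrix bs bs (blinfun_apply (X w)) \<in> carrier_mat ?n ?n" for w
      by (intro minus_carrier_mat) simp
    show "(\<lambda>w. (1\<^sub>m ?n - coord_matrix bs bs (blinfun_apply (X w))) $$ (i, j)) holomorphic_on S"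
      if "i < ?n" "j < ?n" for i j
      using that h by (auto intro!: holomorphic_intros)
  qed
  assume k: "k > 0"
  have c: "coord_matrix bs bs (blinfun_apply (X w)) ^\<^sub>m k \<in> carrier_mat ?n ?n" for w k
    by (simp add: pow_carrier_mat)
  have p: "(\<lambda>w. (coord_matrix bs bs (blinfun_apply (X w)) ^\<^sub>m k) $$ (i, j)) holomorphic_on S"
    if "i < ?n" "j < ?n" for i j k
    using that
  proof (induction k arbitrary: i j)
    case (Suc k)
    have "(coord_matrix bs bs (blinfun_apply (X w)) ^\<^sub>m Suc k) $$ (i, j) =
        (\<Sum>l<?n. (coord_matrix bs bs (blinfun_apply (X w)) ^\<^sub>m k) $$ (i, l) * coord bs (blinfun_apply (X w) (bs ! j)) l)" for w
      using Suc.prems c[of w k] by (auto simp: scalar_prod_def lessThan_atLeast0 intro!: sum.cong)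
    then show ?case using Suc h by (auto intro!: holomorphic_intros)
  qed simp
  have r: "range (blinfun_apply (op_power (X w) k)) \<subseteq> lspan bs" for w
    using k X(2)[of w] by (cases k) auto
  show "(\<lambda>w. op_trace (op_power (X w) k)) holomorphic_on S"
    unfolding det_id_minus_wrt(2)[OF bounded_ops_power[OF X(1)] bs r] trace_wrt_def
      coord_matrix_power[OF bs X] mat_trace_def
    using c by (auto intro!: holomorphic_intros p)
qed

lemma has_op_derivative_cong_open:
  assumes "open S" "w \<in> S" "\<And>v. v \<in> S \<Longrightarrow> X v = Y v" "has_op_derivative X D w"
  shows "has_op_derivative Y D w"
  using assms(4) unfolding has_op_derivative_def
  by (rule has_derivative_transform_within_open[OF _ assms(1,2,3)])

text \<open>The family may take arbitrary values off the open set, since it can be replaced by zero there.\<close>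

lemma holomorphic_det_trace_on:
  fixes bs :: "'a::complex_normed_vector list"
  assumes bs: "basis_list bs" and S: "open S"
    and X: "\<And>w. w \<in> S \<Longrightarrow> X w \<in> bounded_ops" "\<And>w. w \<in> S \<Longrightarrow> range (blinfun_apply (X w)) \<subseteq> lspan bs"
    and D: "\<And>w. w \<in> S \<Longrightarrow> \<exists>D. has_op_derivative X D w \<and> range (blinfun_apply D) \<subseteq> lspan bs"
  shows "(\<lambda>w. det_id_minus (X w)) holomorphic_on S"
    and "k > 0 \<Longrightarrow> (\<lambda>w. op_trace (op_power (X w) k)) holomorphic_on S"
proof -
  define Y where "Y w = (if w \<in> S then X w else 0)" for w
  have 1: "Y w \<in> bounded_ops" "range (blinfun_apply (Y w)) \<subseteq> lspan bs" for w
    using X by (auto simp: Y_def complex_vector.span_zero)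
  have 2: "\<exists>D. has_op_derivative Y D w \<and> range (blinfun_apply D) \<subseteq> lspan bs" if "w \<in> S" for w
    using D[OF that] has_op_derivative_cong_open[OF S that, of X Y] by (auto simp: Y_def)
  have 3: "(\<lambda>w. det_id_minus (Y w)) holomorphic_on S" by (rule holomorphic_det_trace(1)[OF bs S 1 2])
  show "(\<lambda>w. det_id_minus (X w)) holomorphic_on S"
    by (rule holomorphic_transform[OF 3]) (simp add: Y_def)
  assume k: "k > 0"
  have 4: "(\<lambda>w. op_trace (op_power (Y w) k)) holomorphic_on S" by (rule holomorphic_det_trace(2)[OF bs S 1 2 k])
  show "(\<lambda>w. op_trace (op_power (X w) k)) holomorphic_on S"
    by (rule holomorphic_transform[OF 4]) (simp add: Y_def)
qed

section \<open>Inverses and resolvents\<close>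

lemma inverse_op_unique: "is_inverse_op T S \<Longrightarrow> is_inverse_op T S' \<Longrightarrow> S = S'"
  unfolding is_inverse_op_def by (metis compose_assoc compose_id)

definition inv_op :: "('a::complex_normed_vector \<Rightarrow>\<^sub>L 'a) \<Rightarrow> ('a \<Rightarrow>\<^sub>L 'a)" where
  "inv_op T = (THE S. is_inverse_op T S)"

lemma inv_op_eq: "is_inverse_op T S \<Longrightarrow> inv_op T = S"
  unfolding inv_op_def using inverse_op_unique by blast

lemma is_inverse_inv_op: "is_inverse_op T S \<Longrightarrow> is_inverse_op T (inv_op T)"
  using inv_op_eq by metis

lemma resolvent_inv_op: "resolvent T z = inv_op (z *\<^sub>C id_blinfun - T)"
  by (simp add: resolvent_def inv_op_def)

lemma is_inverse_resolvent: "z \<notin> spectrum T \<Longrightarrow> is_inverse_op (z *\<^sub>C id_blinfun - T) (resolvent T z)"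
  unfolding resolvent_inv_op spectrum_def using is_inverse_inv_op by auto

lemma inverse_op_compose:
  assumes "is_inverse_op T S" "is_inverse_op T' S'"
  shows "is_inverse_op (T o\<^sub>L T') (S' o\<^sub>L S)"
proof -
  have "(S' o\<^sub>L S) o\<^sub>L (T o\<^sub>L T') = (S' o\<^sub>L ((S o\<^sub>L T) o\<^sub>L T'))" by (simp add: compose_assoc)
  moreover have "(T o\<^sub>L T') o\<^sub>L (S' o\<^sub>L S) = (T o\<^sub>L ((T' o\<^sub>L S') o\<^sub>L S))" by (simp add: compose_assoc)
  ultimately show ?thesis using assms by (auto simp: is_inverse_op_def)
qed

lemma inverse_op_scale:
  assumes "is_inverse_op T S" "c \<noteq> 0" "T \<in> bounded_ops"
  shows "is_inverse_op (c *\<^sub>C T) ((1 / c) *\<^sub>C S)"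
  using assms by (auto simp: is_inverse_op_def compose_scaleC_left compose_scaleC_right)

lemma inverse_op_apply:
  assumes "is_inverse_op T S"
  shows "blinfun_apply S (blinfun_apply T x) = x" "blinfun_apply T (blinfun_apply S x) = x"
  using assms unfolding is_inverse_op_def
  by (metis blinfun_apply_blinfun_compose id_blinfun.rep_eq id_apply)+

lemma norm_id_blinfun_le: "norm (id_blinfun :: 'a::real_normed_vector \<Rightarrow>\<^sub>L 'a) \<le> 1"
  by (rule norm_blinfun_bound) auto

text \<open>The equation \<open>u = y + X u\<close> is a contraction, so no series is needed.\<close>

lemma neumann_inverse:
  fixes X :: "'a::complex_banach \<Rightarrow>\<^sub>L 'a"
  assumes X: "X \<in> bounded_ops" and n: "norm X < 1"
  obtains S where "is_inverse_op (id_blinfun - X) S" "norm S \<le> 1 / (1 - norm X)"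
proof (rule inverse_opI[of "id_blinfun - X" "1 / (1 - norm X)"])
  show "id_blinfun - X \<in> bounded_ops" using X by auto
  fix x y
  have "norm x \<le> norm (x - blinfun_apply X x) + norm X * norm x"
    using norm_triangle_ineq[of "x - blinfun_apply X x" "blinfun_apply X x"] norm_blinfun[of X x] by simp
  then show "norm x \<le> 1 / (1 - norm X) * norm (blinfun_apply (id_blinfun - X) x)"
    using n by (simp add: blinfun.diff_left field_simps)
  have "\<forall>u v. dist (y + blinfun_apply X u) (y + blinfun_apply X v) \<le> norm X * dist u v"
    using norm_blinfun[of X] by (simp add: dist_norm flip: blinfun.diff_right)
  then obtain u where "y + blinfun_apply X u = u"
    using banach_fix_type[of "norm X" "\<lambda>u. y + blinfun_apply X u"] n by auto
  then have "blinfun_apply (id_blinfun - X) u = y" by (simp add: blinfun.diff_left algebra_simps)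
  then show "\<exists>u. blinfun_apply (id_blinfun - X) u = y" by blast
qed (use n in auto)

lemma inverse_op_perturb:
  fixes T :: "'a::complex_banach \<Rightarrow>\<^sub>L 'a"
  assumes T: "is_inverse_op T S" and E: "E \<in> bounded_ops" and n: "norm E * norm S < 1"
  obtains S' where "is_inverse_op (T - E) S'" "norm S' \<le> norm S / (1 - norm E * norm S)"
proof -
  have S: "S \<in> bounded_ops" "S o\<^sub>L T = id_blinfun" using T by (auto simp: is_inverse_op_def)
  have le: "norm (E o\<^sub>L S) \<le> norm E * norm S" by (rule norm_blinfun_compose)
  then obtain U where U: "is_inverse_op (id_blinfun - (E o\<^sub>L S)) U" "norm U \<le> 1 / (1 - norm (E o\<^sub>L S))"
    using neumann_inverse[of "E o\<^sub>L S"] E S n by auto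
  have "(id_blinfun - (E o\<^sub>L S)) o\<^sub>L T = T - E"
    by (simp add: compose_diff_left compose_assoc S)
  then have 1: "is_inverse_op (T - E) (S o\<^sub>L U)" using inverse_op_compose[OF U(1) T] by simp
  have le2: "1 / (1 - norm (E o\<^sub>L S)) \<le> 1 / (1 - norm E * norm S)"
    using le n by (intro divide_left_mono) (auto intro: mult_pos_pos)
  then have "norm S * norm U \<le> norm S * (1 / (1 - norm E * norm S))"
    using U(2) by (intro mult_left_mono) auto
  then have "norm (S o\<^sub>L U) \<le> norm S * (1 / (1 - norm E * norm S))"
    using norm_blinfun_compose[of S U] by linarith
  then show ?thesis using that[OF 1] by simp
qed

lemma bounded_bilinear_scaleC: "bounded_bilinear (scaleC :: complex \<Rightarrow> 'b::complex_normed_vector \<Rightarrow> 'b)"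
proof
  show "\<exists>K. \<forall>a b. norm (a *\<^sub>C (b::'b)) \<le> norm a * norm b * K"
    by (rule exI[of _ 1]) (simp add: norm_scaleC)
qed (simp_all add: complex_vector.scale_left_distrib complex_vector.scale_right_distrib scaleR_scaleC scaleC_scaleC
    scaleR_conv_of_real mult.commute)

lemma has_op_derivative_continuous: "has_op_derivative X D w \<Longrightarrow> isCont X w"
  unfolding has_op_derivative_def by (rule has_derivative_continuous)

lemma has_op_derivative_linear:
  fixes L :: "'b::complex_normed_vector \<Rightarrow> 'c::complex_normed_vector"
  assumes "bounded_linear L" "\<And>c x. L (c *\<^sub>C x) = c *\<^sub>C L x" "has_op_derivative X D w"
  shows "has_op_derivative (\<lambda>w. L (X w)) (L D) w"
  using bounded_linear.has_derivative[OF assms(1), of X "\<lambda>h. h *\<^sub>C D" "at w"] assms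
  by (simp add: has_op_derivative_def)

lemma has_op_derivative_scale:
  assumes "(f has_field_derivative f') (at w)" "has_op_derivative X D w"
  shows "has_op_derivative (\<lambda>w. f w *\<^sub>C X w) (f' *\<^sub>C X w + f w *\<^sub>C D) w"
proof -
  have "((\<lambda>w. f w *\<^sub>C X w) has_derivative (\<lambda>h. f w *\<^sub>C (h *\<^sub>C D) + (f' * h) *\<^sub>C X w)) (at w)"
    using bounded_bilinear.FDERIV[OF bounded_bilinear_scaleC assms(1)[unfolded has_field_derivative_def]
      assms(2)[unfolded has_op_derivative_def]] .
  moreover have "f w *\<^sub>C (h *\<^sub>C D) + (f' * h) *\<^sub>C X w = h *\<^sub>C (f' *\<^sub>C X w + f w *\<^sub>C D)" for h
    by (simp add: complex_vector.scale_right_distrib mult.commute)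
  ultimately show ?thesis by (simp add: has_op_derivative_def)
qed

text \<open>With \<open>R w\<close> the inverse of \<open>U + w V\<close>, the identity \<open>R (w + h) - R w = - h R (w + h) V R w\<close> is used twice.
  Both the resolvent and \<open>w \<mapsto> (I - w B)\<inverse>\<close> are families of this kind.\<close>

lemma inverse_op_family_derivative:
  fixes U V :: "'a::complex_banach \<Rightarrow>\<^sub>L 'a"
  assumes U: "U \<in> bounded_ops" and V: "V \<in> bounded_ops" and S: "is_inverse_op (U + w *\<^sub>C V) S"
  shows "has_op_derivative (\<lambda>w. inv_op (U + w *\<^sub>C V)) (- (S o\<^sub>L V o\<^sub>L S)) w"
    and "\<exists>\<delta>>0. \<forall>h. cmod h < \<delta> \<longrightarrow> (\<exists>S'. is_inverse_op (U + (w + h) *\<^sub>C V) S')"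
proof -
  let ?R = "\<lambda>w. inv_op (U + w *\<^sub>C V)"
  define \<delta> where "\<delta> = 1 / (2 * (norm V * norm S + 1))"
  have \<delta>: "\<delta> > 0" by (simp add: \<delta>_def add_nonneg_pos)
  have near: "\<exists>S'. is_inverse_op (U + (w + h) *\<^sub>C V) S' \<and> norm S' \<le> 2 * norm S" if h: "cmod h < \<delta>" for h
  proof -
    have "cmod h * (norm V * norm S) \<le> cmod h * (norm V * norm S + 1)" by (intro mult_left_mono) auto
    also have "\<dots> \<le> \<delta> * (norm V * norm S + 1)" using h by (intro mult_right_mono) auto
    also have "\<dots> = 1 / 2"
    proof -
      have "0 \<le> norm V * norm S" by simp
      then have "norm V * norm S + 1 \<noteq> 0" by linarith
      then show ?thesis by (simp add: \<delta>_def field_simps)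
    qed
    finally have n: "norm (- h *\<^sub>C V) * norm S \<le> 1 / 2" by (simp add: norm_scaleC mult_ac)
    obtain S' where S': "is_inverse_op (U + w *\<^sub>C V - (- h *\<^sub>C V)) S'"
      "norm S' \<le> norm S / (1 - norm (- h *\<^sub>C V) * norm S)"
      using inverse_op_perturb[OF S, of "- h *\<^sub>C V"] V n by auto
    have "norm S / (1 - norm (- h *\<^sub>C V) * norm S) \<le> norm S / (1 / 2)"
      using n by (intro divide_left_mono) auto
    also have "\<dots> = 2 * norm S" by simp
    finally have "norm S' \<le> 2 * norm S" using S'(2) by linarith
    moreover have e: "U + w *\<^sub>C V - (- h *\<^sub>C V) = U + (w + h) *\<^sub>C V"
      by (simp add: complex_vector.scale_left_distrib add.assoc)
    have "is_inverse_op (U + (w + h) *\<^sub>C V) S'" using S'(1) unfolding e .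
    ultimately show ?thesis by blast
  qed
  then show "\<exists>\<delta>>0. \<forall>h. cmod h < \<delta> \<longrightarrow> (\<exists>S'. is_inverse_op (U + (w + h) *\<^sub>C V) S')" using \<delta> by blast
  have Rw: "?R w = S" using S by (rule inv_op_eq)
  have Sb: "S \<in> bounded_ops" using S by (auto simp: is_inverse_op_def)
  have key: "norm (?R (w + h) - ?R w - h *\<^sub>C (- (S o\<^sub>L V o\<^sub>L S))) / norm h
      \<le> cmod h * (2 * norm S * norm V * norm S * norm V * norm S)" if h: "cmod h < \<delta>" for h
  proof -
    obtain S' where S': "is_inverse_op (U + (w + h) *\<^sub>C V) S'" "norm S' \<le> 2 * norm S" using near[OF h] by blast
    have S'b: "S' \<in> bounded_ops" using S' by (auto simp: is_inverse_op_def)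
    have R': "?R (w + h) = S'" using S'(1) by (rule inv_op_eq)
    have d: "S' - S = - (h *\<^sub>C (S' o\<^sub>L V o\<^sub>L S))"
    proof -
      have "S' - S = (S' o\<^sub>L ((U + w *\<^sub>C V) - (U + (w + h) *\<^sub>C V)) o\<^sub>L S)"
      proof -
        have "(S' o\<^sub>L (U + (w + h) *\<^sub>C V)) = id_blinfun" "((U + w *\<^sub>C V) o\<^sub>L S) = id_blinfun"
          using S S' by (auto simp: is_inverse_op_def)
        then show ?thesis
          by (simp only: compose_diff_left compose_diff_right compose_assoc)
            (metis compose_assoc compose_id(1,2))
      qed
      also have "(U + w *\<^sub>C V) - (U + (w + h) *\<^sub>C V) = (- h) *\<^sub>C V"
        by (simp add: complex_vector.scale_left_distrib)
      finally show ?thesis using S'b V Sb by (simp add: compose_scaleC_left compose_scaleC_right compose_assoc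
            del: complex_vector.scale_minus_left)
            (simp add: compose_scaleC_left)
    qed
    have "S' - S - h *\<^sub>C (- (S o\<^sub>L V o\<^sub>L S)) = - (h *\<^sub>C ((S' - S) o\<^sub>L V o\<^sub>L S))"
      unfolding compose_diff_left complex_vector.scale_right_diff_distrib using d by simp
    also have "\<dots> = h *\<^sub>C (h *\<^sub>C (S' o\<^sub>L V o\<^sub>L S o\<^sub>L V o\<^sub>L S))"
      unfolding d by (rule blinfun_eqI) (simp add: blinfun.minus_left blinfun.minus_right bounded_ops_apply V Sb S'b)
    finally have "norm (S' - S - h *\<^sub>C (- (S o\<^sub>L V o\<^sub>L S))) =
        cmod h * (cmod h * norm (S' o\<^sub>L V o\<^sub>L S o\<^sub>L V o\<^sub>L S))" by (simp only: norm_scaleC)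
    moreover have "norm (S' o\<^sub>L V o\<^sub>L S o\<^sub>L V o\<^sub>L S) \<le> 2 * norm S * norm V * norm S * norm V * norm S"
      by (intro order_trans[OF norm_blinfun_compose] mult_right_mono norm_ge_zero S'(2))
    then have "cmod h * (cmod h * norm (S' o\<^sub>L V o\<^sub>L S o\<^sub>L V o\<^sub>L S)) / norm h
        \<le> cmod h * (2 * norm S * norm V * norm S * norm V * norm S)"
      by (cases "h = 0") (auto simp: mult_left_mono)
    ultimately show ?thesis unfolding Rw R' by (simp only:)
  qed
  have "(\<lambda>h. norm (?R (w + h) - ?R w - h *\<^sub>C (- (S o\<^sub>L V o\<^sub>L S))) / norm h) \<midarrow>0\<rightarrow> 0"
  proof (rule Lim_null_comparison)
    show "\<forall>\<^sub>F h in at 0. norm (norm (?R (w + h) - ?R w - h *\<^sub>C (- (S o\<^sub>L V o\<^sub>L S))) / norm h)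
      \<le> cmod h * (2 * norm S * norm V * norm S * norm V * norm S)"
      unfolding eventually_at using key \<delta> by (intro exI[of _ \<delta>]) (auto simp: dist_norm)
    show "(\<lambda>h. cmod h * (2 * norm S * norm V * norm S * norm V * norm S)) \<midarrow>0\<rightarrow> 0"
      by (intro tendsto_mult_left_zero tendsto_norm_zero tendsto_ident_at)
  qed
  moreover have "bounded_linear (\<lambda>h. h *\<^sub>C (- (S o\<^sub>L V o\<^sub>L S)))"
    by (rule bounded_bilinear.bounded_linear_left[OF bounded_bilinear_scaleC])
  ultimately show "has_op_derivative ?R (- (S o\<^sub>L V o\<^sub>L S)) w"
    unfolding has_op_derivative_def has_derivative_at by blast
qed

lemma resolvent_derivative:
  fixes T :: "'a::complex_banach \<Rightarrow>\<^sub>L 'a"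
  assumes T: "T \<in> bounded_ops" and z: "z \<notin> spectrum T"
  shows "has_op_derivative (resolvent T) (- (resolvent T z o\<^sub>L resolvent T z)) z"
    and "\<exists>\<delta>>0. ball z \<delta> \<inter> spectrum T = {}"
proof -
  have e: "z *\<^sub>C id_blinfun - T = - T + z *\<^sub>C id_blinfun" for z by simp
  have S: "is_inverse_op (- T + z *\<^sub>C id_blinfun) (resolvent T z)" using is_inverse_resolvent[OF z] by simp
  have id: "id_blinfun \<in> bounded_ops" by simp
  note i = inverse_op_family_derivative[OF bounded_ops_intros(5)[OF T] id S]
  have "resolvent T = (\<lambda>w. inv_op (- T + w *\<^sub>C id_blinfun))"
    by (rule ext) (simp only: resolvent_inv_op e)
  then show "has_op_derivative (resolvent T) (- (resolvent T z o\<^sub>L resolvent T z)) z"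
    using i(1) by simp
  obtain \<delta> where d: "\<delta> > 0" "\<And>h. cmod h < \<delta> \<Longrightarrow> \<exists>S'. is_inverse_op (- T + (z + h) *\<^sub>C id_blinfun) S'"
    using i(2) by blast
  have "v \<notin> spectrum T" if "v \<in> ball z \<delta>" for v
  proof -
    have "\<exists>S'. is_inverse_op (- T + (z + (v - z)) *\<^sub>C id_blinfun) S'"
      using that by (intro d(2)) (simp add: dist_norm norm_minus_commute)
    then show ?thesis unfolding spectrum_def e by simp
  qed
  then show "\<exists>\<delta>>0. ball z \<delta> \<inter> spectrum T = {}" using d(1) by blast
qed

text \<open>The resolvent at \<open>1 / w\<close>, rescaled so that the point at infinity becomes the regular point
  \<open>w = 0\<close>.\<close>

definition neumann :: "('a::complex_normed_vector \<Rightarrow>\<^sub>L 'a) \<Rightarrow> complex \<Rightarrow> ('a \<Rightarrow>\<^sub>L 'a)" where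
  "neumann B w = inv_op (id_blinfun - w *\<^sub>C B)"

lemma neumann_properties:
  fixes B :: "'a::complex_banach \<Rightarrow>\<^sub>L 'a"
  assumes B: "B \<in> bounded_ops" and w: "cmod w * norm B < 1"
  shows "is_inverse_op (id_blinfun - w *\<^sub>C B) (neumann B w)" "norm (neumann B w) \<le> 1 / (1 - cmod w * norm B)"
    "neumann B w \<in> bounded_ops" "has_op_derivative (neumann B) (neumann B w o\<^sub>L B o\<^sub>L neumann B w) w"
proof -
  obtain S where S: "is_inverse_op (id_blinfun - w *\<^sub>C B) S" "norm S \<le> 1 / (1 - norm (w *\<^sub>C B))"
    using neumann_inverse[of "w *\<^sub>C B"] assms by (auto simp: norm_scaleC)
  have g: "neumann B w = S" unfolding neumann_def using S(1) by (rule inv_op_eq)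
  show "is_inverse_op (id_blinfun - w *\<^sub>C B) (neumann B w)" "norm (neumann B w) \<le> 1 / (1 - cmod w * norm B)"
    using S g by (auto simp: norm_scaleC)
  then show gb: "neumann B w \<in> bounded_ops" by (auto simp: is_inverse_op_def)
  have e: "id_blinfun - w *\<^sub>C B = id_blinfun + w *\<^sub>C (- B)" for w by simp
  have "has_op_derivative (\<lambda>w. inv_op (id_blinfun + w *\<^sub>C (- B))) (- (S o\<^sub>L (- B) o\<^sub>L S)) w"
    by (rule inverse_op_family_derivative) (use B S in auto)
  moreover have "- (S o\<^sub>L (- B) o\<^sub>L S) = (S o\<^sub>L B o\<^sub>L S)"
    by (rule blinfun_eqI) (simp add: blinfun.minus_left blinfun.minus_right)
  ultimately show "has_op_derivative (neumann B) (neumann B w o\<^sub>L B o\<^sub>L neumann B w) w"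
    unfolding g by (simp add: neumann_def[abs_def])
qed

lemma norm_spectrum_le:
  fixes T :: "'a::complex_banach \<Rightarrow>\<^sub>L 'a"
  assumes T: "T \<in> bounded_ops" and z: "z \<in> spectrum T"
  shows "cmod z \<le> norm T"
proof (rule ccontr)
  assume "\<not> ?thesis"
  then have n: "norm T < cmod z" "z \<noteq> 0" using norm_ge_zero[of T] by (auto simp: not_le)
  then have "cmod (1 / z) * norm T < 1" by (simp add: norm_divide)
  from neumann_properties(1)[OF T this] have "is_inverse_op (z *\<^sub>C (id_blinfun - (1 / z) *\<^sub>C T)) ((1 / z) *\<^sub>C neumann T (1 / z))"
    using n(2) T by (intro inverse_op_scale) auto
  then show False using z n(2) by (auto simp: spectrum_def complex_vector.scale_right_diff_distrib)
qed

section \<open>Means over circles\<close>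

lemma has_integral_unique_cong:
  fixes f g :: "'n::euclidean_space \<Rightarrow> 'b::real_normed_vector"
  assumes "(f has_integral a) S" "(g has_integral b) S" "\<And>t. f t = g t" shows "a = b"
proof -
  have "f = g" using assms(3) by (rule ext)
  then show ?thesis using assms(1,2) has_integral_unique by simp
qed

text \<open>The vector from the centre to a point of the circle, with the parameter of a circle path.\<close>

abbreviation circ :: "real \<Rightarrow> real \<Rightarrow> complex" where
  "circ r t \<equiv> of_real r * exp (2 * of_real pi * \<i> * of_real t)"

lemma cmod_circ [simp]: "cmod (circ r t) = \<bar>r\<bar>"
proof -
  have "2 * of_real pi * \<i> * of_real t = \<i> * of_real (2 * pi * t)" by simp
  then show ?thesis by (metis norm_exp_i_times norm_mult norm_of_real mult.right_neutral)
qed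

text \<open>Cauchy's theorem in the form needed for vector valued functions. The mean over the circle of radius
  \<open>\<rho>\<close> has derivative zero in \<open>\<rho>\<close>, because the derivatives of \<open>k (z + \<rho> e(t))\<close> in \<open>\<rho>\<close> and in \<open>t\<close>
  differ by a constant factor and the function is periodic in \<open>t\<close>; and it tends to zero with \<open>\<rho>\<close>.\<close>

lemma circle_mean_zero:
  fixes k k' :: "complex \<Rightarrow> 'b::{complex_normed_vector, banach}"
  assumes r: "0 < r"
    and der: "\<And>w. w \<noteq> z \<Longrightarrow> dist z w \<le> r \<Longrightarrow> has_op_derivative k (k' w) w"
    and cont: "continuous_on (cball z r - {z}) k'"
    and lim: "(k \<longlongrightarrow> 0) (at z)"
  shows "integral {0..1} (\<lambda>t. k (z + circ r t)) = 0"
proof -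
  let ?U = "{0<..r}"
  define e where "e t = exp (2 * of_real pi * \<i> * of_real t)" for t :: real
  define J where "J \<rho> = integral (cbox 0 1) (\<lambda>t. k (z + of_real \<rho> * e t))" for \<rho> :: real
  have ce: "continuous_on A e" for A unfolding e_def by (intro continuous_intros)
  have en: "cmod (e t) = 1" for t using cmod_circ[of 1 t] by (simp add: e_def)
  have inU: "z + of_real \<rho> * e t \<noteq> z \<and> dist z (z + of_real \<rho> * e t) \<le> r" if "\<rho> \<in> ?U" for \<rho> t
  proof -
    have "cmod (of_real \<rho> * e t) = \<rho>" using that en by (simp add: norm_mult)
    then show ?thesis using that by (auto simp: dist_norm norm_minus_commute)
  qed
  have dk: "((\<lambda>\<rho>. k (z + of_real \<rho> * e t)) has_vector_derivative e t *\<^sub>C k' (z + of_real \<rho> * e t)) (at \<rho> within ?U)"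
    if "\<rho> \<in> ?U" for \<rho> t
  proof -
    have p: "((\<lambda>\<rho>. z + of_real \<rho> * e t) has_derivative (\<lambda>h. of_real h * e t)) (at \<rho> within ?U)"
      by (auto intro!: derivative_eq_intros)
    have "(k has_derivative (\<lambda>h. h *\<^sub>C k' (z + of_real \<rho> * e t))) (at (z + of_real \<rho> * e t))"
      using der inU[OF that] unfolding has_op_derivative_def by blast
    from has_derivative_compose[OF p this] show ?thesis
      unfolding has_vector_derivative_def by (simp add: scaleR_scaleC)
  qed
  have dt: "((\<lambda>t. k (z + of_real \<rho> * e t)) has_vector_derivative
      (2 * of_real pi * \<i> * of_real \<rho>) *\<^sub>C (e t *\<^sub>C k' (z + of_real \<rho> * e t))) (at t within {0..1})"
    if "\<rho> \<in> ?U" for \<rho> t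
  proof -
    have ed: "(e has_vector_derivative (2 * of_real pi * \<i>) * e t) (at t within {0..1})"
      unfolding e_def
      by (rule has_vector_derivative_real_field) (auto intro!: derivative_eq_intros)
    then have p: "((\<lambda>t. z + of_real \<rho> * e t) has_derivative (\<lambda>h. of_real \<rho> * (h *\<^sub>R ((2 * of_real pi * \<i>) * e t)))) (at t within {0..1})"
      unfolding has_vector_derivative_def by (auto intro!: derivative_eq_intros)
    have "(k has_derivative (\<lambda>h. h *\<^sub>C k' (z + of_real \<rho> * e t))) (at (z + of_real \<rho> * e t))"
      using der inU[OF that] unfolding has_op_derivative_def by blast
    from has_derivative_compose[OF p this] show ?thesis
      unfolding has_vector_derivative_def by (simp add: scaleR_scaleC scaleR_conv_of_real mult_ac)
  qed
  have ck: "continuous_on {0..1} (\<lambda>t. k (z + of_real \<rho> * e t))" if "\<rho> \<in> ?U" for \<rho>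
    unfolding continuous_on_eq_continuous_within
    using has_vector_derivative_continuous[OF dt[OF that]] by blast
  have cc: "continuous_on (?U \<times> cbox 0 1) (\<lambda>(\<rho>, t). e t *\<^sub>C k' (z + of_real \<rho> * e t))"
  proof -
    have 1: "continuous_on (?U \<times> cbox 0 1) (\<lambda>x. z + of_real (fst x) * e (snd x))"
      unfolding e_def by (intro continuous_intros)
    have "continuous_on (?U \<times> cbox 0 1) (\<lambda>x. k' (z + of_real (fst x) * e (snd x)))"
      by (rule continuous_on_compose2[OF cont 1]) (use inU in auto)
    moreover have "continuous_on (?U \<times> cbox 0 1) (\<lambda>x. e (snd x))"
      unfolding e_def by (intro continuous_intros)
    ultimately show ?thesis
      using bounded_bilinear.continuous_on[OF bounded_bilinear_scaleC] by (simp add: split_beta)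
  qed
  have J': "(J has_vector_derivative 0) (at \<rho> within ?U)" if U: "\<rho> \<in> ?U" for \<rho>
  proof -
    have "(J has_vector_derivative integral (cbox 0 1) (\<lambda>t. e t *\<^sub>C k' (z + of_real \<rho> * e t))) (at \<rho> within ?U)"
      unfolding J_def
      using dk ck cc U
      by (intro leibniz_rule_vector_derivative) (auto intro!: integrable_continuous_interval)
    also have "((\<lambda>t. e t *\<^sub>C k' (z + of_real \<rho> * e t)) has_integral 0) (cbox 0 1)"
    proof -
      let ?c = "2 * of_real pi * \<i> * of_real \<rho> :: complex"
      have c0: "?c \<noteq> 0" using U by simp
      have "((\<lambda>t. ?c *\<^sub>C (e t *\<^sub>C k' (z + of_real \<rho> * e t))) has_integral
          (k (z + of_real \<rho> * e 1) - k (z + of_real \<rho> * e 0))) {0..1}"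
        by (rule fundamental_theorem_of_calculus) (use dt[OF U] in auto)
      moreover have "e 1 = e 0" unfolding e_def by simp
      ultimately have "((\<lambda>t. ?c *\<^sub>C (e t *\<^sub>C k' (z + of_real \<rho> * e t))) has_integral 0) {0..1}" by simp
      from has_integral_linear[OF this bounded_bilinear.bounded_linear_right[OF bounded_bilinear_scaleC], of "1 / ?c"]
      have "((\<lambda>t. (1 / ?c) *\<^sub>C (?c *\<^sub>C (e t *\<^sub>C k' (z + of_real \<rho> * e t)))) has_integral 0) {0..1}"
        by (simp only: o_def complex_vector.scale_zero_right)
      then show ?thesis using c0 by (simp add: divide_simps)
    qed
    then have "integral (cbox 0 1) (\<lambda>t. e t *\<^sub>C k' (z + of_real \<rho> * e t)) = 0" by (rule integral_unique)
    finally show ?thesis .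
  qed
  obtain c where c: "\<And>\<rho>. \<rho> \<in> ?U \<Longrightarrow> J \<rho> = c"
    using has_vector_derivative_zero_constant[of ?U J] J' by auto
  have "norm c \<le> \<epsilon>" if \<epsilon>: "\<epsilon> > 0" for \<epsilon>
  proof -
    obtain d where d: "d > 0" "\<And>w. w \<noteq> z \<Longrightarrow> dist w z < d \<Longrightarrow> norm (k w) < \<epsilon>"
      using tendstoD[OF lim \<epsilon>] by (auto simp: eventually_at)
    define \<rho> where "\<rho> = min r (d / 2)"
    have \<rho>: "\<rho> \<in> ?U" "\<rho> < d" using r d(1) by (auto simp: \<rho>_def)
    have "norm (J \<rho>) \<le> \<epsilon> * (1 - 0)"
      unfolding J_def cbox_interval
    proof (rule integral_bound)
      show "continuous_on {0..1} (\<lambda>t. k (z + of_real \<rho> * e t))" by (rule ck[OF \<rho>(1)])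
      show "norm (k (z + of_real \<rho> * e t)) \<le> \<epsilon>" if "t \<in> {0..1}" for t
        using d(2)[of "z + of_real \<rho> * e t"] \<rho> inU[OF \<rho>(1), of t] en
        by (auto simp: dist_norm norm_mult intro: less_imp_le)
    qed simp
    then show ?thesis using c[OF \<rho>(1)] by simp
  qed
  then have "norm c \<le> 0" using field_le_epsilon[of "norm c" 0] by simp
  then show ?thesis using c[of r] r by (simp add: J_def e_def)
qed

lemma circle_mean_power:
  fixes x :: "'b::{complex_normed_vector, banach}"
  assumes r: "0 < r"
  shows "((\<lambda>t. (1 / circ r t ^ j) *\<^sub>C x) has_integral (if j = 0 then x else 0)) {0..1}"
proof (cases "j = 0")
  case True
  then show ?thesis using has_integral_const_real[of x 0 1] by simp
next
  case False
  define a where "a = - (2 * of_real pi * \<i> * of_nat j)"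
  have a0: "a \<noteq> 0" using False by (simp add: a_def)
  have e: "1 / circ r t ^ j = (1 / of_real r ^ j) * exp (a * of_real t)" for t
  proof -
    have "exp (2 * of_real pi * \<i> * of_real t) ^ j = exp (of_nat j * (2 * of_real pi * \<i> * of_real t))"
      by (rule exp_of_nat_mult[symmetric])
    then show ?thesis using r by (simp add: power_mult_distrib a_def exp_minus field_simps)
  qed
  have "((\<lambda>t. exp (a * of_real t)) has_integral (exp (a * of_real 1) / a - exp (a * of_real 0) / a)) {0..1}"
  proof (rule fundamental_theorem_of_calculus)
    show "((\<lambda>t. exp (a * of_real t) / a) has_vector_derivative exp (a * of_real t)) (at t within {0..1})" for t
      by (rule has_vector_derivative_real_field) (use a0 in \<open>auto intro!: derivative_eq_intros\<close>)
  qed simp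
  moreover have "exp a = 1"
  proof -
    have "exp (of_nat j * (2 * of_real pi * \<i>)) = (1::complex)"
      unfolding exp_of_nat_mult by simp
    then have "exp (- (of_nat j * (2 * of_real pi * \<i>))) = (1::complex)" by (simp only: exp_minus) simp
    then show ?thesis by (simp add: a_def mult_ac)
  qed
  ultimately have "((\<lambda>t. exp (a * of_real t)) has_integral 0) {0..1}" by simp
  from has_integral_linear[OF this bounded_bilinear.bounded_linear_left[OF bounded_bilinear_scaleC],
      of "(1 / of_real r ^ j) *\<^sub>C x"]
  have "((\<lambda>t. exp (a * of_real t) *\<^sub>C ((1 / of_real r ^ j) *\<^sub>C x)) has_integral 0) {0..1}" by (simp add: o_def)
  moreover have "(1 / circ r t ^ j) *\<^sub>C x = exp (a * of_real t) *\<^sub>C ((1 / of_real r ^ j) *\<^sub>C x)" for t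
    by (subst e) (simp add: mult.commute)
  ultimately show ?thesis using False by (simp only: if_False)
qed

section \<open>Riesz projections\<close>

abbreviation shift :: "('a::complex_normed_vector \<Rightarrow>\<^sub>L 'a) \<Rightarrow> complex \<Rightarrow> ('a \<Rightarrow>\<^sub>L 'a)" where
  "shift T z \<equiv> T - z *\<^sub>C id_blinfun"

context
  fixes T :: "'a::complex_banach \<Rightarrow>\<^sub>L 'a" and z :: complex and r :: real
  assumes T: "T \<in> bounded_ops" and r: "0 < r" and iso: "cball z r \<inter> spectrum T \<subseteq> {z}"
begin

text \<open>The Riesz projection, with the factor \<open>2 \<pi> \<i>\<close> cancelled against the derivative of the circle.\<close>

definition "circle_proj = integral {0..1} (\<lambda>t. circ r t *\<^sub>C resolvent T (z + circ r t))"

lemma punctured_not_spectrum: "w \<noteq> z \<Longrightarrow> dist z w \<le> r \<Longrightarrow> w \<notin> spectrum T"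
  using iso by auto

lemma circle_not_spectrum: "z + circ r t \<notin> spectrum T"
  by (rule punctured_not_spectrum) (use r in \<open>auto simp: dist_norm\<close>)

lemma resolvent_circle_continuous: "continuous_on A (\<lambda>t. resolvent T (z + circ r t))"
proof (rule continuous_at_imp_continuous_on, rule ballI)
  fix t
  have "isCont (\<lambda>t. z + circ r t) t" by (intro continuous_intros)
  moreover have "isCont (resolvent T) (z + circ r t)"
    using resolvent_derivative(1)[OF T circle_not_spectrum] has_op_derivative_continuous by blast
  ultimately show "isCont (\<lambda>t. resolvent T (z + circ r t)) t" by (rule isCont_o2)
qed

lemma circle_integrable: "(\<lambda>t. circ r t *\<^sub>C resolvent T (z + circ r t)) integrable_on {0..1}"
  by (intro integrable_continuous_interval bounded_bilinear.continuous_on[OF bounded_bilinear_scaleC]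
      resolvent_circle_continuous continuous_intros)

lemma circle_proj_contour:
  "(1 / (2 * of_real pi * \<i>)) *\<^sub>C op_contour_integral (circlepath z r) (resolvent T) = circle_proj"
proof -
  have cp: "circlepath z r t = z + circ r t" for t by (simp add: circlepath)
  have "op_contour_integral (circlepath z r) (resolvent T) =
      integral {0..1} (\<lambda>t. (2 * of_real pi * \<i>) *\<^sub>C (circ r t *\<^sub>C resolvent T (z + circ r t)))"
    unfolding op_contour_integral_def
    by (rule integral_cong) (auto simp: vector_derivative_circlepath01 cp mult_ac)
  also have "\<dots> = (2 * of_real pi * \<i>) *\<^sub>C circle_proj"
    unfolding circle_proj_def
    using integral_linear[OF circle_integrable
        bounded_bilinear.bounded_linear_right[OF bounded_bilinear_scaleC], of "2 * of_real pi * \<i>"]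
    by (simp add: o_def)
  finally show ?thesis by simp
qed

lemma circle_proj_linear:
  assumes L: "bounded_linear L"
  shows "((\<lambda>t. L (circ r t *\<^sub>C resolvent T (z + circ r t))) has_integral L circle_proj) {0..1}"
  unfolding circle_proj_def
  using has_integral_linear[OF integrable_integral[OF circle_integrable] L] by (simp add: o_def)

lemma resolvent_bounded_ops: "w \<notin> spectrum T \<Longrightarrow> resolvent T w \<in> bounded_ops"
  using is_inverse_resolvent[of w T] by (simp add: is_inverse_op_def)

lemma circle_proj_bounded_ops: "circle_proj \<in> bounded_ops"
proof (rule bounded_opsI)
  fix c x
  have "((\<lambda>t. blinfun_apply (circ r t *\<^sub>C resolvent T (z + circ r t)) (c *\<^sub>C x)) has_integral blinfun_apply circle_proj (c *\<^sub>C x)) {0..1}"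
    by (rule circle_proj_linear) (rule blinfun.bounded_linear_left)
  moreover have "bounded_linear (\<lambda>S :: 'a \<Rightarrow>\<^sub>L 'a. c *\<^sub>C blinfun_apply S x)"
    by (rule bounded_linear_compose[OF bounded_bilinear.bounded_linear_right[OF bounded_bilinear_scaleC] blinfun.bounded_linear_left])
  from circle_proj_linear[OF this] have "((\<lambda>t. c *\<^sub>C blinfun_apply (circ r t *\<^sub>C resolvent T (z + circ r t)) x) has_integral c *\<^sub>C blinfun_apply circle_proj x) {0..1}" .
  moreover have "blinfun_apply (circ r t *\<^sub>C resolvent T (z + circ r t)) (c *\<^sub>C x) = c *\<^sub>C blinfun_apply (circ r t *\<^sub>C resolvent T (z + circ r t)) x" for t
    using resolvent_bounded_ops[OF circle_not_spectrum, of t] by (simp add: bounded_ops_apply mult.commute)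
  ultimately show "blinfun_apply circle_proj (c *\<^sub>C x) = c *\<^sub>C blinfun_apply circle_proj x"
    by (rule has_integral_unique_cong)
qed

lemma resolvent_commute:
  assumes "w \<notin> spectrum T" shows "(resolvent T w o\<^sub>L T) = (T o\<^sub>L resolvent T w)"
proof -
  have "(resolvent T w o\<^sub>L (w *\<^sub>C id_blinfun - T)) = ((w *\<^sub>C id_blinfun - T) o\<^sub>L resolvent T w)"
    using is_inverse_resolvent[OF assms] by (auto simp: is_inverse_op_def)
  then show ?thesis
    using resolvent_bounded_ops[OF assms]
    by (simp add: compose_diff_left compose_diff_right compose_scaleC_left compose_scaleC_right)
qed

lemma circle_proj_commute: "(circle_proj o\<^sub>L T) = (T o\<^sub>L circle_proj)"
proof -
  have "((\<lambda>t. (circ r t *\<^sub>C resolvent T (z + circ r t)) o\<^sub>L T) has_integral (circle_proj o\<^sub>L T)) {0..1}"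
    by (rule circle_proj_linear) (rule bounded_bilinear.bounded_linear_left[OF bounded_bilinear_blinfun_compose])
  moreover have "((\<lambda>t. T o\<^sub>L (circ r t *\<^sub>C resolvent T (z + circ r t))) has_integral (T o\<^sub>L circle_proj)) {0..1}"
    by (rule circle_proj_linear) (rule bounded_bilinear.bounded_linear_right[OF bounded_bilinear_blinfun_compose])
  moreover have "((circ r t *\<^sub>C resolvent T (z + circ r t)) o\<^sub>L T) = (T o\<^sub>L (circ r t *\<^sub>C resolvent T (z + circ r t)))" for t
    using T by (simp add: compose_scaleC_left compose_scaleC_right resolvent_commute circle_not_spectrum)
  ultimately show ?thesis by (rule has_integral_unique_cong)
qed

text \<open>On a generalized eigenvector \<open>x\<close> the resolvent satisfies \<open>(w - z) R(w) x = x + R(w) (T - z) x\<close>.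
  By induction on the order of \<open>x\<close> only the first term contributes to the integral; the negative powers
  of \<open>w - z\<close> have to be carried along.\<close>

lemma circle_proj_fixes_aux:
  "blinfun_apply (op_power (shift T z) k) x = 0 \<Longrightarrow>
    ((\<lambda>t. (1 / circ r t ^ j) *\<^sub>C blinfun_apply (circ r t *\<^sub>C resolvent T (z + circ r t)) x) has_integral
      (if j = 0 then x else 0)) {0..1}"
proof (induction k arbitrary: j x)
  case 0
  then show ?case by (simp add: blinfun.zero_right)
next
  case (Suc k)
  let ?y = "blinfun_apply (shift T z) x"
  have "blinfun_apply (op_power (shift T z) k) ?y = 0"
    using Suc.prems unfolding op_power_Suc2 by simp
  note IH = Suc.IH[OF this, of "Suc j"]
  have e: "(1 / circ r t ^ j) *\<^sub>C x + (1 / circ r t ^ Suc j) *\<^sub>C blinfun_apply (circ r t *\<^sub>C resolvent T (z + circ r t)) ?y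
     = (1 / circ r t ^ j) *\<^sub>C blinfun_apply (circ r t *\<^sub>C resolvent T (z + circ r t)) x" for t
  proof -
    let ?R = "resolvent T (z + circ r t)" and ?m = "circ r t"
    have Rb: "?R \<in> bounded_ops" by (rule resolvent_bounded_ops[OF circle_not_spectrum])
    have "blinfun_apply ?R (blinfun_apply ((z + ?m) *\<^sub>C id_blinfun - T) x) = x"
      by (rule inverse_op_apply(1)[OF is_inverse_resolvent[OF circle_not_spectrum]])
    moreover have "blinfun_apply ((z + ?m) *\<^sub>C id_blinfun - T) x = ?m *\<^sub>C x - ?y"
      by (simp add: blinfun.diff_left blinfun.add_left complex_vector.scale_left_distrib)
    ultimately have "blinfun_apply ?R (?m *\<^sub>C x - ?y) = x" by simp
    then have "?m *\<^sub>C blinfun_apply ?R x - blinfun_apply ?R ?y = x"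
      by (simp only: blinfun.diff_right bounded_ops_apply[OF Rb])
    then have 1: "?m *\<^sub>C blinfun_apply ?R x = x + blinfun_apply ?R ?y" by (simp only: diff_eq_eq)
    have "?m \<noteq> 0" using r by simp
    then show ?thesis
      by (simp add: 1 complex_vector.scale_right_distrib)
  qed
  have "((\<lambda>t. (1 / circ r t ^ j) *\<^sub>C x + (1 / circ r t ^ Suc j) *\<^sub>C blinfun_apply (circ r t *\<^sub>C resolvent T (z + circ r t)) ?y)
    has_integral ((if j = 0 then x else 0) + (if Suc j = 0 then ?y else 0))) {0..1}"
    by (rule has_integral_add[OF circle_mean_power[OF r] IH])
  then show ?case unfolding e by simp
qed

lemma circle_proj_fixes:
  assumes "blinfun_apply (op_power (shift T z) k) x = 0"
  shows "blinfun_apply circle_proj x = x"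
proof -
  have "((\<lambda>t. blinfun_apply (circ r t *\<^sub>C resolvent T (z + circ r t)) x) has_integral blinfun_apply circle_proj x) {0..1}"
    by (rule circle_proj_linear) (rule blinfun.bounded_linear_left)
  moreover have "((\<lambda>t. (1 / circ r t ^ 0) *\<^sub>C blinfun_apply (circ r t *\<^sub>C resolvent T (z + circ r t)) x)
      has_integral (if (0::nat) = 0 then x else 0)) {0..1}"
    by (rule circle_proj_fixes_aux[OF assms])
  ultimately have "blinfun_apply circle_proj x = (if (0::nat) = 0 then x else 0)"
    by (rule has_integral_unique_cong) simp
  then show ?thesis by simp
qed

text \<open>The integral of \<open>(T - z)^m R(w)\<close> vanishes: this function differs from \<open>(w - z)^m R(w)\<close> by a polynomial,
  hence it stays bounded near \<open>z\<close> when the pole has order at most \<open>m\<close>. Together with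
  \<open>circle_proj_fixes\<close> this shows that the range of the projection is the generalized eigenspace, and
  that it is a projection.\<close>

lemma circle_proj_annihilated:
  assumes \<delta>: "0 < \<delta>" and pole: "\<And>w. w \<noteq> z \<Longrightarrow> dist z w < \<delta> \<Longrightarrow> norm (resolvent T w) \<le> C / dist z w ^ m"
  shows "(op_power (shift T z) m o\<^sub>L circle_proj) = 0"
proof -
  let ?V = "shift T z"
  have V: "?V \<in> bounded_ops" using T by auto
  define g where "g w = (op_power ?V m o\<^sub>L resolvent T w)" for w
  define g' where "g' w = (op_power ?V m o\<^sub>L (- (resolvent T w o\<^sub>L resolvent T w)))" for w
  have dg: "has_op_derivative g (g' w) w" if "w \<notin> spectrum T" for w
    unfolding g_def g'_def
    by (rule has_op_derivative_linear[OF bounded_bilinear.bounded_linear_right[OF bounded_bilinear_blinfun_compose]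
          _ resolvent_derivative(1)[OF T that]])
      (use V in \<open>simp add: compose_scaleC_right\<close>)
  have bound: "\<exists>D\<ge>0. \<forall>w. w \<noteq> z \<longrightarrow> dist z w < min (min \<delta> 1) r \<longrightarrow>
      norm (op_power ?V i o\<^sub>L resolvent T w) \<le> D / dist z w ^ (m - i)" if "i \<le> m" for i
    using that
  proof (induction i)
    case 0
    show ?case
    proof (intro exI[of _ "\<bar>C\<bar>"] conjI allI impI)
      fix w assume "w \<noteq> z" "dist z w < min (min \<delta> 1) r"
      then have "norm (resolvent T w) \<le> C / dist z w ^ m" by (intro pole) auto
      also have "\<dots> \<le> \<bar>C\<bar> / dist z w ^ m" by (intro divide_right_mono) auto
      finally show "norm (op_power ?V 0 o\<^sub>L resolvent T w) \<le> \<bar>C\<bar> / dist z w ^ (m - 0)" by simp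
    qed simp
  next
    case (Suc i)
    then obtain D where D: "D \<ge> 0" "\<And>w. w \<noteq> z \<Longrightarrow> dist z w < min (min \<delta> 1) r \<Longrightarrow>
      norm (op_power ?V i o\<^sub>L resolvent T w) \<le> D / dist z w ^ (m - i)" by auto
    show ?case
    proof (intro exI[of _ "D + norm (op_power ?V i)"] conjI allI impI)
      show "0 \<le> D + norm (op_power ?V i)" using D(1) by simp
      fix w assume w: "w \<noteq> z" "dist z w < min (min \<delta> 1) r"
      let ?d = "dist z w"
      have d: "0 < ?d" "?d \<le> 1" using w by auto
      have ws: "w \<notin> spectrum T" using w by (intro punctured_not_spectrum) auto
      let ?R = "resolvent T w"
      have "(?V o\<^sub>L ?R) = (w - z) *\<^sub>C ?R - id_blinfun"
      proof -
        have "((w *\<^sub>C id_blinfun - T) o\<^sub>L ?R) = id_blinfun"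
          using is_inverse_resolvent[OF ws] by (simp add: is_inverse_op_def)
        then have "(T o\<^sub>L ?R) = w *\<^sub>C ?R - id_blinfun"
          by (simp add: compose_diff_left compose_scaleC_left algebra_simps)
        then show ?thesis
          by (simp add: compose_diff_left compose_scaleC_left complex_vector.scale_left_diff_distrib)
      qed
      then have "(op_power ?V i o\<^sub>L (?V o\<^sub>L ?R)) = (w - z) *\<^sub>C (op_power ?V i o\<^sub>L ?R) - op_power ?V i"
        using bounded_ops_power[OF V, of i] by (simp only: compose_diff_right compose_scaleC_right compose_id)
      then have "(op_power ?V (Suc i) o\<^sub>L ?R) = (w - z) *\<^sub>C (op_power ?V i o\<^sub>L ?R) - op_power ?V i"
        unfolding op_power_Suc2 compose_assoc .
      then have "norm (op_power ?V (Suc i) o\<^sub>L ?R) \<le> ?d * norm (op_power ?V i o\<^sub>L ?R) + norm (op_power ?V i)"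
        using norm_triangle_ineq4[of "(w - z) *\<^sub>C (op_power ?V i o\<^sub>L ?R)" "op_power ?V i"]
        by (simp add: norm_scaleC dist_norm norm_minus_commute)
      also have "\<dots> \<le> ?d * (D / ?d ^ (m - i)) + norm (op_power ?V i) / ?d ^ (m - Suc i)"
      proof (intro add_mono mult_left_mono D(2) w)
        have "?d ^ (m - Suc i) \<le> 1" "0 < ?d ^ (m - Suc i)" using d by (auto intro: power_le_one)
        then show "norm (op_power ?V i) \<le> norm (op_power ?V i) / ?d ^ (m - Suc i)"
          by (simp add: pos_le_divide_eq mult_right_le_one_le)
      qed simp
      also have "?d * (D / ?d ^ (m - i)) = D / ?d ^ (m - Suc i)"
      proof -
        have "m - i = Suc (m - Suc i)" using Suc.prems by simp
        then show ?thesis using d by simp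
      qed
      finally show "norm (op_power ?V (Suc i) o\<^sub>L ?R) \<le> (D + norm (op_power ?V i)) / ?d ^ (m - Suc i)"
        by (simp add: add_divide_distrib)
    qed
  qed
  obtain D where D: "D \<ge> 0" "\<And>w. w \<noteq> z \<Longrightarrow> dist z w < min (min \<delta> 1) r \<Longrightarrow> norm (g w) \<le> D"
    using bound[of m] by (auto simp: g_def)
  define k where "k w = (w - z) *\<^sub>C g w" for w
  have "integral {0..1} (\<lambda>t. k (z + circ r t)) = 0"
  proof (rule circle_mean_zero[OF r, of z k "\<lambda>w. 1 *\<^sub>C g w + (w - z) *\<^sub>C g' w"])
    show "has_op_derivative k (1 *\<^sub>C g w + (w - z) *\<^sub>C g' w) w" if "w \<noteq> z" "dist z w \<le> r" for w
      unfolding k_def using dg[OF punctured_not_spectrum[OF that]]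
      by (intro has_op_derivative_scale) (auto intro!: derivative_eq_intros)
    have cR: "continuous_on (cball z r - {z}) (resolvent T)"
    proof (intro continuous_at_imp_continuous_on ballI)
      fix w assume "w \<in> cball z r - {z}"
      then have "w \<notin> spectrum T" by (intro punctured_not_spectrum) auto
      then show "isCont (resolvent T) w"
        using resolvent_derivative(1)[OF T] has_op_derivative_continuous by blast
    qed
    show "continuous_on (cball z r - {z}) (\<lambda>w. 1 *\<^sub>C g w + (w - z) *\<^sub>C g' w)"
      unfolding g_def g'_def
      by (intro continuous_intros cR bounded_bilinear.continuous_on[OF bounded_bilinear_scaleC]
          bounded_bilinear.continuous_on[OF bounded_bilinear_blinfun_compose])
    show "(k \<longlongrightarrow> 0) (at z)"
    proof (rule Lim_null_comparison)
      show "\<forall>\<^sub>F w in at z. norm (k w) \<le> cmod (w - z) * D"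
        unfolding eventually_at using \<delta> r D
        by (intro exI[of _ "min (min \<delta> 1) r"]) (auto simp: k_def norm_scaleC dist_commute intro!: mult_left_mono)
      have "((\<lambda>w. w - z) \<longlongrightarrow> z - z) (at z)" by (intro tendsto_intros)
      then show "((\<lambda>w. cmod (w - z) * D) \<longlongrightarrow> 0) (at z)"
        by (intro tendsto_mult_left_zero tendsto_norm_zero) simp
    qed
  qed
  moreover have "((\<lambda>t. op_power ?V m o\<^sub>L (circ r t *\<^sub>C resolvent T (z + circ r t))) has_integral (op_power ?V m o\<^sub>L circle_proj)) {0..1}"
    by (rule circle_proj_linear) (rule bounded_bilinear.bounded_linear_right[OF bounded_bilinear_blinfun_compose])
  moreover have "(op_power ?V m o\<^sub>L (circ r t *\<^sub>C resolvent T (z + circ r t))) = k (z + circ r t)" for t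
    using V by (simp add: k_def g_def compose_scaleC_right)
  ultimately show ?thesis by (simp add: integral_unique)
qed

end

section \<open>Perturbation determinant\<close>

lemma resolvent_disc:
  assumes "0 \<le> b" shows "open {w. cmod w * b < 1}" "convex {w. cmod w * b < 1}" "0 \<in> {w. cmod w * b < 1}"
proof -
  have "{w. cmod w * b < 1} = (if b = 0 then UNIV else ball 0 (1 / b))"
    using assms by (auto simp: field_simps dist_norm)
  then show "open {w. cmod w * b < 1}" "convex {w. cmod w * b < 1}" by auto
  show "0 \<in> {w. cmod w * b < 1}" by simp
qed

text \<open>The ranges stay inside the range of \<open>Y\<close>.\<close>

lemma holomorphic_perturbation_determinant:
  fixes B Y :: "'a::complex_banach \<Rightarrow>\<^sub>L 'a"
  assumes B: "B \<in> bounded_ops" and Y: "Y \<in> finite_rank_ops"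
  shows "(\<lambda>w. det_id_minus (w *\<^sub>C (Y o\<^sub>L neumann B w))) holomorphic_on {w. cmod w * norm B < 1}"
    and "k > 0 \<Longrightarrow> (\<lambda>w. op_trace (op_power (w *\<^sub>C (Y o\<^sub>L neumann B w)) k)) holomorphic_on {w. cmod w * norm B < 1}"
proof -
  let ?S = "{w. cmod w * norm B < 1}"
  let ?bs = "range_basis Y"
  have Yb: "Y \<in> bounded_ops" using Y by (rule finite_rank_ops_bounded)
  have bs: "basis_list ?bs" and r: "range (blinfun_apply Y) \<subseteq> lspan ?bs" using range_basis_list[OF Y] by auto
  have S: "open ?S" by (rule resolvent_disc) simp
  have 1: "w *\<^sub>C (Y o\<^sub>L neumann B w) \<in> bounded_ops" if "w \<in> ?S" for w
    using that neumann_properties(3)[OF B] Yb by auto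
  have 2: "range (blinfun_apply (w *\<^sub>C (Y o\<^sub>L neumann B w))) \<subseteq> lspan ?bs" for w
    using r by (auto intro!: complex_vector.span_scale)
  have 3: "\<exists>D. has_op_derivative (\<lambda>w. w *\<^sub>C (Y o\<^sub>L neumann B w)) D w \<and> range (blinfun_apply D) \<subseteq> lspan ?bs"
    if "w \<in> ?S" for w
  proof -
    have "has_op_derivative (\<lambda>w. Y o\<^sub>L neumann B w) (Y o\<^sub>L (neumann B w o\<^sub>L B o\<^sub>L neumann B w)) w"
      using that Yb
      by (intro has_op_derivative_linear[OF bounded_bilinear.bounded_linear_right[OF bounded_bilinear_blinfun_compose]]
          neumann_properties(4) B) (auto simp: compose_scaleC_right)
    then have "has_op_derivative (\<lambda>w. w *\<^sub>C (Y o\<^sub>L neumann B w))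
        (1 *\<^sub>C (Y o\<^sub>L neumann B w) + w *\<^sub>C (Y o\<^sub>L (neumann B w o\<^sub>L B o\<^sub>L neumann B w))) w"
      by (rule has_op_derivative_scale[rotated]) (auto intro!: derivative_eq_intros)
    moreover have "range (blinfun_apply (1 *\<^sub>C (Y o\<^sub>L neumann B w) + w *\<^sub>C (Y o\<^sub>L (neumann B w o\<^sub>L B o\<^sub>L neumann B w)))) \<subseteq> lspan ?bs"
      using r by (auto simp: blinfun.add_left intro!: complex_vector.span_add complex_vector.span_scale)
    ultimately show ?thesis by blast
  qed
  show "(\<lambda>w. det_id_minus (w *\<^sub>C (Y o\<^sub>L neumann B w))) holomorphic_on ?S"
    by (rule holomorphic_det_trace_on(1)[OF bs S 1 2 3])
  show "(\<lambda>w. op_trace (op_power (w *\<^sub>C (Y o\<^sub>L neumann B w)) k)) holomorphic_on ?S" if "k > 0"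
    by (rule holomorphic_det_trace_on(2)[OF bs S 1 2 3 that])
qed

lemma det_id_minus_zero [simp]:
  fixes Z :: "'a::complex_normed_vector \<Rightarrow>\<^sub>L 'a"
  assumes "Z = 0" shows "det_id_minus Z = 1"
proof -
  have Z: "Z \<in> finite_rank_ops" using assms by simp
  have "det_id_minus Z = det_id_minus Z * det_id_minus Z"
    using det_id_minus_mult[OF Z Z] assms by simp
  moreover have "det_id_minus Z \<noteq> 0"
    using det_id_minus_zero_fixpoint[OF Z] assms by auto
  ultimately show ?thesis by simp
qed

text \<open>The factorization behind perturbation determinants: singularities of \<open>I - w (B + F)\<close> inside the disc
  come from the finite rank factor.\<close>

lemma id_minus_perturbation_factor:
  fixes B F :: "'a::complex_banach \<Rightarrow>\<^sub>L 'a"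
  assumes B: "B \<in> bounded_ops" and F: "F \<in> bounded_ops" and w: "cmod w * norm B < 1"
  shows "id_blinfun - w *\<^sub>C (B + F) = ((id_blinfun - w *\<^sub>C (F o\<^sub>L neumann B w)) o\<^sub>L (id_blinfun - w *\<^sub>C B))"
proof -
  have "(neumann B w o\<^sub>L (id_blinfun - w *\<^sub>C B)) = id_blinfun"
    using neumann_properties(1)[OF B w] by (simp add: is_inverse_op_def)
  then show ?thesis
    by (simp add: compose_diff_left compose_scaleC_left compose_assoc complex_vector.scale_right_distrib)
qed

lemma perturbation_determinant_zero_eigenvector:
  fixes B F :: "'a::complex_banach \<Rightarrow>\<^sub>L 'a"
  assumes B: "B \<in> bounded_ops" and F: "F \<in> finite_rank_ops" and w: "cmod w * norm B < 1"
    and d: "det_id_minus (w *\<^sub>C (F o\<^sub>L neumann B w)) = 0"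
  obtains x where "x \<noteq> 0" "x = w *\<^sub>C blinfun_apply (B + F) x"
proof -
  note g = neumann_properties[OF B w]
  have "w *\<^sub>C (F o\<^sub>L neumann B w) \<in> finite_rank_ops" using F g by auto
  then obtain v where v: "v \<noteq> 0" "blinfun_apply (w *\<^sub>C (F o\<^sub>L neumann B w)) v = v"
    using det_id_minus_zero_fixpoint d by blast
  define x where "x = blinfun_apply (neumann B w) v"
  have vx: "blinfun_apply (id_blinfun - w *\<^sub>C B) x = v"
    unfolding x_def by (rule inverse_op_apply(2)[OF g(1)])
  have "x \<noteq> 0" using v(1) vx by (auto simp: blinfun.zero_right)
  moreover have "blinfun_apply (id_blinfun - w *\<^sub>C (B + F)) x = 0"
    unfolding id_minus_perturbation_factor[OF B finite_rank_ops_bounded[OF F] w]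
      blinfun_apply_blinfun_compose vx using v(2) by (simp add: blinfun.diff_left)
  then have "x = w *\<^sub>C blinfun_apply (B + F) x" by (simp add: blinfun.diff_left)
  ultimately show ?thesis using that by blast
qed

text \<open>In the variable \<open>1 / w\<close> the resolvent of \<open>B + F\<close> is, up to bounded factors, the inverse of \<open>I - X\<close> with
  \<open>X\<close> of fixed finite dimensional range. By Cramer's rule its norm is bounded by the inverse of a determinant
  that is holomorphic and equals \<open>1\<close> at the origin. So its zeros are isolated and of finite order, and a zero
  provides an eigenvector.\<close>

lemma finite_rank_perturbation_spectrum:
  fixes B F :: "'a::complex_banach \<Rightarrow>\<^sub>L 'a"
  assumes B: "B \<in> bounded_ops" and F: "F \<in> finite_rank_ops"
    and z: "z \<in> spectrum (B + F)" and nz: "norm B < cmod z"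
  shows "\<exists>\<delta>>0. \<exists>C m. \<forall>w. w \<noteq> z \<longrightarrow> dist z w < \<delta> \<longrightarrow>
      w \<notin> spectrum (B + F) \<and> norm (resolvent (B + F) w) \<le> C / dist z w ^ m"
    and "\<exists>x. x \<noteq> 0 \<and> blinfun_apply (B + F) x = z *\<^sub>C x"
proof -
  let ?T = "B + F" and ?b = "norm B"
  have Fb: "F \<in> bounded_ops" using F by (rule finite_rank_ops_bounded)
  have z0: "z \<noteq> 0" using nz norm_ge_zero[of B] by auto
  define D where "D w = det_id_minus (w *\<^sub>C (F o\<^sub>L neumann B w))" for w
  define \<Omega> where "\<Omega> = {w. cmod w * ?b < 1}"
  have \<Omega>: "open \<Omega>" "connected \<Omega>" "0 \<in> \<Omega>"
    unfolding \<Omega>_def using resolvent_disc[of ?b] convex_connected by auto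
  have hol: "D holomorphic_on \<Omega>"
    unfolding D_def \<Omega>_def by (rule holomorphic_perturbation_determinant(1)[OF B F])
  \<comment> \<open>A level between \<open>cmod (1 / z) * norm B\<close> and \<open>1\<close>, below which the inverse of \<open>I - w B\<close> is uniformly bounded.\<close>
  define q where "q = (1 + cmod (1 / z) * ?b) / 2"
  have q0: "cmod (1 / z) * ?b < 1" using nz z0 by (simp add: norm_divide field_simps)
  have half: "t < (1 + t) / 2" "(1 + t) / 2 < 1" if "t < 1" for t :: real using that by auto
  have q: "cmod (1 / z) * ?b < q" "q < 1" unfolding q_def by (rule half[OF q0])+
  have z\<Omega>: "1 / z \<in> \<Omega>" using q0 by (simp add: \<Omega>_def)
  define b where "b = (cmod (1 / z) + 1) * norm F / (1 - q)"
  have b0: "0 \<le> b" using q by (simp add: b_def)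
  obtain K where K: "K \<ge> 0" "\<And>X. X \<in> bounded_ops \<Longrightarrow> range (blinfun_apply X) \<subseteq> lspan (range_basis F) \<Longrightarrow> norm X \<le> b \<Longrightarrow>
    det_id_minus X \<noteq> 0 \<Longrightarrow> \<exists>S. is_inverse_op (id_blinfun - X) S \<and> norm S \<le> 1 + K / cmod (det_id_minus X)"
    by (rule inverse_id_minus_finite_rank[OF range_basis_list(1)[OF F] b0]) (rule that, assumption, blast)
  have inv: "\<exists>S. is_inverse_op (id_blinfun - w *\<^sub>C ?T) S \<and> norm S \<le> 1 / (1 - q) * (1 + K / cmod (D w))"
    if w: "cmod w * ?b \<le> q" "cmod w \<le> cmod (1 / z) + 1" and Dw: "D w \<noteq> 0" for w
  proof -
    have w1: "cmod w * ?b < 1" using w q by simp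
    note g = neumann_properties[OF B w1]
    have "1 / (1 - cmod w * ?b) \<le> 1 / (1 - q)"
      using w(1) w1 q(2) by (intro divide_left_mono mult_pos_pos) linarith+
    then have gn: "norm (neumann B w) \<le> 1 / (1 - q)" using g(2) by linarith
    let ?X = "w *\<^sub>C (F o\<^sub>L neumann B w)"
    have "norm ?X \<le> cmod w * (norm F * norm (neumann B w))"
      unfolding norm_scaleC by (intro mult_left_mono norm_blinfun_compose) simp
    also have "\<dots> \<le> (cmod (1 / z) + 1) * (norm F * (1 / (1 - q)))"
      using w gn by (intro mult_mono) auto
    also have "\<dots> = b" by (simp add: b_def)
    finally have Xb: "norm ?X \<le> b" .
    have "range (blinfun_apply ?X) \<subseteq> lspan (range_basis F)"
      using range_basis_list(2)[OF F] by (auto intro!: complex_vector.span_scale)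
    then obtain S where S: "is_inverse_op (id_blinfun - ?X) S" "norm S \<le> 1 + K / cmod (D w)"
      using K(2)[of ?X] Xb Dw Fb g(3) by (auto simp: D_def)
    have "is_inverse_op (id_blinfun - w *\<^sub>C ?T) (neumann B w o\<^sub>L S)"
      unfolding id_minus_perturbation_factor[OF B Fb w1] by (rule inverse_op_compose[OF S(1) g(1)])
    moreover have "norm (neumann B w o\<^sub>L S) \<le> 1 / (1 - q) * (1 + K / cmod (D w))"
      using gn S(2) q K(1)
      by (intro order_trans[OF norm_blinfun_compose] mult_mono) auto
    ultimately show ?thesis by blast
  qed
  have res: "v \<notin> spectrum ?T \<and> norm (resolvent ?T v) \<le> cmod (1 / v) * (1 / (1 - q) * (1 + K / cmod (D (1 / v))))"
    if v: "v \<noteq> 0" "cmod (1 / v) * ?b \<le> q" "cmod (1 / v) \<le> cmod (1 / z) + 1" and Dw: "D (1 / v) \<noteq> 0" for v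
  proof -
    obtain S where S: "is_inverse_op (id_blinfun - (1 / v) *\<^sub>C ?T) S" "norm S \<le> 1 / (1 - q) * (1 + K / cmod (D (1 / v)))"
      using inv[OF v(2,3) Dw] by blast
    have "is_inverse_op (v *\<^sub>C (id_blinfun - (1 / v) *\<^sub>C ?T)) ((1 / v) *\<^sub>C S)"
      using v(1) B Fb by (intro inverse_op_scale[OF S(1)]) auto
    then have i: "is_inverse_op (v *\<^sub>C id_blinfun - ?T) ((1 / v) *\<^sub>C S)"
      using v(1) by (simp add: complex_vector.scale_right_diff_distrib complex_vector.scale_right_distrib)
    then have "v \<notin> spectrum ?T" by (auto simp: spectrum_def)
    moreover have "resolvent ?T v = (1 / v) *\<^sub>C S" unfolding resolvent_inv_op using i by (rule inv_op_eq)
    moreover have "norm ((1 / v) *\<^sub>C S) \<le> cmod (1 / v) * (1 / (1 - q) * (1 + K / cmod (D (1 / v))))"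
      unfolding norm_scaleC by (rule mult_left_mono[OF S(2)]) simp
    ultimately show ?thesis by simp
  qed
  have Dz: "D (1 / z) = 0"
  proof (rule ccontr)
    assume "D (1 / z) \<noteq> 0"
    then have "z \<notin> spectrum ?T" using res[of z] z0 q by auto
    then show False using z by simp
  qed
  obtain x where x: "x \<noteq> 0" "x = (1 / z) *\<^sub>C blinfun_apply ?T x"
    using perturbation_determinant_zero_eigenvector[OF B F q0] Dz unfolding D_def by blast
  have "z *\<^sub>C x = z *\<^sub>C ((1 / z) *\<^sub>C blinfun_apply ?T x)" using x(2) by (rule arg_cong)
  then have Tx: "blinfun_apply ?T x = z *\<^sub>C x" using z0 by simp
  have "D 0 = 1" by (simp add: D_def)
  then have nc: "\<not> D constant_on \<Omega>" using \<Omega>(3) z\<Omega> Dz unfolding constant_on_def by (metis zero_neq_one)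
  obtain g \<rho> n where f: "0 < \<rho>" "ball (1 / z) \<rho> \<subseteq> \<Omega>" "g holomorphic_on ball (1 / z) \<rho>"
    "\<And>w. w \<in> ball (1 / z) \<rho> \<Longrightarrow> D w = (w - 1 / z) ^ n * g w"
    "\<And>w. w \<in> ball (1 / z) \<rho> \<Longrightarrow> g w \<noteq> 0"
    using holomorphic_factor_zero_nonconstant[OF hol \<Omega>(1,2) z\<Omega> Dz nc] by metis
  have "continuous_on (cball (1 / z) (\<rho> / 2)) g"
    using f(1) by (intro continuous_on_subset[OF holomorphic_on_imp_continuous_on[OF f(3)]]) auto
  then have cn: "continuous_on (cball (1 / z) (\<rho> / 2)) (\<lambda>w. cmod (g w))" by (rule continuous_on_norm)
  have "compact (cball (1 / z) (\<rho> / 2))" "cball (1 / z) (\<rho> / 2) \<noteq> {}" using f(1) by auto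
  then obtain w0 where w0: "w0 \<in> cball (1 / z) (\<rho> / 2)" "\<And>w. w \<in> cball (1 / z) (\<rho> / 2) \<Longrightarrow> cmod (g w0) \<le> cmod (g w)"
    using continuous_attains_inf[OF _ _ cn] by metis
  define c where "c = cmod (g w0)"
  have c: "c > 0" using f(5)[of w0] w0(1) f(1) by (auto simp: c_def)
  have t0: "((\<lambda>v. 1 / v) \<longlongrightarrow> 1 / z) (at z)"
    by (rule tendsto_divide[OF tendsto_const tendsto_ident_at z0])
  have t1: "((\<lambda>v. cmod (1 / v)) \<longlongrightarrow> cmod (1 / z)) (at z)" "((\<lambda>v. cmod (1 / v) * ?b) \<longlongrightarrow> cmod (1 / z) * ?b) (at z)"
    "((\<lambda>v. dist (1 / v) (1 / z)) \<longlongrightarrow> dist (1 / z) (1 / z)) (at z)" "((\<lambda>v. cmod v) \<longlongrightarrow> cmod z) (at z)"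
    "((\<lambda>v. dist v z) \<longlongrightarrow> dist z z) (at z)"
    by (intro tendsto_norm tendsto_mult tendsto_dist t0 tendsto_const tendsto_ident_at)+
  have "\<forall>\<^sub>F v in at z. cmod (1 / v) < cmod (1 / z) + 1 \<and> cmod (1 / v) * ?b < q \<and> dist (1 / v) (1 / z) < \<rho> / 2 \<and>
      cmod v > cmod z / 2 \<and> cmod v < cmod z + 1 \<and> dist v z < 1"
    using z0 q f(1)
    by (intro eventually_conj order_tendstoD[OF t1(1)] order_tendstoD[OF t1(2)] order_tendstoD[OF t1(3)]
        order_tendstoD[OF t1(4)] order_tendstoD[OF t1(5)]) auto
  then obtain \<delta> where \<delta>: "\<delta> > 0" "\<And>v. v \<noteq> z \<Longrightarrow> dist v z < \<delta> \<Longrightarrow> cmod (1 / v) < cmod (1 / z) + 1 \<and>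
      cmod (1 / v) * ?b < q \<and> dist (1 / v) (1 / z) < \<rho> / 2 \<and> cmod v > cmod z / 2 \<and> cmod v < cmod z + 1 \<and> dist v z < 1"
    unfolding eventually_at by auto
  define M where "M = (cmod z + 1) * cmod z"
  have M: "M > 0" using z0 by (simp add: M_def add_nonneg_pos)
  define C where "C = (2 / cmod z) * (1 / (1 - q) * (1 + K * M ^ n / c))"
  have main: "v \<notin> spectrum ?T \<and> norm (resolvent ?T v) \<le> C / dist z v ^ n" if v: "v \<noteq> z" "dist z v < \<delta>" for v
  proof -
    have p: "cmod (1 / v) < cmod (1 / z) + 1" "cmod (1 / v) * ?b < q" "dist (1 / v) (1 / z) < \<rho> / 2"
      "cmod v > cmod z / 2" "cmod v < cmod z + 1" "dist v z < 1"
      using \<delta>(2)[of v] v by (auto simp: dist_commute)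
    have v0: "v \<noteq> 0" using p(4) z0 by auto
    have iv: "1 / v \<in> cball (1 / z) (\<rho> / 2)" "1 / v \<in> ball (1 / z) \<rho>" using p(3) f(1) by (auto simp: dist_commute)
    let ?d = "dist z v"
    have d: "0 < ?d" "?d \<le> 1" using v p(6) by (auto simp: dist_commute)
    have dd: "?d / M \<le> cmod (1 / v - 1 / z)"
    proof -
      have "1 / v - 1 / z = (z - v) / (v * z)" using v0 z0 by (simp add: field_simps)
      then have "cmod (1 / v - 1 / z) = ?d / (cmod v * cmod z)" by (simp add: norm_divide norm_mult dist_norm)
      moreover have "?d / M \<le> ?d / (cmod v * cmod z)"
        unfolding M_def using p(5) v0 z0 add_nonneg_pos[of "cmod z" 1]
        by (intro divide_left_mono mult_right_mono mult_pos_pos) auto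
      ultimately show ?thesis by simp
    qed
    have "c * (?d / M) ^ n \<le> cmod (g (1 / v)) * cmod (1 / v - 1 / z) ^ n"
      using w0(2)[OF iv(1)] dd M d by (intro mult_mono power_mono) (auto simp: c_def)
    also have "\<dots> = cmod (D (1 / v))" using f(4)[OF iv(2)] by (simp add: norm_mult norm_power)
    finally have Dl: "c * (?d / M) ^ n \<le> cmod (D (1 / v))" .
    have cd: "0 < c * (?d / M) ^ n" using c d M by simp
    then have "D (1 / v) \<noteq> 0" using Dl by auto
    then have r: "v \<notin> spectrum ?T" "norm (resolvent ?T v) \<le> cmod (1 / v) * (1 / (1 - q) * (1 + K / cmod (D (1 / v))))"
      using res[of v] v0 p by auto
    have "K / cmod (D (1 / v)) \<le> K / (c * (?d / M) ^ n)"
      by (rule divide_left_mono[OF Dl K(1) mult_pos_pos[OF less_le_trans[OF cd Dl] cd]])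
    also have "\<dots> = K * M ^ n / c / ?d ^ n" by (simp add: power_divide)
    finally have "1 + K / cmod (D (1 / v)) \<le> 1 / ?d ^ n + K * M ^ n / c / ?d ^ n"
      using d by (intro add_mono) (auto simp: power_le_one)
    also have "\<dots> = (1 + K * M ^ n / c) / ?d ^ n" by (simp add: add_divide_distrib)
    finally have k: "1 + K / cmod (D (1 / v)) \<le> (1 + K * M ^ n / c) / ?d ^ n" .
    have iv2: "cmod (1 / v) \<le> 2 / cmod z"
      using p(4) v0 z0 by (simp add: norm_divide field_simps)
    have "cmod (1 / v) * (1 / (1 - q) * (1 + K / cmod (D (1 / v)))) \<le>
        (2 / cmod z) * (1 / (1 - q) * ((1 + K * M ^ n / c) / ?d ^ n))"
      using iv2 k q K(1) by (intro mult_mono mult_left_mono) (auto intro!: mult_nonneg_nonneg add_nonneg_nonneg divide_nonneg_nonneg)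
    also have "\<dots> = C / ?d ^ n" by (simp add: C_def)
    finally show ?thesis using r by auto
  qed
  show "\<exists>\<delta>>0. \<exists>C m. \<forall>w. w \<noteq> z \<longrightarrow> dist z w < \<delta> \<longrightarrow>
      w \<notin> spectrum (B + F) \<and> norm (resolvent (B + F) w) \<le> C / dist z w ^ m"
    using \<delta>(1) main by blast
  show "\<exists>x. x \<noteq> 0 \<and> blinfun_apply (B + F) x = z *\<^sub>C x" using x(1) Tx by blast
qed

section \<open>Structure of the discrete spectrum\<close>

text \<open>The algebraic properties of the Riesz projection at an isolated eigenvalue of finite
  multiplicity. Its range is the generalized eigenspace.\<close>

definition spectral_projection ::
    "('a::complex_normed_vector \<Rightarrow>\<^sub>L 'a) \<Rightarrow> complex \<Rightarrow> ('a \<Rightarrow>\<^sub>L 'a) \<Rightarrow> bool" where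
  "spectral_projection T z P \<longleftrightarrow> P \<in> bounded_ops \<and> (P o\<^sub>L P) = P \<and> (P o\<^sub>L T) = (T o\<^sub>L P) \<and>
     (\<exists>m. (op_power (shift T z) m o\<^sub>L P) = 0) \<and>
     (\<forall>k x. blinfun_apply (op_power (shift T z) k) x = 0 \<longrightarrow> blinfun_apply P x = x)"

lemma compose_eq_apply: "(A o\<^sub>L B) = C \<Longrightarrow> blinfun_apply A (blinfun_apply B x) = blinfun_apply C x"
  by auto

lemma op_power_inverse: "is_inverse_op T S \<Longrightarrow> is_inverse_op (op_power T m) (op_power S m)"
proof (induction m)
  case 0
  then show ?case by (simp add: is_inverse_op_def)
next
  case (Suc m)
  have "is_inverse_op (T o\<^sub>L op_power T m) (op_power S m o\<^sub>L S)"
    using Suc by (intro inverse_op_compose) auto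
  moreover have "op_power S (Suc m) = (op_power S m o\<^sub>L S)" by (rule op_power_Suc2)
  ultimately show ?case by (simp only: op_power_simps(2)[of T])
qed

lemma op_power_finite_rank_difference:
  assumes B: "B \<in> bounded_ops" and F: "F \<in> finite_rank_ops"
  shows "op_power (B + F) m - op_power B m \<in> finite_rank_ops"
proof (induction m)
  case (Suc m)
  have "op_power (B + F) (Suc m) - op_power B (Suc m) =
      ((B + F) o\<^sub>L (op_power (B + F) m - op_power B m)) + (F o\<^sub>L op_power B m)"
    by (simp add: compose_add_left compose_diff_right)
  then show ?case using Suc B F finite_rank_ops_bounded[OF F] by simp
qed simp

text \<open>The Riesz projection \<open>P\<close> maps into the kernel of \<open>(T - z)^m\<close>. It has finite rank because
  \<open>(T - z)^m\<close> differs by a finite rank operator \<open>G\<close> from the invertible operator \<open>(B - z)^m\<close>, so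
  that \<open>P = - (B - z)^{-m} G P\<close>.\<close>

lemma riesz_projection_spectral:
  fixes B F :: "'a::complex_banach \<Rightarrow>\<^sub>L 'a"
  assumes B: "B \<in> bounded_ops" and F: "F \<in> finite_rank_ops"
    and z: "z \<in> spectrum (B + F)" and nz: "norm B < cmod z"
  shows "spectral_projection (B + F) z (riesz_projection (B + F) z)"
    and "riesz_projection (B + F) z \<in> finite_rank_ops"
    and "z \<in> discrete_eigenvalues (B + F)"
proof -
  let ?T = "B + F"
  have T: "?T \<in> bounded_ops" using B F finite_rank_ops_bounded by auto
  obtain m C \<delta> where *: "0 < \<delta>"
    "\<And>w. w \<noteq> z \<Longrightarrow> dist z w < \<delta> \<Longrightarrow> w \<notin> spectrum ?T"
    "\<And>w. w \<noteq> z \<Longrightarrow> dist z w < \<delta> \<Longrightarrow> norm (resolvent ?T w) \<le> C / dist z w ^ m"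
    using finite_rank_perturbation_spectrum(1)[OF B F z nz] by blast
  define r where "r = (SOME r. 0 < r \<and> cball z r \<inter> spectrum ?T \<subseteq> {z})"
  have "0 < \<delta> / 2 \<and> cball z (\<delta> / 2) \<inter> spectrum ?T \<subseteq> {z}"
  proof (intro conjI subsetI)
    fix w assume w: "w \<in> cball z (\<delta> / 2) \<inter> spectrum ?T"
    have "dist z w < \<delta>" using w *(1) by auto
    then show "w \<in> {z}" using *(2)[of w] w by auto
  qed (use *(1) in simp)
  then have "0 < r \<and> cball z r \<inter> spectrum ?T \<subseteq> {z}" unfolding r_def by (rule someI)
  then have r: "0 < r" "cball z r \<inter> spectrum ?T \<subseteq> {z}" by auto
  note c = circle_proj_contour[OF T r] circle_proj_bounded_ops[OF T r] circle_proj_commute[OF T r]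
    circle_proj_fixes[OF T r] circle_proj_annihilated[OF T r *(1,3)]
  let ?P = "circle_proj ?T z r"
  have P: "riesz_projection ?T z = ?P"
    unfolding riesz_projection_def r_def[symmetric] Let_def by (rule c(1))
  have PP: "(?P o\<^sub>L ?P) = ?P"
  proof (rule blinfun_eqI)
    fix y
    have "blinfun_apply (op_power (shift ?T z) m) (blinfun_apply ?P y) = 0"
      using compose_eq_apply[OF c(5)] by simp
    then show "blinfun_apply (?P o\<^sub>L ?P) y = blinfun_apply ?P y" using c(4) by simp
  qed
  show "spectral_projection ?T z (riesz_projection ?T z)"
    unfolding P spectral_projection_def using c PP by blast
  show fr: "riesz_projection ?T z \<in> finite_rank_ops"
  proof -
    let ?V = "shift B z" and ?W = "shift ?T z"
    have z0: "z \<noteq> 0" using nz norm_ge_zero[of B] by auto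
    have "cmod (1 / z) * norm B < 1" using nz z0 by (simp add: norm_divide)
    from inverse_op_scale[OF neumann_properties(1)[OF B this], of "- z"]
    have "is_inverse_op ((- z) *\<^sub>C (id_blinfun - (1 / z) *\<^sub>C B)) ((1 / - z) *\<^sub>C neumann B (1 / z))"
      using z0 B by auto
    moreover have "(- z) *\<^sub>C (id_blinfun - (1 / z) *\<^sub>C B) = ?V"
      using z0 by (simp add: complex_vector.scale_right_diff_distrib)
    ultimately obtain S where S: "is_inverse_op ?V S" by auto
    define Q where "Q = op_power S m"
    have Q: "Q \<in> bounded_ops" "(Q o\<^sub>L op_power ?V m) = id_blinfun"
      using op_power_inverse[OF S, of m] by (auto simp: Q_def is_inverse_op_def)
    define G where "G = op_power ?W m - op_power ?V m"
    have W: "?W = ?V + F" by simp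
    have G: "G \<in> finite_rank_ops"
      unfolding G_def W using B F by (intro op_power_finite_rank_difference) auto
    have "?P = (Q o\<^sub>L op_power ?V m) o\<^sub>L ?P" using Q(2) by simp
    also have "\<dots> = (Q o\<^sub>L (op_power ?W m o\<^sub>L ?P)) - (Q o\<^sub>L (G o\<^sub>L ?P))"
      by (simp add: G_def compose_assoc compose_diff_left compose_diff_right)
    also have "(op_power ?W m o\<^sub>L ?P) = 0" by (rule c(5))
    finally have e: "?P = 0 - (Q o\<^sub>L (G o\<^sub>L ?P))" by (simp only: compose_zero)
    have "0 - (Q o\<^sub>L (G o\<^sub>L ?P)) \<in> finite_rank_ops"
      by (intro finite_rank_ops_diff finite_rank_ops_intros(1,4,5) G Q(1) c(2))
    then show ?thesis unfolding P using e by simp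
  qed
  have "z isolated_in spectrum ?T"
    unfolding isolated_in_dist_Ex_iff using z *(1,2) by blast
  then show "z \<in> discrete_eigenvalues ?T"
    using fr finite_rank_perturbation_spectrum(2)[OF B F z nz]
    by (simp add: discrete_eigenvalues_def finite_rank_ops_def)
qed

text \<open>The coordinate matrix in a basis of the range is the identity. As traces are additive, so are
  the multiplicities of different eigenvalues.\<close>

lemma op_rank_projection:
  assumes P: "P \<in> finite_rank_ops" "(P o\<^sub>L P) = P"
  shows "op_trace P = of_nat (op_rank P)" "op_rank P = length (range_basis P)"
proof -
  let ?bs = "range_basis P"
  note bs = range_basis_list[OF P(1)]
  have "blinfun_apply P b = b" if "b \<in> set ?bs" for b
  proof -
    have "b \<in> range (blinfun_apply P)" using that bs(2) complex_vector.span_base by blast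
    then show ?thesis using P(2) by (metis blinfun_apply_blinfun_compose rangeE)
  qed
  then have "coord_matrix ?bs ?bs (blinfun_apply P) = coord_matrix ?bs ?bs (\<lambda>x. x)"
    by (intro eq_matI) auto
  then have "coord_matrix ?bs ?bs (blinfun_apply P) = 1\<^sub>m (length ?bs)" using coord_matrix_id[OF bs(1)] by simp
  then have tr: "op_trace P = of_nat (length ?bs)"
    using det_id_minus_wrt(2)[OF finite_rank_ops_bounded[OF P(1)] bs(1)] bs(2)
    by (simp add: trace_wrt_def mat_trace_def)
  show l: "op_rank P = length ?bs"
    unfolding op_rank_def bs(2)[symmetric] complex_vector.dim_span
    using bs(1) by (simp add: basis_list_def complex_vector.dim_eq_card_independent distinct_card)
  show "op_trace P = of_nat (op_rank P)" using tr l by simp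
qed

lemma compose_power_commute:
  assumes "(A o\<^sub>L B) = (B o\<^sub>L A)" shows "(A o\<^sub>L op_power B k) = (op_power B k o\<^sub>L A)"
proof (induction k)
  case (Suc k)
  have "(A o\<^sub>L op_power B (Suc k)) = ((A o\<^sub>L B) o\<^sub>L op_power B k)" by (simp add: compose_assoc)
  also have "\<dots> = (B o\<^sub>L (A o\<^sub>L op_power B k))" by (simp only: assms compose_assoc)
  also have "\<dots> = (op_power B (Suc k) o\<^sub>L A)" by (simp only: Suc op_power_simps compose_assoc)
  finally show ?case .
qed simp

lemma generalized_eigenspaces_disjoint:
  fixes T :: "'a::complex_normed_vector \<Rightarrow>\<^sub>L 'a"
  assumes T: "T \<in> bounded_ops" and zw: "z \<noteq> w"
  shows "blinfun_apply (op_power (shift T z) k) u = 0 \<Longrightarrow> blinfun_apply (op_power (shift T w) l) u = 0 \<Longrightarrow> u = 0"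
proof (induction l arbitrary: u)
  case (Suc l)
  let ?u = "blinfun_apply (shift T w) u"
  have "(shift T w o\<^sub>L shift T z) = (shift T z o\<^sub>L shift T w)"
    using T by (simp add: compose_diff_left compose_diff_right compose_scaleC_left compose_scaleC_right
        complex_vector.scale_right_diff_distrib mult.commute)
  from compose_eq_apply[OF compose_power_commute[OF this, of k], of u]
  have "blinfun_apply (op_power (shift T z) k) ?u = blinfun_apply (shift T w) (blinfun_apply (op_power (shift T z) k) u)"
    by simp
  then have "blinfun_apply (op_power (shift T z) k) ?u = 0" using Suc.prems(1) by (simp add: blinfun.zero_right)
  moreover have "blinfun_apply (op_power (shift T w) l) ?u = 0"
    using Suc.prems(2) unfolding op_power_Suc2 by simp
  ultimately have "?u = 0" by (rule Suc.IH)
  then have Tu: "blinfun_apply T u = w *\<^sub>C u" by (simp add: blinfun.diff_left)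
  have "blinfun_apply (op_power (shift T z) k) u = ((w - z) ^ k) *\<^sub>C u" for k
  proof (induction k)
    case (Suc k)
    have "shift T z \<in> bounded_ops" using T by auto
    then show ?case
      using Suc T by (simp add: bounded_ops_apply blinfun.diff_left Tu
          complex_vector.scale_left_diff_distrib[symmetric] left_diff_distrib)
  qed simp
  then show ?case using Suc.prems(1) zw by simp
qed simp

lemma spectral_projection_eigenvector:
  fixes T :: "'a::complex_normed_vector \<Rightarrow>\<^sub>L 'a"
  assumes T: "T \<in> bounded_ops" and P: "spectral_projection T z P"
    and v: "blinfun_apply T v = l *\<^sub>C v" "blinfun_apply P v \<noteq> 0"
  shows "l = z"
proof (rule ccontr)
  assume "l \<noteq> z"
  obtain m where m: "(op_power (shift T z) m o\<^sub>L P) = 0" using P by (auto simp: spectral_projection_def)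
  let ?u = "blinfun_apply P v"
  have Pb: "P \<in> bounded_ops" and comm: "(P o\<^sub>L T) = (T o\<^sub>L P)" using P by (auto simp: spectral_projection_def)
  have "blinfun_apply T ?u = l *\<^sub>C ?u"
    using compose_eq_apply[OF comm, of v] v(1) Pb by (simp add: bounded_ops_apply)
  then have "blinfun_apply (op_power (shift T l) 1) ?u = 0" by (simp add: blinfun.diff_left)
  moreover have "blinfun_apply (op_power (shift T z) m) ?u = 0"
    using compose_eq_apply[OF m] by simp
  ultimately show False using generalized_eigenspaces_disjoint[OF T, of z l] \<open>l \<noteq> z\<close> v(2) by metis
qed

text \<open>Projections to different points annihilate each other, since generalized eigenspaces intersect
  trivially.\<close>

lemma spectral_projection_sum:
  fixes T :: "'a::complex_normed_vector \<Rightarrow>\<^sub>L 'a"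
  assumes T: "T \<in> bounded_ops" and S: "finite S"
    and Q: "\<And>z. z \<in> S \<Longrightarrow> spectral_projection T z (Q z)" "\<And>z. z \<in> S \<Longrightarrow> Q z \<in> finite_rank_ops"
  defines "P \<equiv> \<Sum>z\<in>S. Q z"
  shows "P \<in> finite_rank_ops" "(P o\<^sub>L P) = P" "(P o\<^sub>L T) = (T o\<^sub>L P)"
    "op_rank P = (\<Sum>z\<in>S. op_rank (Q z))"
    "\<And>v l. v \<noteq> 0 \<Longrightarrow> blinfun_apply P v = v \<Longrightarrow> blinfun_apply T v = l *\<^sub>C v \<Longrightarrow> l \<in> S"
    "\<And>z k x. z \<in> S \<Longrightarrow> blinfun_apply (op_power (shift T z) k) x = 0 \<Longrightarrow> blinfun_apply P x = x"
proof -
  show Pf: "P \<in> finite_rank_ops" unfolding P_def using Q(2) by (rule finite_rank_ops_sum)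
  have P_apply: "blinfun_apply P x = (\<Sum>z\<in>S. blinfun_apply (Q z) x)" for x
    unfolding P_def by (simp add: blinfun.sum_left)
  have orth: "blinfun_apply (Q z) (blinfun_apply (Q w) x) = (if z = w then blinfun_apply (Q w) x else 0)"
    if zw: "z \<in> S" "w \<in> S" for z w x
  proof (cases "z = w")
    case True
    then show ?thesis
      using Q(1)[OF zw(2)] compose_eq_apply[of "Q w" "Q w" "Q w" x] by (simp add: spectral_projection_def)
  next
    case False
    let ?y = "blinfun_apply (Q w) x"
    obtain m m' where m: "(op_power (shift T z) m o\<^sub>L Q z) = 0" "(op_power (shift T w) m' o\<^sub>L Q w) = 0"
      using Q(1)[OF zw(1)] Q(1)[OF zw(2)] by (auto simp: spectral_projection_def)
    have "(Q z o\<^sub>L shift T w) = (shift T w o\<^sub>L Q z)"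
      using Q(1)[OF zw(1)]
      by (simp add: spectral_projection_def compose_diff_left compose_diff_right compose_scaleC_left compose_scaleC_right)
    note comm = compose_eq_apply[OF compose_power_commute[OF this, of m'], of ?y]
    have "blinfun_apply (op_power (shift T z) m) (blinfun_apply (Q z) ?y) = 0"
      using compose_eq_apply[OF m(1)] by simp
    moreover have "blinfun_apply (op_power (shift T w) m') (blinfun_apply (Q z) ?y) = 0"
    proof -
      have "blinfun_apply (op_power (shift T w) m') ?y = 0"
        using compose_eq_apply[OF m(2)] by simp
      then show ?thesis using comm by (simp add: blinfun.zero_right)
    qed
    ultimately show ?thesis using generalized_eigenspaces_disjoint[OF T False] False by auto
  qed
  have QP: "blinfun_apply P (blinfun_apply (Q w) x) = blinfun_apply (Q w) x" if "w \<in> S" for w x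
  proof -
    have "blinfun_apply P (blinfun_apply (Q w) x) = (\<Sum>z\<in>S. if z = w then blinfun_apply (Q w) x else 0)"
      unfolding P_apply using orth that by (intro sum.cong) auto
    then show ?thesis using S that by simp
  qed
  show PP: "(P o\<^sub>L P) = P"
  proof (rule blinfun_eqI)
    fix x
    have "blinfun_apply P (blinfun_apply P x) = (\<Sum>w\<in>S. blinfun_apply P (blinfun_apply (Q w) x))"
      unfolding P_apply[of x] by (simp add: blinfun.sum_right)
    then show "blinfun_apply (P o\<^sub>L P) x = blinfun_apply P x" using QP P_apply by simp
  qed
  show "(P o\<^sub>L T) = (T o\<^sub>L P)"
  proof (rule blinfun_eqI)
    fix x
    have "blinfun_apply (Q z) (blinfun_apply T x) = blinfun_apply T (blinfun_apply (Q z) x)" if "z \<in> S" for z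
      using Q(1)[OF that] compose_eq_apply[of "Q z" T "T o\<^sub>L Q z" x] by (simp add: spectral_projection_def)
    then show "blinfun_apply (P o\<^sub>L T) x = blinfun_apply (T o\<^sub>L P) x"
      by (simp add: P_apply blinfun.sum_right)
  qed
  have "(of_nat (op_rank P) :: complex) = of_nat (\<Sum>z\<in>S. op_rank (Q z))"
  proof -
    have "of_nat (op_rank P) = op_trace P" using op_rank_projection(1)[OF Pf PP] by simp
    also have "\<dots> = (\<Sum>z\<in>S. op_trace (Q z))" unfolding P_def using Q(2) by (rule op_trace_sum)
    also have "\<dots> = (\<Sum>z\<in>S. of_nat (op_rank (Q z)))"
    proof (intro sum.cong refl)
      fix z assume z: "z \<in> S"
      then have "(Q z o\<^sub>L Q z) = Q z" using Q(1) by (simp add: spectral_projection_def)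
      then show "op_trace (Q z) = of_nat (op_rank (Q z))" by (rule op_rank_projection(1)[OF Q(2)[OF z]])
    qed
    finally show ?thesis by simp
  qed
  then show "op_rank P = (\<Sum>z\<in>S. op_rank (Q z))" by (simp only: of_nat_eq_iff)
  show "l \<in> S" if v: "v \<noteq> 0" "blinfun_apply P v = v" "blinfun_apply T v = l *\<^sub>C v" for v l
  proof -
    have "\<exists>z\<in>S. blinfun_apply (Q z) v \<noteq> 0"
    proof (rule ccontr)
      assume "\<not> ?thesis"
      then have "blinfun_apply P v = 0" unfolding P_apply by (intro sum.neutral) auto
      then show False using v(1,2) by simp
    qed
    then obtain z where z: "z \<in> S" "blinfun_apply (Q z) v \<noteq> 0" by blast
    then show ?thesis using spectral_projection_eigenvector[OF T Q(1)[OF z(1)] v(3) z(2)] by simp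
  qed
  show "blinfun_apply P x = x" if "z \<in> S" "blinfun_apply (op_power (shift T z) k) x = 0" for z k x
  proof -
    have "blinfun_apply (Q z) x = x" using Q(1)[OF that(1)] that(2) by (auto simp: spectral_projection_def)
    then show ?thesis using QP[OF that(1), of x] by simp
  qed
qed

section \<open>Finite products of primary factors\<close>

lemma holomorphic_on_prod_list [holomorphic_intros]:
  "(\<And>l. l \<in> set ls \<Longrightarrow> (\<lambda>z. f l z) holomorphic_on S) \<Longrightarrow> (\<lambda>z. \<Prod>l\<leftarrow>ls. f l z) holomorphic_on S"
  by (induction ls) (auto intro!: holomorphic_intros)

lemma holomorphic_on_sum_list [holomorphic_intros]:
  "(\<And>l. l \<in> set ls \<Longrightarrow> (\<lambda>z. f l z) holomorphic_on S) \<Longrightarrow> (\<lambda>z. \<Sum>l\<leftarrow>ls. f l z) holomorphic_on S"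
  by (induction ls) (auto intro!: holomorphic_intros)

lemma sum_list_has_field_derivative:
  "(\<And>l. l \<in> set ls \<Longrightarrow> (f l has_field_derivative f' l) F) \<Longrightarrow>
    ((\<lambda>z. \<Sum>l\<leftarrow>ls. f l z) has_field_derivative (\<Sum>l\<leftarrow>ls. f' l)) F"
  by (induction ls) (auto intro!: derivative_eq_intros)

lemma norm_prod_list: "norm (\<Prod>l\<leftarrow>ls. f l :: complex) = (\<Prod>l\<leftarrow>ls. norm (f l))"
  by (induction ls) (auto simp: norm_mult)

lemma prod_list_mono_real:
  "(\<And>l. l \<in> set ls \<Longrightarrow> 0 \<le> f l \<and> f l \<le> (g l :: real)) \<Longrightarrow> (\<Prod>l\<leftarrow>ls. f l) \<le> (\<Prod>l\<leftarrow>ls. g l) \<and> 0 \<le> (\<Prod>l\<leftarrow>ls. f l)"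
proof (induction ls)
  case (Cons a ls)
  have "0 \<le> f a" "f a \<le> g a" using Cons.prems[of a] by auto
  moreover from this have "0 \<le> g a" by linarith
  ultimately show ?case using Cons by (auto intro!: mult_mono)
qed simp

lemma prod_list_const: "(\<Prod>l\<leftarrow>ls. c) = (c :: 'b::comm_monoid_mult) ^ length ls"
  by (induction ls) auto

lemma exp_sum_list: "exp (\<Sum>l\<leftarrow>ls. f l :: complex) = (\<Prod>l\<leftarrow>ls. exp (f l))"
  by (induction ls) (auto simp: exp_add)

lemma prod_list_mult: "(\<Prod>l\<leftarrow>ls. f l * g l :: 'b::comm_monoid_mult) = (\<Prod>l\<leftarrow>ls. f l) * (\<Prod>l\<leftarrow>ls. g l)"
  by (induction ls) (auto simp: mult_ac)

lemma max_modulus_cball: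
  assumes R: "0 < R" and U: "open U" "cball 0 R \<subseteq> U" and h: "h holomorphic_on U"
    and B: "\<And>z. cmod z = R \<Longrightarrow> cmod (h z) \<le> B" and z: "cmod z \<le> R"
  shows "cmod (h z) \<le> B"
proof (rule maximum_modulus_frontier[of h "cball 0 R"])
  show "h holomorphic_on interior (cball 0 R)"
    by (rule holomorphic_on_subset[OF h]) (use U interior_subset in blast)
  show "continuous_on (closure (cball 0 R)) h"
    using U by (auto intro!: continuous_on_subset[OF holomorphic_on_imp_continuous_on[OF h]])
  show "cmod (h z) \<le> B" if "z \<in> frontier (cball 0 R)" for z
    using that R by (intro B) (simp add: frontier_cball)
qed (use z in auto)

text \<open>On the circle \<open>cmod z = R\<close> the factor \<open>1 - z l\<close> has the same modulus as its reflection
  \<open>R (cnj l) - z / R\<close>, which need not vanish inside the disc. At \<open>z = 0\<close> this is Jensen's inequality.\<close>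

lemma blaschke_bound:
  assumes R: "0 < R" and U: "open U" "cball 0 R \<subseteq> U" and g: "g holomorphic_on U"
    and B: "\<And>z. cmod z = R \<Longrightarrow> cmod (g z * (\<Prod>l\<leftarrow>ls. 1 - z * l)) \<le> B"
    and z: "cmod z \<le> R"
  shows "cmod (g z * (\<Prod>l\<leftarrow>ls. of_real R * cnj l - z / of_real R)) \<le> B"
proof (rule max_modulus_cball[OF R U _ _ z])
  show "(\<lambda>z. g z * (\<Prod>l\<leftarrow>ls. of_real R * cnj l - z / of_real R)) holomorphic_on U"
    using R by (intro holomorphic_intros g) auto
  fix z assume z: "cmod z = R"
  have "cmod (of_real R * cnj l - z / of_real R) = cmod (1 - z * l)" for l
  proof -
    have z0: "z \<noteq> 0" using z R by auto
    have cz: "cnj z = of_real (R\<^sup>2) / z"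
      using z z0 complex_norm_square[of z] by (simp add: field_simps)
    have "cmod (of_real R * cnj l - z / of_real R) = cmod (cnj (of_real R * cnj l - z / of_real R))"
      by (rule complex_mod_cnj[symmetric])
    also have "cnj (of_real R * cnj l - z / of_real R) = - (of_real R / z) * (1 - z * l)"
      using z0 R by (simp add: cz field_simps power2_eq_square)
    also have "cmod \<dots> = cmod (1 - z * l)" using z R by (simp add: norm_mult norm_divide)
    finally show ?thesis .
  qed
  then have "cmod (\<Prod>l\<leftarrow>ls. of_real R * cnj l - z / of_real R) = cmod (\<Prod>l\<leftarrow>ls. 1 - z * l)"
    by (simp add: norm_prod_list)
  then show "cmod (g z * (\<Prod>l\<leftarrow>ls. of_real R * cnj l - z / of_real R)) \<le> B"
    using B[OF z] by (simp add: norm_mult)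
qed

text \<open>Each step subtracts the value at the origin and divides by \<open>z\<close>; by the maximum principle this costs
  a factor \<open>2 / \<rho>\<close>.\<close>

lemma polynomial_remainder_bound:
  fixes c :: "nat \<Rightarrow> complex"
  assumes \<rho>: "0 < \<rho>" and U: "open U" "cball 0 \<rho> \<subseteq> U" and k: "k holomorphic_on U"
    and B: "\<And>z. cmod z \<le> \<rho> \<Longrightarrow> cmod ((\<Sum>i<m. c i * z ^ i) + z ^ m * k z) \<le> B"
    and z: "cmod z \<le> \<rho>"
  shows "cmod (k z) \<le> B * (2 / \<rho>) ^ m"
  using B
proof (induction m arbitrary: c B)
  case 0
  then show ?case using z by simp
next
  case (Suc m)
  define f where "f z = (\<Sum>i<m. c (Suc i) * z ^ i) + z ^ m * k z" for z
  have e: "(\<Sum>i<Suc m. c i * z ^ i) + z ^ Suc m * k z = c 0 + z * f z" for z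
    unfolding sum.lessThan_Suc_shift f_def by (simp add: algebra_simps sum_distrib_left)
  have c0: "cmod (c 0) \<le> B" using Suc.prems[of 0] \<rho> unfolding e by simp
  have "cmod (f z) \<le> 2 * B / \<rho>" if "cmod z \<le> \<rho>" for z
  proof (rule max_modulus_cball[OF \<rho> U _ _ that])
    show "f holomorphic_on U" unfolding f_def by (intro holomorphic_intros k)
    fix z assume z: "cmod z = \<rho>"
    have "cmod (z * f z) \<le> cmod (c 0 + z * f z) + cmod (c 0)"
      using norm_triangle_ineq4[of "c 0 + z * f z" "c 0"] by simp
    also have "\<dots> \<le> B + B" using Suc.prems[of z] c0 z unfolding e by (intro add_mono) auto
    finally show "cmod (f z) \<le> 2 * B / \<rho>" using \<rho> z by (simp add: norm_mult field_simps)
  qed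
  then have "cmod (k z) \<le> (2 * B / \<rho>) * (2 / \<rho>) ^ m"
    unfolding f_def by (rule Suc.IH)
  then show ?case by (simp add: mult_ac)
qed

text \<open>The Borel-Caratheodory inequality on the half radius: Schwarz's lemma for \<open>H / (2 M - H)\<close>, which
  maps the disc into the unit disc.\<close>

lemma borel_caratheodory_half:
  assumes R: "0 < R" and H: "H holomorphic_on ball 0 R" and H0: "H 0 = 0"
    and M: "0 < M" "\<And>z. cmod z < R \<Longrightarrow> Re (H z) < M" and z: "cmod z \<le> R / 2"
  shows "cmod (H z) \<le> 2 * M"
proof -
  have lt: "cmod (H z) < cmod (2 * of_real M - H z)" if "cmod z < R" for z
  proof -
    have "(cmod (H z))\<^sup>2 < (cmod (2 * of_real M - H z))\<^sup>2"
    proof -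
      have "(2 * M - Re (H z))\<^sup>2 - (Re (H z))\<^sup>2 = 4 * M * (M - Re (H z))"
        by (simp add: power2_eq_square algebra_simps)
      also have "\<dots> > 0" using M(1) M(2)[OF that] by simp
      finally show ?thesis by (simp add: cmod_power2)
    qed
    then show ?thesis by (rule power_less_imp_less_base) simp
  qed
  define \<phi> where "\<phi> w = H (of_real R * w) / (2 * of_real M - H (of_real R * w))" for w
  have in_R: "cmod (of_real R * w) < R" if "cmod w < 1" for w using that R by (simp add: norm_mult)
  have nz: "2 * of_real M - H (of_real R * w) \<noteq> 0" if "cmod w < 1" for w
    using lt[OF in_R[OF that]] by (metis norm_zero norm_ge_zero not_less)
  have "cmod (\<phi> w) \<le> cmod w" if w: "cmod w < 1" for w
  proof (rule Schwarz_Lemma(1))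
    have "(\<lambda>w. H (of_real R * w)) holomorphic_on ball 0 1"
      using in_R by (intro holomorphic_on_compose_gen[OF _ H, unfolded o_def]) (auto intro!: holomorphic_intros)
    then show "\<phi> holomorphic_on ball 0 1"
      unfolding \<phi>_def using nz by (intro holomorphic_intros) auto
    show "cmod (\<phi> w) < 1" if "cmod w < 1" for w
    proof -
      have "cmod (H (of_real R * w)) < cmod (2 * of_real M - H (of_real R * w))" by (rule lt[OF in_R[OF that]])
      moreover have "0 < cmod (2 * of_real M - H (of_real R * w))" using nz[OF that] by simp
      ultimately show ?thesis by (simp only: \<phi>_def norm_divide divide_less_eq_1_pos)
    qed
    show "\<phi> 0 = 0" by (simp add: \<phi>_def H0)
  qed (use w in auto)
  note S = this
  define w where "w = z / of_real R"
  have w: "of_real R * w = z" "cmod w \<le> 1 / 2" using R z by (auto simp: w_def norm_divide field_simps)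
  have w1: "cmod w < 1" using w(2) by simp
  have "cmod (\<phi> w) = cmod (H z) / cmod (2 * of_real M - H z)" by (simp only: \<phi>_def w(1) norm_divide)
  moreover have "cmod (\<phi> w) \<le> 1 / 2" using S[OF w1] w(2) by linarith
  moreover have "0 < cmod (2 * of_real M - H z)" using nz[OF w1] unfolding w(1) by simp
  ultimately have "cmod (H z) \<le> cmod (2 * of_real M - H z) / 2"
    by (simp add: pos_divide_le_eq)
  also have "\<dots> \<le> (2 * M + cmod (H z)) / 2"
    using norm_triangle_ineq4[of "2 * of_real M" "H z"] M(1) by (simp add: norm_mult)
  finally show ?thesis by simp
qed

text \<open>Maximum principle for the reversed polynomial. It allows to leave the unit disc at the price of a
  power of \<open>z\<close> only, whatever the coefficients are.\<close>

lemma reverse_polynomial_bound: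
  assumes B: "\<And>\<zeta>. cmod \<zeta> = 1 \<Longrightarrow> cmod (a * (\<Prod>m\<leftarrow>ms. 1 - \<zeta> * m)) \<le> B" and z: "1 \<le> cmod z"
  shows "cmod (a * (\<Prod>m\<leftarrow>ms. 1 - z * m)) \<le> cmod z ^ length ms * B"
proof -
  have pull: "(\<Prod>m\<leftarrow>ms. 1 - w * m) = w ^ length ms * (\<Prod>m\<leftarrow>ms. 1 / w - m)" if "w \<noteq> 0" for w
    using that by (induction ms) (auto simp: field_simps)
  have "cmod (a * (\<Prod>m\<leftarrow>ms. 1 / z - m)) \<le> B"
  proof (rule max_modulus_cball[of 1 UNIV "\<lambda>w. a * (\<Prod>m\<leftarrow>ms. w - m)"])
    show "(\<lambda>w. a * (\<Prod>m\<leftarrow>ms. w - m)) holomorphic_on UNIV" by (intro holomorphic_intros)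
    fix w :: complex assume w: "cmod w = 1"
    then have "w \<noteq> 0" by auto
    then have "cmod (a * (\<Prod>m\<leftarrow>ms. 1 - (1 / w) * m)) = cmod (a * (\<Prod>m\<leftarrow>ms. w - m))"
      using pull[of "1 / w"] w by (simp add: norm_mult norm_power norm_divide)
    then show "cmod (a * (\<Prod>m\<leftarrow>ms. w - m)) \<le> B" using B[of "1 / w"] w by (simp add: norm_divide)
  qed (use z in \<open>auto simp: norm_divide divide_le_eq_1\<close>)
  then have "cmod z ^ length ms * cmod (a * (\<Prod>m\<leftarrow>ms. 1 / z - m)) \<le> cmod z ^ length ms * B"
    by (intro mult_left_mono) auto
  moreover have "z \<noteq> 0" using z by auto
  then have "cmod (a * (\<Prod>m\<leftarrow>ms. 1 - z * m)) = cmod z ^ length ms * cmod (a * (\<Prod>m\<leftarrow>ms. 1 / z - m))"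
    by (subst pull) (simp_all only: norm_mult norm_power mult.left_commute not_False_eq_True)
  ultimately show ?thesis by simp
qed

lemma entire_difference_bound:
  assumes h: "h holomorphic_on UNIV" and \<rho>: "0 < \<rho>" and C: "\<And>z. cmod z \<le> \<rho> + 1 \<Longrightarrow> cmod (h z) \<le> C"
  shows "cmod (h 1 - h 0) \<le> C / \<rho>"
proof -
  have "cmod (h 1 - h 0) \<le> (C / \<rho>) * cmod (1 - 0)"
  proof (rule field_differentiable_bound[of "cball 0 1" h "deriv h"])
    fix z :: complex assume z: "z \<in> cball 0 1"
    have "(h has_field_derivative deriv h z) (at z)" by (rule holomorphic_derivI[OF h]) auto
    then show "(h has_field_derivative deriv h z) (at z within cball 0 1)"
      by (rule has_field_derivative_at_within)
    have "cmod ((deriv ^^ 1) h z) \<le> fact 1 * C / \<rho> ^ 1"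
    proof (rule Cauchy_inequality)
      show "h holomorphic_on ball z \<rho>" "continuous_on (cball z \<rho>) h"
        using h by (auto intro: holomorphic_on_subset holomorphic_on_imp_continuous_on continuous_on_subset)
      fix x assume "cmod (z - x) = \<rho>"
      then show "cmod (h x) \<le> C" using z norm_triangle_ineq2[of x z] by (intro C) (simp add: norm_minus_commute)
    qed (rule \<rho>)
    then show "cmod (deriv h z) \<le> C / \<rho>" by simp
  qed auto
  then show ?thesis by simp
qed

text \<open>The Weierstrass primary factor of genus \<open>n - 1\<close>.\<close>

definition primary :: "nat \<Rightarrow> complex \<Rightarrow> complex" where
  "primary n w = (1 - w) * exp (\<Sum>k = 1..n - 1. 1 / of_nat k * w ^ k)"

definition log_primary :: "nat \<Rightarrow> complex \<Rightarrow> complex" where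
  "log_primary n w = Ln (1 - w) + (\<Sum>k = 1..n - 1. 1 / of_nat k * w ^ k)"

lemma one_minus_Re_pos: "cmod w < 1 \<Longrightarrow> 1 - w \<notin> \<real>\<^sub>\<le>\<^sub>0 \<and> 1 - w \<noteq> 0"
  using abs_Re_le_cmod[of w] by (auto simp: complex_nonpos_Reals_iff)

lemma exp_log_primary: "cmod w < 1 \<Longrightarrow> exp (log_primary n w) = primary n w"
  using one_minus_Re_pos[of w] by (simp add: log_primary_def primary_def exp_add)

lemma log_primary_0 [simp]: "log_primary n 0 = 0"
  by (auto simp: log_primary_def intro!: sum.neutral)

lemma exp_part_derivative:
  "((\<lambda>z. \<Sum>k = 1..n - 1. 1 / of_nat k * (z * \<mu>) ^ k) has_field_derivative (\<Sum>i<n - 1. \<mu> ^ Suc i * z ^ i)) (at z within S)"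
proof -
  have "((\<lambda>z. \<Sum>k = 1..n - 1. 1 / of_nat k * (z * \<mu>) ^ k) has_field_derivative
      (\<Sum>k = 1..n - 1. \<mu> ^ Suc (k - 1) * z ^ (k - 1))) (at z within S)"
  proof (rule DERIV_sum)
    fix k assume k: "k \<in> {1..n - 1}"
    have "((\<lambda>z. 1 / of_nat k * (z * \<mu>) ^ k) has_field_derivative
        1 / of_nat k * (of_nat k * (1 * \<mu>) * (z * \<mu>) ^ (k - 1))) (at z within S)"
      by (rule derivative_eq_intros refl | simp)+
    moreover have "1 / of_nat k * (of_nat k * (1 * \<mu>) * (z * \<mu>) ^ (k - 1)) = \<mu> ^ Suc (k - 1) * z ^ (k - 1)"
    proof -
      obtain j where "k = Suc j" using k by (cases k) auto
      then show ?thesis by (simp add: power_mult_distrib del: of_nat_Suc)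
    qed
    ultimately show "((\<lambda>z. 1 / of_nat k * (z * \<mu>) ^ k) has_field_derivative \<mu> ^ Suc (k - 1) * z ^ (k - 1)) (at z within S)"
      by simp
  qed
  also have "(\<Sum>k = 1..n - 1. \<mu> ^ Suc (k - 1) * z ^ (k - 1)) = (\<Sum>i<n - 1. \<mu> ^ Suc i * z ^ i)"
    by (rule sum.reindex_bij_witness[of _ Suc "\<lambda>k. k - 1"]) auto
  finally show ?thesis .
qed

text \<open>The geometric sum cancels all terms below order \<open>n - 1\<close>.\<close>

lemma log_primary_derivative:
  assumes n: "0 < n" and z: "cmod (z * \<mu>) < 1"
  shows "((\<lambda>z. log_primary n (z * \<mu>)) has_field_derivative z ^ (n - 1) * (- (\<mu> ^ n / (1 - z * \<mu>)))) (at z within S)"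
proof -
  have nz: "1 - z * \<mu> \<noteq> 0" "1 - z * \<mu> \<notin> \<real>\<^sub>\<le>\<^sub>0" using one_minus_Re_pos[OF z] by auto
  have "((\<lambda>z. Ln (1 - z * \<mu>)) has_field_derivative (- \<mu> / (1 - z * \<mu>))) (at z within S)"
    using nz by (auto intro!: derivative_eq_intros simp: divide_inverse)
  then have "((\<lambda>z. log_primary n (z * \<mu>)) has_field_derivative (- \<mu> / (1 - z * \<mu>) + (\<Sum>i<n - 1. \<mu> ^ Suc i * z ^ i))) (at z within S)"
    unfolding log_primary_def by (intro DERIV_add exp_part_derivative)
  moreover have "- \<mu> / (1 - z * \<mu>) + (\<Sum>i<n - 1. \<mu> ^ Suc i * z ^ i) = z ^ (n - 1) * (- (\<mu> ^ n / (1 - z * \<mu>)))"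
  proof -
    have "(\<Sum>i<n - 1. \<mu> ^ Suc i * z ^ i) = \<mu> * (\<Sum>i<n - 1. (z * \<mu>) ^ i)"
      by (simp add: sum_distrib_left power_mult_distrib mult_ac)
    then have "(1 - z * \<mu>) * (\<Sum>i<n - 1. \<mu> ^ Suc i * z ^ i) = \<mu> * (1 - (z * \<mu>) ^ (n - 1))"
      by (simp add: one_diff_power_eq mult.left_commute)
    then have "(\<Sum>i<n - 1. \<mu> ^ Suc i * z ^ i) = \<mu> * (1 - (z * \<mu>) ^ (n - 1)) / (1 - z * \<mu>)"
      using nz by (simp add: field_simps)
    moreover have "\<mu> ^ n = \<mu> * \<mu> ^ (n - 1)" using n by (cases n) auto
    moreover have "- \<mu> / (1 - z * \<mu>) + \<mu> * (1 - y) / (1 - z * \<mu>) = - (\<mu> * y) / (1 - z * \<mu>)" for y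
      by (simp add: diff_divide_distrib right_diff_distrib)
    ultimately show ?thesis by (simp add: power_mult_distrib mult_ac)
  qed
  ultimately show ?thesis by simp
qed

lemma log_primary_bound:
  assumes n: "0 < n" and \<mu>: "cmod \<mu> \<le> 1 / 2"
  shows "cmod (log_primary n \<mu>) \<le> 2 * cmod \<mu> ^ n"
proof -
  have "cmod (log_primary n (1 * \<mu>) - log_primary n (0 * \<mu>)) \<le> (2 * cmod \<mu> ^ n) * cmod (1 - 0)"
  proof (rule field_differentiable_bound[of "cball 0 1" "\<lambda>z. log_primary n (z * \<mu>)"])
    fix z :: complex assume z: "z \<in> cball 0 1"
    then have zm: "cmod (z * \<mu>) \<le> 1 / 2" using \<mu> mult_mono[of "cmod z" 1 "cmod \<mu>" "1/2"] by (simp add: norm_mult)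
    then show "((\<lambda>z. log_primary n (z * \<mu>)) has_field_derivative z ^ (n - 1) * (- (\<mu> ^ n / (1 - z * \<mu>)))) (at z within cball 0 1)"
      by (intro log_primary_derivative n) simp
    have "1 / 2 \<le> cmod (1 - z * \<mu>)" using norm_triangle_ineq2[of 1 "z * \<mu>"] zm by simp
    moreover have "cmod z ^ (n - 1) \<le> 1" using z by (simp add: power_le_one)
    ultimately have "cmod z ^ (n - 1) * (cmod \<mu> ^ n / cmod (1 - z * \<mu>)) \<le> 1 * (cmod \<mu> ^ n / (1 / 2))"
      by (intro mult_mono divide_left_mono) (auto intro!: mult_pos_pos)
    then show "cmod (z ^ (n - 1) * (- (\<mu> ^ n / (1 - z * \<mu>)))) \<le> 2 * cmod \<mu> ^ n"
      by (simp add: norm_mult norm_power norm_divide)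
  qed auto
  then show ?thesis by simp
qed

text \<open>The quantitative form of Lidskii's theorem. If the product over all factors grows like
  \<open>exp (\<delta> |z|^p + C)\<close>, divide out the zeros in the disc of radius \<open>R\<close> (\<open>blaschke_bound\<close>): the quotient has a
  logarithm \<open>H\<close> whose real part is at most of order \<open>\<delta> R^p + C\<close>. Apart from a polynomial of degree less than
  \<open>n\<close>, the function \<open>H\<close> is the sum \<open>u\<close> of the logarithms of the primary factors that belong to the small \<open>l\<close>
  and to the reflections of the large ones. As \<open>u\<close> vanishes to order \<open>n \<ge> p\<close> at the origin, its value at \<open>1\<close> is
  only of order \<open>(\<delta> R^p + C) / R^n\<close>. The estimate does not involve the number of small factors.\<close>

lemma small_factor_product_bound:
  assumes n: "0 < n" and p: "0 < p" "p \<le> real n" and R: "4 \<le> R" and \<delta>: "0 < \<delta>" and C: "0 \<le> C"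
    and big: "\<And>l. l \<in> set ls1 \<Longrightarrow> 1 / R \<le> cmod l" and small: "\<And>l. l \<in> set ls2 \<Longrightarrow> cmod l < 1 / R"
    and bound: "\<And>z. cmod (\<Prod>l\<leftarrow>ls1 @ ls2. primary n (z * l)) \<le> exp (\<delta> * cmod z powr p + C)"
  shows "cmod (\<Prod>l\<leftarrow>ls2. primary n l) \<le> exp ((2 * 8 ^ n + 2 * exp p) * (\<delta> + C * R powr - p))"
proof -
  have R0: "0 < R" using R by simp
  define M where "M r = \<delta> * r powr p + C" for r
  have Mpos: "0 < M R" using \<delta> C R0 by (simp add: M_def add_pos_nonneg)
  define ex where "ex x = (\<Sum>k = 1..n - 1. 1 / of_nat k * x ^ k)" for x :: complex
  define v where "v z = (\<Prod>l\<leftarrow>ls2. primary n (z * l)) * (\<Prod>l\<leftarrow>ls1. exp (ex (z * l)))" for z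
  have v_hol: "v holomorphic_on UNIV"
    unfolding v_def primary_def ex_def by (intro holomorphic_intros)
  have fv: "(\<Prod>l\<leftarrow>ls1 @ ls2. primary n (z * l)) = v z * (\<Prod>l\<leftarrow>ls1. 1 - z * l)" for z
    by (simp add: v_def primary_def ex_def prod_list_mult mult_ac)
  have J: "cmod (v z * (\<Prod>l\<leftarrow>ls1. of_real r * cnj l - z / of_real r)) \<le> exp (M r)" if "0 < r" "cmod z \<le> r" for r z
    by (rule blaschke_bound[OF that(1) open_UNIV _ v_hol _ that(2)])
      (use bound in \<open>auto simp: M_def fv[symmetric]\<close>)
  \<comment> \<open>Jensen's inequality for the radius \<open>e R\<close>, where each large factor contributes at least \<open>e\<close>\<close>
  define N where "N = length ls1"
  have N: "real N \<le> M (exp 1 * R)"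
  proof -
    have "exp 1 ^ N \<le> (\<Prod>l\<leftarrow>ls1. cmod (of_real (exp 1 * R) * cnj l - 0 / of_real (exp 1 * R)))"
    proof -
      have "exp 1 \<le> exp 1 * R * cmod l" if "l \<in> set ls1" for l
        using big[OF that] R0 by (simp add: field_simps)
      then have "(\<Prod>l\<leftarrow>ls1. exp 1) \<le> (\<Prod>l\<leftarrow>ls1. cmod (of_real (exp 1 * R) * cnj l - 0 / of_real (exp 1 * R)))"
        using R0 by (intro conjunct1[OF prod_list_mono_real]) (auto simp: norm_mult)
      then show ?thesis by (simp add: prod_list_const N_def)
    qed
    also have "\<dots> = cmod (v 0 * (\<Prod>l\<leftarrow>ls1. of_real (exp 1 * R) * cnj l - 0 / of_real (exp 1 * R)))"
    proof -
      have ex0: "ex 0 = 0" by (auto simp: ex_def intro!: sum.neutral)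
      have "primary n 0 = 1" unfolding primary_def ex_def[symmetric] ex0 by simp
      then have "v 0 = 1" by (simp add: v_def prod_list_const ex0)
      then show ?thesis by (simp only: norm_mult norm_prod_list norm_one mult_1)
    qed
    also have "\<dots> \<le> exp (M (exp 1 * R))" using R0 by (intro J) auto
    finally have "exp (real N) \<le> exp (M (exp 1 * R))" by (simp flip: exp_of_nat_mult)
    then show ?thesis by simp
  qed
  define \<mu>s where "\<mu>s = map (\<lambda>l. 1 / (of_real (R\<^sup>2) * cnj l)) ls1"
  define ls3 where "ls3 = ls2 @ \<mu>s"
  have \<mu>s: "cmod m \<le> 1 / R" if m: "m \<in> set \<mu>s" for m
  proof -
    obtain l where l: "l \<in> set ls1" "m = 1 / (of_real (R\<^sup>2) * cnj l)" using m unfolding \<mu>s_def set_map by blast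
    have "R * 1 \<le> R * (R * cmod l)" using big[OF l(1)] R0 by (intro mult_left_mono) (auto simp: field_simps)
    then show ?thesis
      using R0 by (simp add: l(2) norm_divide norm_mult power2_eq_square divide_simps norm_power)
  qed
  have ls3: "cmod m \<le> 1 / R" if "m \<in> set ls3" for m using that \<mu>s small by (auto simp: ls3_def less_imp_le)
  have ls3z: "cmod (z * m) < 1" if "m \<in> set ls3" "cmod z < R" for z m
  proof -
    have "cmod z * cmod m \<le> cmod z * (1 / R)" using ls3[OF that(1)] by (intro mult_left_mono) auto
    also have "\<dots> < 1" using that(2) R0 by (simp add: field_simps)
    finally show ?thesis by (simp add: norm_mult)
  qed
  define Q where "Q z = (\<Sum>l\<leftarrow>ls1 @ ls2. ex (z * l))" for z
  define H where "H z = (\<Sum>m\<leftarrow>ls3. Ln (1 - z * m)) + Q z" for z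
  have H_hol: "H holomorphic_on ball 0 R"
    unfolding H_def Q_def ex_def
    using ls3z one_minus_Re_pos by (intro holomorphic_intros) auto
  have ex0: "ex 0 = 0" by (auto simp: ex_def intro!: sum.neutral)
  have H0: "H 0 = 0" by (simp add: H_def Q_def ex0)
  have expH: "cmod (exp (H z)) \<le> exp (M R)" if z: "cmod z < R" for z
  proof -
    have "exp (H z) = (\<Prod>m\<leftarrow>ls3. exp (Ln (1 - z * m))) * (\<Prod>l\<leftarrow>ls1 @ ls2. exp (ex (z * l)))"
      by (simp add: H_def Q_def exp_add exp_sum_list)
    also have "(\<Prod>m\<leftarrow>ls3. exp (Ln (1 - z * m))) = (\<Prod>m\<leftarrow>ls3. 1 - z * m)"
      using one_minus_Re_pos[OF ls3z[OF _ z]] by (intro arg_cong[of _ _ prod_list] map_cong) auto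
    also have "(\<Prod>m\<leftarrow>ls3. 1 - z * m) * (\<Prod>l\<leftarrow>ls1 @ ls2. exp (ex (z * l))) = v z * (\<Prod>m\<leftarrow>\<mu>s. 1 - z * m)"
      by (simp add: ls3_def v_def primary_def ex_def prod_list_mult mult_ac)
    finally have e: "exp (H z) = v z * (\<Prod>m\<leftarrow>\<mu>s. 1 - z * m)" .
    have "cmod (\<Prod>m\<leftarrow>\<mu>s. 1 - z * m) \<le> cmod (\<Prod>l\<leftarrow>ls1. of_real R * cnj l - z / of_real R)"
    proof -
      have "cmod (1 - z * (1 / (of_real (R\<^sup>2) * cnj l))) \<le> cmod (of_real R * cnj l - z / of_real R)"
        if l: "l \<in> set ls1" for l
      proof -
        have l0: "l \<noteq> 0" using big[OF l] R0 by auto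
        have "of_real R * cnj l - z / of_real R = (of_real R * cnj l) * (1 - z * (1 / (of_real (R\<^sup>2) * cnj l)))"
          using l0 R0 by (simp add: field_simps power2_eq_square)
        moreover have "1 \<le> cmod (of_real R * cnj l)" using big[OF l] R0 by (simp add: norm_mult field_simps)
        ultimately show ?thesis
          by (simp only: norm_mult) (metis mult_right_mono mult_1 norm_ge_zero)
      qed
      then have "(\<Prod>l\<leftarrow>ls1. cmod (1 - z * (1 / (of_real (R\<^sup>2) * cnj l)))) \<le> (\<Prod>l\<leftarrow>ls1. cmod (of_real R * cnj l - z / of_real R))"
        by (intro conjunct1[OF prod_list_mono_real]) auto
      then show ?thesis by (simp add: norm_prod_list \<mu>s_def o_def)
    qed
    then have "cmod (exp (H z)) \<le> cmod (v z * (\<Prod>l\<leftarrow>ls1. of_real R * cnj l - z / of_real R))"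
      unfolding e by (simp add: norm_mult mult_left_mono)
    also have "\<dots> \<le> exp (M R)" using z R0 by (intro J) auto
    finally show ?thesis .
  qed
  have ReH: "Re (H z) < 2 * M R" if "cmod z < R" for z
    using expH[OF that] Mpos by simp
  have Hb: "cmod (H z) \<le> 4 * M R" if "cmod z \<le> R / 2" for z
    using borel_caratheodory_half[OF R0 H_hol H0 _ ReH that] Mpos by simp
  define k where "k z = - (\<Sum>m\<leftarrow>ls3. m ^ n / (1 - z * m))" for z
  define c where "c i = (\<Sum>l\<leftarrow>ls1 @ ls2. l ^ Suc i)" for i
  define u where "u z = (\<Sum>m\<leftarrow>ls3. log_primary n (z * m))" for z
  have u': "(u has_field_derivative z ^ (n - 1) * k z) (at z within S)" if "cmod z < R" for z S
  proof -
    have "(u has_field_derivative (\<Sum>m\<leftarrow>ls3. z ^ (n - 1) * (- (m ^ n / (1 - z * m))))) (at z within S)"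
      unfolding u_def using ls3z[OF _ that] by (intro sum_list_has_field_derivative log_primary_derivative n)
    also have "(\<Sum>m\<leftarrow>ls3. z ^ (n - 1) * (- (m ^ n / (1 - z * m)))) = z ^ (n - 1) * k z"
      by (simp only: k_def sum_list_const_mult) (simp add: uminus_sum_list_map o_def)
    finally show ?thesis .
  qed
  have ex_sum: "(\<Sum>l\<leftarrow>ls. \<Sum>i<n - 1. l ^ Suc i * z ^ i) = (\<Sum>i<n - 1. (\<Sum>l\<leftarrow>ls. l ^ Suc i) * z ^ i)" for ls and z :: complex
    by (induction ls) (auto simp: sum.distrib algebra_simps)
  have Q': "(Q has_field_derivative (\<Sum>i<n - 1. c i * z ^ i)) (at z)" for z
  proof -
    have "(Q has_field_derivative (\<Sum>l\<leftarrow>ls1 @ ls2. \<Sum>i<n - 1. l ^ Suc i * z ^ i)) (at z)"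
      unfolding Q_def ex_def by (intro sum_list_has_field_derivative exp_part_derivative)
    then show ?thesis unfolding ex_sum c_def .
  qed
  have Q3': "((\<lambda>z. \<Sum>m\<leftarrow>ls3. ex (z * m)) has_field_derivative (\<Sum>i<n - 1. (\<Sum>l\<leftarrow>ls3. l ^ Suc i) * z ^ i)) (at z)" for z
  proof -
    have "((\<lambda>z. \<Sum>m\<leftarrow>ls3. ex (z * m)) has_field_derivative (\<Sum>l\<leftarrow>ls3. \<Sum>i<n - 1. l ^ Suc i * z ^ i)) (at z)"
      unfolding ex_def by (intro sum_list_has_field_derivative exp_part_derivative)
    then show ?thesis unfolding ex_sum .
  qed
  define d where "d i = c i - (\<Sum>l\<leftarrow>ls3. l ^ Suc i)" for i
  have Hu: "H z = u z + (Q z - (\<Sum>m\<leftarrow>ls3. ex (z * m)))" for z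
    by (simp add: H_def u_def log_primary_def ex_def sum_list_addf)
  have H': "(H has_field_derivative (\<Sum>i<n - 1. d i * z ^ i) + z ^ (n - 1) * k z) (at z)" if "cmod z < R" for z
  proof -
    have "((\<lambda>z. u z + (Q z - (\<Sum>m\<leftarrow>ls3. ex (z * m)))) has_field_derivative
        z ^ (n - 1) * k z + ((\<Sum>i<n - 1. c i * z ^ i) - (\<Sum>i<n - 1. (\<Sum>l\<leftarrow>ls3. l ^ Suc i) * z ^ i))) (at z)"
      by (intro DERIV_add DERIV_diff u' Q' Q3' that)
    also have "(\<lambda>z. u z + (Q z - (\<Sum>m\<leftarrow>ls3. ex (z * m)))) = H" by (rule ext) (simp add: Hu)
    also have "(\<Sum>i<n - 1. c i * z ^ i) - (\<Sum>i<n - 1. (\<Sum>l\<leftarrow>ls3. l ^ Suc i) * z ^ i) = (\<Sum>i<n - 1. d i * z ^ i)"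
      by (simp add: d_def algebra_simps sum_subtractf)
    finally show ?thesis by (simp add: add.commute)
  qed
  have H'b: "cmod ((\<Sum>i<n - 1. d i * z ^ i) + z ^ (n - 1) * k z) \<le> 16 * M R / R" if z: "cmod z \<le> R / 4" for z
  proof -
    have sub: "cball z (R / 4) \<subseteq> ball 0 R" "ball z (R / 4) \<subseteq> ball 0 R"
      using z R0 by (auto simp: dist_norm intro: norm_triangle_lt)
        (smt (verit) norm_triangle_ineq2 norm_minus_commute)+
    have "cmod ((deriv ^^ 1) H z) \<le> fact 1 * (4 * M R) / (R / 4) ^ 1"
    proof (rule Cauchy_inequality)
      show "H holomorphic_on ball z (R / 4)" using holomorphic_on_subset[OF H_hol sub(2)] .
      show "continuous_on (cball z (R / 4)) H"
        using holomorphic_on_imp_continuous_on[OF holomorphic_on_subset[OF H_hol sub(1)]] .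
      fix x assume "cmod (z - x) = R / 4"
      then have "cmod x \<le> R / 2" using z norm_triangle_ineq2[of x z] by (simp add: norm_minus_commute)
      then show "cmod (H x) \<le> 4 * M R" by (rule Hb)
    qed (use R0 in simp)
    moreover have "cmod z < R" using z R0 by simp
    ultimately show ?thesis using DERIV_imp_deriv[OF H'[of z]] by simp
  qed
  have kb: "cmod (k z) \<le> 2 * M R * (8 / R) ^ n" if "cmod z \<le> R / 4" for z
  proof -
    have "cmod (k z) \<le> (16 * M R / R) * (2 / (R / 4)) ^ (n - 1)"
    proof (rule polynomial_remainder_bound[of "R / 4" "ball 0 R" k d])
      show "k holomorphic_on ball 0 R"
        unfolding k_def using ls3z one_minus_Re_pos by (intro holomorphic_intros) auto
    qed (use R0 H'b that in auto)
    also have "\<dots> = 2 * M R * (8 / R) ^ n" using n by (cases n) auto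
    finally show ?thesis .
  qed
  have u1: "cmod (u 1) \<le> 2 * M R * (8 / R) ^ n"
  proof -
    have "cmod (u 1 - u 0) \<le> (2 * M R * (8 / R) ^ n) * cmod (1 - 0)"
    proof (rule field_differentiable_bound[of "cball 0 1" u])
      fix z :: complex assume "z \<in> cball 0 1"
      then have z: "cmod z \<le> 1" "cmod z < R" "cmod z \<le> R / 4" using R by auto
      show "(u has_field_derivative z ^ (n - 1) * k z) (at z within cball 0 1)" by (rule u'[OF z(2)])
      have "cmod z ^ (n - 1) * cmod (k z) \<le> 1 * (2 * M R * (8 / R) ^ n)"
        using kb[OF z(3)] z(1) by (intro mult_mono power_le_one) auto
      then show "cmod (z ^ (n - 1) * k z) \<le> 2 * M R * (8 / R) ^ n" by (simp add: norm_mult norm_power)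
    qed auto
    moreover have "u 0 = 0" by (auto simp: u_def intro!: sum_list_0)
    ultimately show ?thesis by simp
  qed
  define w where "w = (\<Sum>m\<leftarrow>\<mu>s. log_primary n m)"
  have wb: "cmod w \<le> real N * (2 * (1 / R) ^ n)"
  proof -
    have "cmod (\<Sum>m\<leftarrow>ms. log_primary n m) \<le> real (length ms) * (2 * (1 / R) ^ n)"
      if "\<And>m. m \<in> set ms \<Longrightarrow> cmod m \<le> 1 / R" for ms
      using that
    proof (induction ms)
      case (Cons m ms)
      have m: "cmod m \<le> 1 / R" using Cons.prems by simp
      have "1 / R \<le> 1 / 2" using R by (intro divide_left_mono) auto
      then have "cmod (log_primary n m) \<le> 2 * cmod m ^ n" using m by (intro log_primary_bound n) linarith
      also have "\<dots> \<le> 2 * (1 / R) ^ n" using m by (intro mult_left_mono power_mono) auto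
      finally have "cmod (log_primary n m) \<le> 2 * (1 / R) ^ n" .
      moreover have "cmod (\<Sum>m\<leftarrow>ms. log_primary n m) \<le> real (length ms) * (2 * (1 / R) ^ n)"
        using Cons by auto
      ultimately have "cmod (log_primary n m + (\<Sum>m\<leftarrow>ms. log_primary n m)) \<le>
          2 * (1 / R) ^ n + real (length ms) * (2 * (1 / R) ^ n)" by (intro order_trans[OF norm_triangle_ineq] add_mono)
      then show ?case by (simp add: algebra_simps)
    qed simp
    from this[of \<mu>s] show ?thesis unfolding w_def N_def using \<mu>s by (simp add: \<mu>s_def)
  qed
  have prods: "(\<Prod>l\<leftarrow>ls2. primary n l) = exp (u 1 - w)"
  proof -
    have "cmod m < 1" if "m \<in> set ls3" for m using ls3z[OF that, of 1] R by simp
    then have "(\<Sum>m\<leftarrow>ls3. log_primary n m) - w = (\<Sum>m\<leftarrow>ls2. log_primary n m)"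
      by (simp add: ls3_def w_def)
    moreover have "exp (\<Sum>m\<leftarrow>ls2. log_primary n m) = (\<Prod>l\<leftarrow>ls2. primary n l)"
      unfolding exp_sum_list
      using \<open>\<And>m. m \<in> set ls3 \<Longrightarrow> cmod m < 1\<close>
      by (intro arg_cong[of _ _ prod_list] map_cong refl exp_log_primary) (auto simp: ls3_def)
    ultimately show ?thesis by (simp add: u_def)
  qed
  have final: "2 * M R * (8 / R) ^ n + real N * (2 * (1 / R) ^ n) \<le> (2 * 8 ^ n + 2 * exp p) * (\<delta> + C * R powr - p)"
  proof -
    have Rn: "(1 / R) ^ n \<le> R powr - p"
    proof -
      have "(1 / R) ^ n = R powr - real n" using R0 by (simp add: powr_minus powr_realpow inverse_eq_divide power_divide)
      also have "\<dots> \<le> R powr - p" using p(2) R by (intro powr_mono) auto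
      finally show ?thesis .
    qed
    have RR: "R powr p * R powr - p = 1" using R0 by (simp flip: powr_add)
    have "M R * (1 / R) ^ n \<le> M R * R powr - p" using Rn Mpos by (intro mult_left_mono) auto
    also have "\<dots> = \<delta> + C * R powr - p" using RR by (simp add: M_def algebra_simps)
    finally have 1: "M R * (1 / R) ^ n \<le> \<delta> + C * R powr - p" .
    have "real N * (1 / R) ^ n \<le> M (exp 1 * R) * R powr - p"
      using N Rn R0 by (intro mult_mono) (auto intro: order_trans[OF of_nat_0_le_iff])
    also have "\<dots> = \<delta> * exp p * (R powr p * R powr - p) + C * R powr - p"
      using R0 by (simp add: M_def powr_mult algebra_simps) (simp add: powr_def)
    also have "\<dots> \<le> exp p * (\<delta> + C * R powr - p)"
    proof -
      have "1 * (C * R powr - p) \<le> exp p * (C * R powr - p)" using C p by (intro mult_right_mono) auto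
      then show ?thesis by (simp add: RR algebra_simps)
    qed
    finally have 2: "real N * (1 / R) ^ n \<le> exp p * (\<delta> + C * R powr - p)" .
    have "2 * M R * (8 / R) ^ n = 2 * 8 ^ n * (M R * (1 / R) ^ n)"
      by (simp add: power_divide)
    also have "\<dots> \<le> 2 * 8 ^ n * (\<delta> + C * R powr - p)" using 1 by (intro mult_left_mono) auto
    finally show ?thesis using 2 by (simp add: algebra_simps)
  qed
  have "cmod (\<Prod>l\<leftarrow>ls2. primary n l) = exp (Re (u 1 - w))" unfolding prods by simp
  also have "Re (u 1 - w) \<le> cmod (u 1) + cmod w"
    using complex_Re_le_cmod[of "u 1 - w"] norm_triangle_ineq4[of "u 1" w] by linarith
  also have "\<dots> \<le> (2 * 8 ^ n + 2 * exp p) * (\<delta> + C * R powr - p)" using u1 wb final by linarith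
  finally show ?thesis by simp
qed

section \<open>The regularized determinant of finite rank operators\<close>

lemma trace_compose_bound:
  fixes F :: "'a::complex_normed_vector \<Rightarrow>\<^sub>L 'a"
  assumes F: "F \<in> finite_rank_ops"
  obtains c where "0 \<le> c" "\<And>X. X \<in> bounded_ops \<Longrightarrow> cmod (op_trace (X o\<^sub>L F)) \<le> c * norm X"
proof -
  let ?bs = "range_basis F"
  note bs = range_basis_list[OF F]
  obtain C where C: "C > 0" "\<And>v i. v \<in> lspan ?bs \<Longrightarrow> i < length ?bs \<Longrightarrow> cmod (coord ?bs v i) \<le> C * norm v"
    using coord_bounded[OF bs(1)] by blast
  show ?thesis
  proof
    show "0 \<le> (\<Sum>i<length ?bs. C * (norm F * norm (?bs ! i)))" using C(1) by (intro sum_nonneg) auto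
    fix X :: "'a \<Rightarrow>\<^sub>L 'a" assume X: "X \<in> bounded_ops"
    have FX: "F o\<^sub>L X \<in> bounded_ops" using X finite_rank_ops_bounded[OF F] by auto
    have r: "range (blinfun_apply (F o\<^sub>L X)) \<subseteq> lspan ?bs" using bs(2) by auto
    have "op_trace (X o\<^sub>L F) = op_trace (F o\<^sub>L X)" using det_id_minus_trace_commute(2)[OF F X] by simp
    also have "\<dots> = trace_wrt ?bs (F o\<^sub>L X)" by (rule det_id_minus_wrt(2)[OF FX bs(1) r])
    also have "\<dots> = (\<Sum>i<length ?bs. coord ?bs (blinfun_apply F (blinfun_apply X (?bs ! i))) i)"
      by (simp add: trace_wrt_def mat_trace_def)
    finally have "cmod (op_trace (X o\<^sub>L F)) \<le> (\<Sum>i<length ?bs. cmod (coord ?bs (blinfun_apply F (blinfun_apply X (?bs ! i))) i))"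
      by (simp add: norm_sum)
    also have "\<dots> \<le> (\<Sum>i<length ?bs. C * (norm F * norm (?bs ! i)) * norm X)"
    proof (rule sum_mono)
      fix i assume "i \<in> {..<length ?bs}"
      then have "cmod (coord ?bs (blinfun_apply F (blinfun_apply X (?bs ! i))) i) \<le> C * norm (blinfun_apply F (blinfun_apply X (?bs ! i)))"
        using bs(2) by (intro C(2)) auto
      also have "\<dots> \<le> C * (norm F * (norm X * norm (?bs ! i)))"
        using C(1) by (intro mult_left_mono order_trans[OF norm_blinfun] norm_blinfun) auto
      finally show "cmod (coord ?bs (blinfun_apply F (blinfun_apply X (?bs ! i))) i) \<le> C * (norm F * norm (?bs ! i)) * norm X"
        by (simp add: mult_ac)
    qed
    finally show "cmod (op_trace (X o\<^sub>L F)) \<le> (\<Sum>i<length ?bs. C * (norm F * norm (?bs ! i))) * norm X"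
      by (simp add: sum_distrib_right)
  qed
qed

lemma norm_op_power_le: "norm Z \<le> N \<Longrightarrow> norm (op_power Z k) \<le> N ^ k"
proof (induction k)
  case 0
  then show ?case using norm_id_blinfun_le by simp
next
  case (Suc k)
  have "0 \<le> N" using Suc.prems norm_ge_zero[of Z] by linarith
  then have "norm Z * norm (op_power Z k) \<le> N * N ^ k" using Suc by (intro mult_mono) auto
  then show ?case using norm_blinfun_compose[of Z "op_power Z k"] by simp
qed

text \<open>Telescoping: every term in the difference of the powers contains one factor \<open>F\<close>, which can be moved to
  the end inside the trace. The bound does not depend on the rank of \<open>Z\<close>.\<close>

lemma trace_power_difference_bound:
  fixes Y Z F :: "'a::complex_normed_vector \<Rightarrow>\<^sub>L 'a"
  assumes Z: "Z \<in> bounded_ops" and F: "F \<in> finite_rank_ops" and Y: "Y = Z + \<zeta> *\<^sub>C F"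
    and c: "\<And>X. X \<in> bounded_ops \<Longrightarrow> cmod (op_trace (X o\<^sub>L F)) \<le> c * norm X" "0 \<le> c"
    and N: "norm Y \<le> N" "norm Z \<le> N" and X: "X \<in> bounded_ops"
  shows "cmod (op_trace (X o\<^sub>L (op_power Y k - op_power Z k))) \<le> real k * c * cmod \<zeta> * norm X * N ^ (k - 1)"
  using X
proof (induction k arbitrary: X)
  case 0
  then show ?case using op_trace_linear(3)[of 0 0 0] by simp
next
  case (Suc k)
  have N0: "0 \<le> N" using N(1) norm_ge_zero[of Y] by linarith
  have Fb: "F \<in> bounded_ops" using F by (rule finite_rank_ops_bounded)
  have Yb: "Y \<in> bounded_ops" unfolding Y using Z Fb by auto
  have zF: "\<zeta> *\<^sub>C F \<in> finite_rank_ops" using F by auto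
  have d: "op_power Y k - op_power Z k \<in> finite_rank_ops"
    unfolding Y by (rule op_power_finite_rank_difference[OF Z zF])
  have e: "(X o\<^sub>L (op_power Y (Suc k) - op_power Z (Suc k))) =
      ((X o\<^sub>L Y) o\<^sub>L (op_power Y k - op_power Z k)) + ((X o\<^sub>L (\<zeta> *\<^sub>C F)) o\<^sub>L op_power Z k)"
    unfolding Y by (simp add: compose_diff_right compose_diff_left compose_add_right compose_add_left compose_assoc)
  have "op_trace (X o\<^sub>L (op_power Y (Suc k) - op_power Z (Suc k))) =
      op_trace ((X o\<^sub>L Y) o\<^sub>L (op_power Y k - op_power Z k)) + op_trace ((X o\<^sub>L (\<zeta> *\<^sub>C F)) o\<^sub>L op_power Z k)"
    unfolding e using d zF Suc.prems Yb Z by (intro op_trace_linear(1)) auto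
  also have "op_trace ((X o\<^sub>L (\<zeta> *\<^sub>C F)) o\<^sub>L op_power Z k) = op_trace (op_power Z k o\<^sub>L (X o\<^sub>L (\<zeta> *\<^sub>C F)))"
    using zF Suc.prems Z by (intro det_id_minus_trace_commute(2)) auto
  also have "(op_power Z k o\<^sub>L (X o\<^sub>L (\<zeta> *\<^sub>C F))) = \<zeta> *\<^sub>C ((op_power Z k o\<^sub>L X) o\<^sub>L F)"
    using Suc.prems Z by (simp add: compose_scaleC_right compose_assoc)
  also have "op_trace \<dots> = \<zeta> * op_trace ((op_power Z k o\<^sub>L X) o\<^sub>L F)"
    using Suc.prems Z F by (intro op_trace_linear(3)[where G = 0]) auto
  finally have "cmod (op_trace (X o\<^sub>L (op_power Y (Suc k) - op_power Z (Suc k)))) \<le>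
      cmod (op_trace ((X o\<^sub>L Y) o\<^sub>L (op_power Y k - op_power Z k))) + cmod (\<zeta> * op_trace ((op_power Z k o\<^sub>L X) o\<^sub>L F))"
    by (simp only: norm_triangle_ineq)
  also have "cmod (op_trace ((X o\<^sub>L Y) o\<^sub>L (op_power Y k - op_power Z k))) \<le> real k * c * cmod \<zeta> * (norm X * N ^ k)"
  proof (cases k)
    case 0
    then show ?thesis using op_trace_linear(3)[of 0 0 0] by simp
  next
    case (Suc j)
    have "cmod (op_trace ((X o\<^sub>L Y) o\<^sub>L (op_power Y k - op_power Z k))) \<le> real k * c * cmod \<zeta> * norm (X o\<^sub>L Y) * N ^ (k - 1)"
      using Suc.IH Suc.prems Yb by auto
    also have "\<dots> \<le> real k * c * cmod \<zeta> * (norm X * N) * N ^ (k - 1)"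
      using c(2) N0 N(1) by (intro mult_right_mono mult_left_mono order_trans[OF norm_blinfun_compose]) auto
    finally show ?thesis using Suc by (simp add: mult_ac)
  qed
  also have "cmod (\<zeta> * op_trace ((op_power Z k o\<^sub>L X) o\<^sub>L F)) \<le> cmod \<zeta> * (c * (N ^ k * norm X))"
  proof -
    have "cmod (op_trace ((op_power Z k o\<^sub>L X) o\<^sub>L F)) \<le> c * norm (op_power Z k o\<^sub>L X)"
      using Suc.prems Z by (intro c(1)) auto
    also have "\<dots> \<le> c * (N ^ k * norm X)"
      using c(2) norm_op_power_le[OF N(2)]
      by (intro mult_left_mono order_trans[OF norm_blinfun_compose] mult_right_mono) auto
    finally show ?thesis by (simp add: norm_mult mult_left_mono)
  qed
  finally show ?case by (simp add: algebra_simps)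
qed

lemma op_power_scaleC: "F \<in> bounded_ops \<Longrightarrow> op_power (z *\<^sub>C F) k = z ^ k *\<^sub>C op_power F k"
  by (induction k) (simp_all add: compose_scaleC_left compose_scaleC_right mult.commute)

lemma det_p_eigenvalue_list:
  assumes F: "F \<in> finite_rank_ops" and ls: "eigenvalue_list F ls"
  shows "det_p_id_minus p (z *\<^sub>C F) = (\<Prod>l\<leftarrow>ls. primary (nat \<lceil>p\<rceil>) (z * l))"
proof -
  let ?n = "nat \<lceil>p\<rceil>"
  have tr: "op_trace (op_power (z *\<^sub>C F) k) = (\<Sum>l\<leftarrow>ls. (z * l) ^ k)" if "k > 0" for k
  proof -
    have "op_trace (op_power (z *\<^sub>C F) k) = z ^ k * op_trace (op_power F k)"
      unfolding op_power_scaleC[OF finite_rank_ops_bounded[OF F]]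
      by (rule op_trace_linear(3)[OF finite_rank_ops_power[OF F that] finite_rank_ops_intros(1)])
    also have "op_trace (op_power F k) = (\<Sum>l\<leftarrow>ls. l ^ k)" using ls that by (simp add: eigenvalue_list_def)
    finally show ?thesis by (simp add: power_mult_distrib sum_list_const_mult)
  qed
  have sw: "(\<Sum>k\<in>K. c k * (\<Sum>l\<leftarrow>ls. g k l)) = (\<Sum>l\<leftarrow>ls. \<Sum>k\<in>K. c k * g k l)" for K :: "nat set" and c :: "nat \<Rightarrow> complex" and g ls
    by (induction ls) (auto simp: algebra_simps sum.distrib)
  have "(\<Sum>k = 1..?n - 1. 1 / of_nat k * op_trace (op_power (z *\<^sub>C F) k)) =
      (\<Sum>k = 1..?n - 1. 1 / of_nat k * (\<Sum>l\<leftarrow>ls. (z * l) ^ k))"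
    by (intro sum.cong refl) (simp add: tr)
  also have "\<dots> = (\<Sum>l\<leftarrow>ls. \<Sum>k = 1..?n - 1. 1 / of_nat k * (z * l) ^ k)" by (rule sw)
  finally have t: "(\<Sum>k = 1..?n - 1. 1 / of_nat k * op_trace (op_power (z *\<^sub>C F) k)) =
      (\<Sum>l\<leftarrow>ls. \<Sum>k = 1..?n - 1. 1 / of_nat k * (z * l) ^ k)" .
  have "det_id_minus (z *\<^sub>C F) = (\<Prod>l\<leftarrow>ls. 1 - z * l)" using ls by (simp add: eigenvalue_list_def)
  then show ?thesis
    unfolding det_p_id_minus_def t exp_sum_list primary_def prod_list_mult by simp
qed

lemma eigenvalue_list_any:
  assumes F: "F \<in> finite_rank_ops" obtains ls where "eigenvalue_list F ls"
proof -
  have "range (blinfun_apply F) \<subseteq> lspan (range_basis F)" using range_basis_list(2)[OF F] by simp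
  from eigenvalue_list_exists[OF finite_rank_ops_bounded[OF F] range_basis_list(1)[OF F] this]
  show ?thesis using that by metis
qed

lemma det_p_pencil_holomorphic:
  assumes F: "F \<in> finite_rank_ops" and G: "G \<in> finite_rank_ops"
  shows "(\<lambda>\<zeta>. det_p_id_minus p (F + \<zeta> *\<^sub>C G)) holomorphic_on UNIV"
proof -
  obtain bs where bs: "basis_list bs"
    and r: "range (blinfun_apply F) \<subseteq> lspan bs" "range (blinfun_apply G) \<subseteq> lspan bs"
    using finite_rank_ops_basis[of "{F, G}"] F G
    by (metis empty_subsetI finite.intros insertI1 insertI2 insert_subset)
  have 1: "F + \<zeta> *\<^sub>C G \<in> bounded_ops" for \<zeta> using finite_rank_ops_bounded[OF F] finite_rank_ops_bounded[OF G] by auto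
  have 2: "range (blinfun_apply (F + \<zeta> *\<^sub>C G)) \<subseteq> lspan bs" for \<zeta>
    using r by (auto simp: blinfun.add_left image_subset_iff intro!: complex_vector.span_add complex_vector.span_scale)
  have 3: "\<exists>D. has_op_derivative (\<lambda>\<zeta>. F + \<zeta> *\<^sub>C G) D \<zeta> \<and> range (blinfun_apply D) \<subseteq> lspan bs" for \<zeta>
  proof (intro exI conjI)
    have "((\<lambda>\<zeta>. F + \<zeta> *\<^sub>C G) has_derivative (\<lambda>h. 0 + h *\<^sub>C G)) (at \<zeta>)"
      by (intro has_derivative_add has_derivative_const bounded_linear_imp_has_derivative
          bounded_bilinear.bounded_linear_left[OF bounded_bilinear_scaleC])
    then show "has_op_derivative (\<lambda>\<zeta>. F + \<zeta> *\<^sub>C G) G \<zeta>" by (simp add: has_op_derivative_def)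
  qed (rule r)
  have "(\<lambda>\<zeta>. det_id_minus (F + \<zeta> *\<^sub>C G)) holomorphic_on UNIV"
    by (rule holomorphic_det_trace(1)[OF bs open_UNIV 1 2 3])
  moreover have "(\<lambda>\<zeta>. op_trace (op_power (F + \<zeta> *\<^sub>C G) k)) holomorphic_on UNIV" if "k > 0" for k
    by (rule holomorphic_det_trace(2)[OF bs open_UNIV 1 2 3 that])
  ultimately show ?thesis unfolding det_p_id_minus_def by (auto intro!: holomorphic_intros)
qed

text \<open>With \<open>S\<close> the inverse of \<open>I - G\<close>, one has \<open>I - G - \<zeta> F = (I - \<zeta> F S)(I - G)\<close>, so the determinant is a
  polynomial in \<open>\<zeta>\<close> of degree at most the rank of \<open>F\<close>.\<close>

lemma det_rank_pencil:
  fixes F G :: "'a::complex_normed_vector \<Rightarrow>\<^sub>L 'a"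
  assumes F: "F \<in> finite_rank_ops" and G: "G \<in> finite_rank_ops" and d: "det_id_minus G \<noteq> 0"
  obtains ms where "length ms = length (range_basis F)"
    "\<And>\<zeta>. det_id_minus (G + \<zeta> *\<^sub>C F) = det_id_minus G * (\<Prod>m\<leftarrow>ms. 1 - \<zeta> * m)"
proof -
  note b = finite_rank_ops_bounded[OF F] finite_rank_ops_bounded[OF G]
  have rG: "range (blinfun_apply G) \<subseteq> lspan (range_basis G)" using range_basis_list(2)[OF G] by simp
  obtain S where S: "is_inverse_op (id_blinfun - G) S"
    using inverse_id_minus_finite_rank[OF range_basis_list(1)[OF G] norm_ge_zero[of G]] b(2) rG d by (metis order_refl)
  then have Sb: "S \<in> bounded_ops" and SG: "(S o\<^sub>L (id_blinfun - G)) = id_blinfun" by (auto simp: is_inverse_op_def)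
  have FS: "F o\<^sub>L S \<in> bounded_ops" "F o\<^sub>L S \<in> finite_rank_ops" using b Sb F by auto
  have r: "range (blinfun_apply (F o\<^sub>L S)) \<subseteq> lspan (range_basis F)" using range_basis_list(2)[OF F] by auto
  obtain ms where ms: "eigenvalue_list (F o\<^sub>L S) ms" "length ms = length (range_basis F)"
    using eigenvalue_list_exists[OF FS(1) range_basis_list(1)[OF F] r] by metis
  show ?thesis
  proof
    show "length ms = length (range_basis F)" by (rule ms(2))
    fix \<zeta>
    have "((F o\<^sub>L S) o\<^sub>L (id_blinfun - G)) = F" by (simp add: compose_assoc SG)
    then have "(\<zeta> *\<^sub>C (F o\<^sub>L S)) o\<^sub>L G = \<zeta> *\<^sub>C (F o\<^sub>L S) - \<zeta> *\<^sub>C F"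
      by (simp add: compose_diff_right compose_scaleC_left algebra_simps
          flip: complex_vector.scale_right_diff_distrib)
    then have e: "\<zeta> *\<^sub>C (F o\<^sub>L S) + G - ((\<zeta> *\<^sub>C (F o\<^sub>L S)) o\<^sub>L G) = G + \<zeta> *\<^sub>C F" by simp
    have "det_id_minus (G + \<zeta> *\<^sub>C F) = det_id_minus (\<zeta> *\<^sub>C (F o\<^sub>L S)) * det_id_minus G"
      unfolding e[symmetric] using FS G by (intro det_id_minus_mult) auto
    also have "det_id_minus (\<zeta> *\<^sub>C (F o\<^sub>L S)) = (\<Prod>m\<leftarrow>ms. 1 - \<zeta> * m)"
      using ms(1) by (simp add: eigenvalue_list_def)
    finally show "det_id_minus (G + \<zeta> *\<^sub>C F) = det_id_minus G * (\<Prod>m\<leftarrow>ms. 1 - \<zeta> * m)" by simp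
  qed
qed

section \<open>Growth of determinants near an element of the ideal\<close>

text \<open>The sign of \<open>\<gamma>\<close> is part of the setting because a negative \<open>\<gamma>\<close> forces the ideal to be zero.\<close>

locale determinant_ideal = lp_ideal p \<I> qn \<gamma>
  for p :: real and \<I> :: "('a::complex_banach \<Rightarrow>\<^sub>L 'a) set" and qn :: "('a \<Rightarrow>\<^sub>L 'a) \<Rightarrow> real"
    and \<gamma> :: real +
  fixes \<Gamma> :: real
  assumes p: "0 < p" and \<Gamma>: "0 < \<Gamma>" and \<gamma>: "0 \<le> \<gamma>"
    and det_bound: "(F :: 'a \<Rightarrow>\<^sub>L 'a) \<in> finite_rank_ops \<Longrightarrow>
      cmod (det_p_id_minus p F) \<le> exp (\<Gamma> * eigenvalue_power_sum p F)"
begin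

definition q :: real where
  "q = (SOME q. 1 \<le> q \<and> (\<forall>x\<in>\<I>. \<forall>y\<in>\<I>. qn (x + y) \<le> q * (qn x + qn y)))"

lemma q: "1 \<le> q" "x \<in> \<I> \<Longrightarrow> y \<in> \<I> \<Longrightarrow> qn (x + y) \<le> q * (qn x + qn y)"
proof -
  have "1 \<le> q \<and> (\<forall>x\<in>\<I>. \<forall>y\<in>\<I>. qn (x + y) \<le> q * (qn x + qn y))"
    unfolding q_def using quasi_triangle by (rule someI_ex)
  then show "1 \<le> q" "x \<in> \<I> \<Longrightarrow> y \<in> \<I> \<Longrightarrow> qn (x + y) \<le> q * (qn x + qn y)" by auto
qed

lemma ideal_closed:
  "x \<in> \<I> \<Longrightarrow> y \<in> \<I> \<Longrightarrow> x + y \<in> \<I>" "x \<in> \<I> \<Longrightarrow> c *\<^sub>C x \<in> \<I>" "x \<in> \<I> \<Longrightarrow> y \<in> \<I> \<Longrightarrow> x - y \<in> \<I>"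
  "x \<in> \<I> \<Longrightarrow> x \<in> bounded_ops" "F \<in> finite_rank_ops \<Longrightarrow> F \<in> \<I>"
  "x \<in> \<I> \<Longrightarrow> B \<in> bounded_ops \<Longrightarrow> (x o\<^sub>L B) \<in> \<I>" "x \<in> \<I> \<Longrightarrow> B \<in> bounded_ops \<Longrightarrow> (B o\<^sub>L x) \<in> \<I>"
  using subspace subset_bounded_ops finite_rank_subset ideal[of x id_blinfun B] ideal[of x B id_blinfun]
  by (auto intro: complex_vector.subspace_add complex_vector.subspace_scale complex_vector.subspace_diff)

lemma qn_minus: "x \<in> \<I> \<Longrightarrow> qn (- x) = qn x"
  using homogeneous[of x "-1"] by simp

lemma qn_minus_commute: "x \<in> \<I> \<Longrightarrow> y \<in> \<I> \<Longrightarrow> qn (x - y) = qn (y - x)"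
  using qn_minus[of "y - x"] ideal_closed(3)[of y x] by simp

lemma qn_triangle_diff:
  assumes "x \<in> \<I>" "y \<in> \<I>" "w \<in> \<I>" shows "qn (x - w) \<le> q * (qn (x - y) + qn (y - w))"
  using q(2)[of "x - y" "y - w"] ideal_closed(3) assms by simp

lemma qn_compose:
  assumes x: "x \<in> \<I>" and B: "B \<in> bounded_ops"
  shows "qn (x o\<^sub>L B) \<le> qn x * norm B" "qn (B o\<^sub>L x) \<le> norm B * qn x"
proof -
  have "qn (id_blinfun o\<^sub>L x o\<^sub>L B) \<le> norm (id_blinfun :: 'a \<Rightarrow>\<^sub>L 'a) * qn x * norm B"
    using x B by (intro ideal_norm) auto
  also have "\<dots> \<le> 1 * qn x * norm B"
    using nonneg[OF x] norm_id_blinfun_le by (intro mult_right_mono) auto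
  finally show "qn (x o\<^sub>L B) \<le> qn x * norm B" by simp
  have "qn (B o\<^sub>L x o\<^sub>L id_blinfun) \<le> norm B * qn x * norm (id_blinfun :: 'a \<Rightarrow>\<^sub>L 'a)"
    using x B by (intro ideal_norm) auto
  also have "\<dots> \<le> norm B * qn x * 1"
    using nonneg[OF x] norm_id_blinfun_le by (intro mult_left_mono) auto
  finally show "qn (B o\<^sub>L x) \<le> norm B * qn x" by simp
qed

text \<open>The balls of a quasi-norm need not be open, but the points around which some ball is contained in a given
  ball form an open set.\<close>

lemma finite_rank_approximation:
  assumes K: "K \<in> \<I>" and e: "0 < e"
  obtains F where "F \<in> finite_rank_ops" "qn (F - K) < e"
proof -
  obtain n where n: "1 / real (Suc n) < e" using e reals_Archimedean[of e] by (auto simp: inverse_eq_divide)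
  let ?ball = "\<lambda>x m. {y \<in> \<I>. qn (y - x) \<le> 1 / real (Suc m)}"
  define U where "U = {y \<in> \<I>. \<exists>m. ?ball y m \<subseteq> ?ball K n}"
  have zero: "qn (x - x) = 0" if "x \<in> \<I>" for x
    using eq_zero_iff[of "x - x"] ideal_closed(3)[OF that that] by simp
  have "openin (quasi_norm_topology \<I> qn) U"
    unfolding openin_quasi_norm_topology
  proof (intro conjI ballI)
    fix y assume "y \<in> U"
    then obtain m where y: "y \<in> \<I>" and m: "?ball y m \<subseteq> ?ball K n" by (auto simp: U_def)
    obtain k where k: "1 / real (Suc k) < (1 / real (Suc m)) / (2 * q)"
      using reals_Archimedean[of "(1 / real (Suc m)) / (2 * q)"] q(1) by (auto simp: inverse_eq_divide)
    have "w \<in> U" if w: "w \<in> ?ball y k" for w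
    proof -
      have "?ball w k \<subseteq> ?ball y m"
      proof
        fix v assume v: "v \<in> ?ball w k"
        have "qn (v - y) \<le> q * (qn (v - w) + qn (w - y))" using v w y by (intro qn_triangle_diff) auto
        also have "\<dots> \<le> q * (1 / real (Suc k) + 1 / real (Suc k))"
          using v w q(1) by (intro mult_left_mono add_mono) auto
        also have "\<dots> \<le> q * (2 * ((1 / real (Suc m)) / (2 * q)))"
        proof (rule mult_left_mono)
          show "1 / real (Suc k) + 1 / real (Suc k) \<le> 2 * ((1 / real (Suc m)) / (2 * q))" using k by linarith
        qed (use q(1) in simp)
        also have "\<dots> = 1 / real (Suc m)" using q(1) by simp
        finally show "v \<in> ?ball y m" using v by auto
      qed
      then show ?thesis using m w by (auto simp: U_def)
    qed
    then show "\<exists>n. ?ball y n \<subseteq> U" by blast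
  qed (auto simp: U_def)
  moreover have "K \<in> U" using K by (auto simp: U_def)
  moreover have "K \<in> (quasi_norm_topology \<I> qn) closure_of finite_rank_ops" using K finite_rank_dense by simp
  ultimately obtain F where F: "F \<in> finite_rank_ops" "F \<in> U" unfolding in_closure_of by blast
  then obtain m where "F \<in> \<I>" "?ball F m \<subseteq> ?ball K n" by (auto simp: U_def)
  moreover have "F \<in> ?ball F m" using \<open>F \<in> \<I>\<close> zero by simp
  ultimately have "qn (F - K) \<le> 1 / real (Suc n)" by blast
  then show ?thesis using that[OF F(1)] n by linarith
qed

lemma power_sum_le:
  assumes L: "L \<in> \<I>"
  shows "eigenvalue_power_sum p L \<le> (\<gamma> * qn L) powr p"
proof -
  have "0 \<le> eigenvalue_power_sum p L" unfolding eigenvalue_power_sum_def by (intro infsum_nonneg) auto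
  then have "eigenvalue_power_sum p L = (eigenvalue_power_sum p L powr (1 / p)) powr p"
    using p by (simp add: powr_powr)
  also have "\<dots> \<le> (\<gamma> * qn L) powr p"
    using eigenvalue_bound[OF L] p by (intro powr_mono2) auto
  finally show ?thesis .
qed

text \<open>The exponent in the determinant bound for an operator of quasi-norm \<open>x\<close>.\<close>

definition \<Phi> :: "real \<Rightarrow> real" where "\<Phi> x = \<Gamma> * (\<gamma> * x) powr p"

lemma \<Phi>_mono: "0 \<le> x \<Longrightarrow> x \<le> y \<Longrightarrow> \<Phi> x \<le> \<Phi> y"
  unfolding \<Phi>_def using \<Gamma> \<gamma> p by (intro mult_left_mono powr_mono2) (auto intro: mult_left_mono)

lemma \<Phi>_nonneg: "0 \<le> \<Phi> x" unfolding \<Phi>_def using \<Gamma> by simp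

lemma det_p_bound:
  assumes F: "F \<in> finite_rank_ops"
  shows "cmod (det_p_id_minus p F) \<le> exp (\<Phi> (qn F))"
proof -
  have "\<Gamma> * eigenvalue_power_sum p F \<le> \<Phi> (qn F)"
    unfolding \<Phi>_def using power_sum_le[OF ideal_closed(5)[OF F]] \<Gamma> by (intro mult_left_mono) auto
  then show ?thesis using det_bound[OF F] by (meson exp_le_cancel_iff order_trans)
qed

lemma \<Phi>_sum:
  assumes "0 \<le> x" "0 \<le> y" shows "\<Phi> (q * (x + y)) \<le> \<Phi> (2 * q * x) + \<Phi> (2 * q * y)"
proof (cases "x \<le> y")
  case True
  then have "q * (x + y) \<le> q * (2 * y)" using q(1) by (intro mult_left_mono) auto
  then have "\<Phi> (q * (x + y)) \<le> \<Phi> (2 * q * y)" using q(1) assms by (intro \<Phi>_mono) (auto simp: mult_ac)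
  then show ?thesis using \<Phi>_nonneg[of "2 * q * x"] by linarith
next
  case False
  then have "q * (x + y) \<le> q * (2 * x)" using q(1) by (intro mult_left_mono) auto
  then have "\<Phi> (q * (x + y)) \<le> \<Phi> (2 * q * x)" using q(1) assms by (intro \<Phi>_mono) (auto simp: mult_ac)
  then show ?thesis using \<Phi>_nonneg[of "2 * q * y"] by linarith
qed

lemma \<Phi>_scale: "0 \<le> x \<Longrightarrow> 0 \<le> y \<Longrightarrow> \<Phi> (x * y) = x powr p * \<Phi> y"
  unfolding \<Phi>_def using \<gamma> by (simp add: powr_mult mult_ac)

lemma ceiling_p: "1 \<le> nat \<lceil>p\<rceil>" "p \<le> real (nat \<lceil>p\<rceil>)" "real (nat \<lceil>p\<rceil> - 1) < p"
proof -
  show "1 \<le> nat \<lceil>p\<rceil>" "p \<le> real (nat \<lceil>p\<rceil>)" using p by linarith+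
  then show "real (nat \<lceil>p\<rceil> - 1) < p" using p by linarith
qed

end

text \<open>Lower powers are absorbed into an arbitrarily small multiple of the highest one.\<close>

lemma powr_dominates:
  fixes D s p e :: real
  assumes "0 \<le> D" "s < p" "0 \<le> s" "0 < e"
  obtains C where "0 \<le> C" "\<And>x. 1 \<le> x \<Longrightarrow> D * x powr s \<le> e * x powr p + C"
proof -
  define x0 where "x0 = (D / e + 1) powr (1 / (p - s))"
  have x0: "x0 \<ge> 1" unfolding x0_def using assms by (intro ge_one_powr_ge_zero) auto
  show ?thesis
  proof
    show "0 \<le> D * x0 powr s" using assms by simp
    fix x :: real assume x: "1 \<le> x"
    show "D * x powr s \<le> e * x powr p + D * x0 powr s"
    proof (cases "x \<le> x0")
      case True
      then have "D * x powr s \<le> D * x0 powr s" using x assms by (intro mult_left_mono powr_mono2) auto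
      moreover have "0 \<le> e * x powr p" using assms by simp
      ultimately show ?thesis by linarith
    next
      case False
      have "D / e + 1 = x0 powr (p - s)" unfolding x0_def using assms by (simp add: powr_powr add_nonneg_pos)
      also have "\<dots> \<le> x powr (p - s)" using False x0 assms by (intro powr_mono2) auto
      finally have "D \<le> e * x powr (p - s)" using assms by (simp add: field_simps)
      then have "D * x powr s \<le> e * x powr (p - s) * x powr s" by (intro mult_right_mono) auto
      also have "\<dots> = e * x powr p" using x by (simp flip: powr_add)
      finally show ?thesis using assms by (simp add: add_increasing2)
    qed
  qed
qed

context determinant_ideal
begin

text \<open>For \<open>\<zeta>\<close> on the unit circle the operator \<open>z G + \<zeta> F\<close> has quasi-norm at most \<open>q (|z| g + qn F)\<close>, with the small
  coefficient \<open>g\<close> in front of \<open>|z|\<close>. The determinant is a polynomial in \<open>\<zeta>\<close> whose degree is bounded in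
  terms of \<open>F\<close>, so the passage to \<open>\<zeta> = z\<close> costs only a power of \<open>|z|\<close>; the exponential of the traces changes
  by a factor of lower order.\<close>

lemma det_pencil_generic_bound:
  fixes F G :: "'a \<Rightarrow>\<^sub>L 'a"
  assumes F: "F \<in> finite_rank_ops" and G: "G \<in> finite_rank_ops" and g: "qn G \<le> g"
    and c: "\<And>X. X \<in> bounded_ops \<Longrightarrow> cmod (op_trace (X o\<^sub>L F)) \<le> c * norm X" "0 \<le> c"
    and z: "1 \<le> cmod z" and d: "det_id_minus (z *\<^sub>C G) \<noteq> 0"
  shows "cmod (det_p_id_minus p (z *\<^sub>C (G + F))) \<le>
    cmod z ^ length (range_basis F) * exp (cmod z powr p * \<Phi> (2 * q * g) + \<Phi> (2 * q * qn F)
      + 2 * (real (nat \<lceil>p\<rceil>) * c * (1 + g + norm F) ^ nat \<lceil>p\<rceil>) * cmod z powr real (nat \<lceil>p\<rceil> - 1))"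
proof -
  let ?n = "nat \<lceil>p\<rceil>"
  let ?Z = "z *\<^sub>C G"
  note Fb = finite_rank_ops_bounded[OF F] and Gb = finite_rank_ops_bounded[OF G]
  have g0: "0 \<le> g" using nonneg[OF ideal_closed(5)[OF G]] g by linarith
  have Zf: "?Z \<in> finite_rank_ops" using G by auto
  note Zb = finite_rank_ops_bounded[OF Zf]
  define N0 where "N0 = 1 + g + norm F"
  have N0: "1 \<le> N0" using g0 by (simp add: N0_def)
  define t where "t \<zeta> = (\<Sum>k = 1..?n - 1. 1 / of_nat k * op_trace (op_power (?Z + \<zeta> *\<^sub>C F) k))" for \<zeta>
  define D where "D = real ?n * c * N0 ^ ?n"
  have D0: "0 \<le> D" using c(2) N0 by (simp add: D_def)
  have td: "cmod (t \<zeta> - t 0) \<le> D * cmod z powr real (?n - 1)" if \<zeta>: "cmod \<zeta> \<le> cmod z" for \<zeta>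
  proof -
    let ?Y = "?Z + \<zeta> *\<^sub>C F"
    have "norm G \<le> g" using norm_le[OF ideal_closed(5)[OF G]] g by linarith
    then have nZ: "norm ?Z \<le> cmod z * g" by (simp add: norm_scaleC mult_left_mono)
    then have nZ': "norm ?Z \<le> cmod z * N0"
      by (rule order_trans) (auto simp: N0_def intro!: mult_left_mono)
    have "norm ?Y \<le> cmod z * g + cmod \<zeta> * norm F"
      using norm_triangle_ineq[of ?Z "\<zeta> *\<^sub>C F"] nZ by (simp add: norm_scaleC)
    also have "\<dots> \<le> cmod z * g + cmod z * norm F" using \<zeta> by (intro add_left_mono mult_right_mono) auto
    also have "\<dots> \<le> cmod z * N0" by (simp add: N0_def algebra_simps)
    finally have nY: "norm ?Y \<le> cmod z * N0" .
    have Yf: "?Y \<in> finite_rank_ops" using Zf F by auto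
    have "cmod (op_trace (op_power ?Y k) - op_trace (op_power ?Z k)) \<le>
        real k * (c * (N0 ^ ?n * cmod z powr real (?n - 1)))" if k: "k \<in> {1..?n - 1}" for k
    proof -
      have k0: "0 < k" "k \<le> ?n - 1" using k by auto
      have "op_trace (op_power ?Y k) - op_trace (op_power ?Z k) = op_trace (op_power ?Y k - op_power ?Z k)"
        using finite_rank_ops_power[OF Yf k0(1)] finite_rank_ops_power[OF Zf k0(1)] by (simp add: op_trace_linear(2))
      also have "\<dots> = op_trace (id_blinfun o\<^sub>L (op_power ?Y k - op_power ?Z k))" by simp
      finally have "cmod (op_trace (op_power ?Y k) - op_trace (op_power ?Z k)) \<le>
          real k * c * cmod \<zeta> * norm (id_blinfun :: 'a \<Rightarrow>\<^sub>L 'a) * (cmod z * N0) ^ (k - 1)"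
        using trace_power_difference_bound[OF Zb F refl c nY nZ', of id_blinfun k] by simp
      also have "\<dots> \<le> real k * c * cmod z * 1 * (cmod z * N0) ^ (k - 1)"
        using \<zeta> c(2) norm_id_blinfun_le N0 by (intro mult_mono mult_nonneg_nonneg) auto
      also have "\<dots> = real k * (c * (N0 ^ (k - 1) * cmod z ^ k))"
        using k0(1) by (cases k) (auto simp: power_mult_distrib mult_ac)
      also have "\<dots> \<le> real k * (c * (N0 ^ ?n * cmod z ^ (?n - 1)))"
        using k0 c(2) N0 z by (intro mult_left_mono mult_mono power_increasing) auto
      also have "cmod z ^ (?n - 1) = cmod z powr real (?n - 1)" using z by (subst powr_realpow) auto
      finally show ?thesis .
    qed
    note kb = this
    have "t \<zeta> - t 0 = (\<Sum>k = 1..?n - 1. 1 / of_nat k * (op_trace (op_power ?Y k) - op_trace (op_power ?Z k)))"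
      by (simp add: t_def sum_subtractf right_diff_distrib)
    then have "cmod (t \<zeta> - t 0) \<le> (\<Sum>k = 1..?n - 1. cmod (1 / of_nat k * (op_trace (op_power ?Y k) - op_trace (op_power ?Z k))))"
      by (simp only: norm_sum)
    also have "\<dots> \<le> (\<Sum>k = 1..?n - 1. c * (N0 ^ ?n * cmod z powr real (?n - 1)))"
    proof (rule sum_mono)
      fix k assume k: "k \<in> {1..?n - 1}"
      then have "cmod (1 / of_nat k * (op_trace (op_power ?Y k) - op_trace (op_power ?Z k))) =
          cmod (op_trace (op_power ?Y k) - op_trace (op_power ?Z k)) / real k"
        by (simp add: norm_mult norm_divide)
      also have "\<dots> \<le> (real k * (c * (N0 ^ ?n * cmod z powr real (?n - 1)))) / real k"
        by (intro divide_right_mono kb[OF k]) simp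
      finally show "cmod (1 / of_nat k * (op_trace (op_power ?Y k) - op_trace (op_power ?Z k))) \<le> c * (N0 ^ ?n * cmod z powr real (?n - 1))"
        using k by simp
    qed
    also have "\<dots> \<le> real ?n * (c * (N0 ^ ?n * cmod z powr real (?n - 1)))"
      using c(2) N0 by (simp only: sum_constant) (intro mult_right_mono; simp)
    finally show ?thesis by (simp add: D_def mult_ac)
  qed
  obtain ms where ms: "length ms = length (range_basis F)"
    "\<And>\<zeta>. det_id_minus (?Z + \<zeta> *\<^sub>C F) = det_id_minus ?Z * (\<Prod>m\<leftarrow>ms. 1 - \<zeta> * m)"
    using det_rank_pencil[OF F Zf d] by metis
  have detp: "det_p_id_minus p (?Z + \<zeta> *\<^sub>C F) = det_id_minus ?Z * (\<Prod>m\<leftarrow>ms. 1 - \<zeta> * m) * exp (t \<zeta>)" for \<zeta>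
    by (simp add: det_p_id_minus_def ms(2) t_def)
  let ?B = "exp (cmod z powr p * \<Phi> (2 * q * g) + \<Phi> (2 * q * qn F) + D * cmod z powr real (?n - 1))"
  have "cmod ((det_id_minus ?Z * exp (t 0)) * (\<Prod>m\<leftarrow>ms. 1 - \<zeta> * m)) \<le> ?B" if \<zeta>: "cmod \<zeta> = 1" for \<zeta>
  proof -
    have "qn (?Z + \<zeta> *\<^sub>C F) \<le> q * (qn ?Z + qn (\<zeta> *\<^sub>C F))"
      using Zf F by (intro q(2) ideal_closed) auto
    also have "\<dots> \<le> q * (cmod z * g + qn F)"
      using g q(1) \<zeta> ideal_closed(5)[OF F] ideal_closed(5)[OF G]
      by (intro mult_left_mono) (auto simp: homogeneous mult_left_mono)
    finally have "\<Phi> (qn (?Z + \<zeta> *\<^sub>C F)) \<le> \<Phi> (q * (cmod z * g + qn F))"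
      using Zf F by (intro \<Phi>_mono nonneg ideal_closed) auto
    also have "\<dots> \<le> \<Phi> (2 * q * (cmod z * g)) + \<Phi> (2 * q * qn F)"
      using g0 nonneg[OF ideal_closed(5)[OF F]] by (intro \<Phi>_sum) auto
    also have "\<Phi> (2 * q * (cmod z * g)) = cmod z powr p * \<Phi> (2 * q * g)"
      using \<Phi>_scale[of "cmod z" "2 * q * g"] q(1) g0 by (simp add: mult_ac)
    finally have 1: "\<Phi> (qn (?Z + \<zeta> *\<^sub>C F)) \<le> cmod z powr p * \<Phi> (2 * q * g) + \<Phi> (2 * q * qn F)" .
    have Yf: "?Z + \<zeta> *\<^sub>C F \<in> finite_rank_ops" using Zf F by auto
    have "(det_id_minus ?Z * exp (t 0)) * (\<Prod>m\<leftarrow>ms. 1 - \<zeta> * m) = det_p_id_minus p (?Z + \<zeta> *\<^sub>C F) * exp (t 0 - t \<zeta>)"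
      by (simp add: detp exp_diff)
    then have "cmod ((det_id_minus ?Z * exp (t 0)) * (\<Prod>m\<leftarrow>ms. 1 - \<zeta> * m)) =
        cmod (det_p_id_minus p (?Z + \<zeta> *\<^sub>C F)) * exp (Re (t 0 - t \<zeta>))" by (simp add: norm_mult)
    also have "\<dots> \<le> exp (\<Phi> (qn (?Z + \<zeta> *\<^sub>C F))) * exp (D * cmod z powr real (?n - 1))"
    proof (intro mult_mono det_p_bound Yf)
      have "Re (t 0 - t \<zeta>) \<le> cmod (t \<zeta> - t 0)" using complex_Re_le_cmod[of "t 0 - t \<zeta>"] by (simp add: norm_minus_commute)
      also have "\<dots> \<le> D * cmod z powr real (?n - 1)" using \<zeta> z by (intro td) simp
      finally show "exp (Re (t 0 - t \<zeta>)) \<le> exp (D * cmod z powr real (?n - 1))" by simp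
    qed auto
    also have "\<dots> \<le> ?B" using 1 by (simp flip: exp_add)
    finally show ?thesis .
  qed
  from reverse_polynomial_bound[of "det_id_minus ?Z * exp (t 0)" ms, OF this z]
  have P: "cmod ((det_id_minus ?Z * exp (t 0)) * (\<Prod>m\<leftarrow>ms. 1 - z * m)) \<le> cmod z ^ length ms * ?B" .
  have "z *\<^sub>C (G + F) = ?Z + z *\<^sub>C F" by (rule complex_vector.scale_right_distrib)
  then have "det_p_id_minus p (z *\<^sub>C (G + F)) = (det_id_minus ?Z * exp (t 0)) * (\<Prod>m\<leftarrow>ms. 1 - z * m) * exp (t z - t 0)"
    by (simp add: detp exp_diff)
  then have "cmod (det_p_id_minus p (z *\<^sub>C (G + F))) =
      cmod ((det_id_minus ?Z * exp (t 0)) * (\<Prod>m\<leftarrow>ms. 1 - z * m)) * exp (Re (t z - t 0))"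
    by (simp only: norm_mult norm_exp_eq_Re)
  also have "\<dots> \<le> (cmod z ^ length ms * ?B) * exp (D * cmod z powr real (?n - 1))"
  proof (intro mult_mono P)
    have "Re (t z - t 0) \<le> cmod (t z - t 0)" by (rule complex_Re_le_cmod)
    also have "\<dots> \<le> D * cmod z powr real (?n - 1)" by (intro td) simp
    finally show "exp (Re (t z - t 0)) \<le> exp (D * cmod z powr real (?n - 1))" by simp
  qed auto
  also have "\<dots> = cmod z ^ length ms * (exp (cmod z powr p * \<Phi> (2 * q * g) + \<Phi> (2 * q * qn F) + D * cmod z powr real (?n - 1)
      + D * cmod z powr real (?n - 1)))" by (simp only: exp_add mult.assoc)
  finally show ?thesis by (simp add: ms(1) D_def N0_def algebra_simps)
qed

text \<open>Near an element of the ideal, determinants of finite rank operators have growth of minimal type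
  with respect to the order \<open>p\<close>, uniformly: write \<open>L' = G + F\<close> with \<open>F\<close> of fixed finite rank and \<open>G\<close> of small
  quasi-norm.\<close>

lemma det_p_growth:
  assumes L: "L \<in> \<I>" and \<delta>: "0 < \<delta>"
  obtains C \<kappa> where "0 \<le> C" "0 < \<kappa>"
    "\<And>L' z. L' \<in> finite_rank_ops \<Longrightarrow> qn (L' - L) < \<kappa> \<Longrightarrow>
      cmod (det_p_id_minus p (z *\<^sub>C L')) \<le> exp (\<delta> * cmod z powr p + C)"
proof -
  let ?n = "nat \<lceil>p\<rceil>"
  \<comment> \<open>This bound for the quasi-norm of the small part makes its coefficient of \<open>|z|^p\<close> at most \<open>\<delta> / 2\<close>.\<close>
  define g where "g = (\<delta> / (2 * (\<Phi> (2 * q) + 1))) powr (1 / p)"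
  have g: "0 < g" using \<delta> \<Phi>_nonneg[of "2 * q"] by (simp add: g_def)
  have gp: "\<Phi> (2 * q * g) \<le> \<delta> / 2"
  proof -
    have "\<Phi> (2 * q * g) = g powr p * \<Phi> (2 * q)" using \<Phi>_scale[of g "2 * q"] g q(1) by (simp add: mult_ac)
    also have "g powr p = \<delta> / (2 * (\<Phi> (2 * q) + 1))"
      using \<delta> \<Phi>_nonneg[of "2 * q"] p by (simp add: g_def powr_powr)
    finally have e: "\<Phi> (2 * q * g) = \<delta> / (2 * (\<Phi> (2 * q) + 1)) * \<Phi> (2 * q)" .
    have "\<delta> / (2 * (u + 1)) * u \<le> \<delta> / 2" if "0 \<le> u" for u using \<delta> that by (simp add: field_simps)
    then show ?thesis unfolding e using \<Phi>_nonneg by blast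
  qed
  define \<kappa> where "\<kappa> = g / (2 * q)"
  have \<kappa>: "0 < \<kappa>" using g q(1) by (simp add: \<kappa>_def)
  obtain F where F: "F \<in> finite_rank_ops" "qn (F - L) < \<kappa>" using finite_rank_approximation[OF L \<kappa>] by blast
  obtain c where c: "0 \<le> c" "\<And>X. X \<in> bounded_ops \<Longrightarrow> cmod (op_trace (X o\<^sub>L F)) \<le> c * norm X"
    using trace_compose_bound[OF F(1)] by metis
  define m where "m = length (range_basis F)"
  define D where "D = 2 * (real ?n * c * (1 + g + norm F) ^ ?n)"
  have "0 \<le> D" using c(1) g by (simp add: D_def)
  then obtain Ca where Ca: "0 \<le> Ca" "\<And>x. 1 \<le> x \<Longrightarrow> D * x powr real (?n - 1) \<le> \<delta> / 4 * x powr p + Ca"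
    using powr_dominates[of D "real (?n - 1)" p "\<delta> / 4"] ceiling_p(3) \<delta> by auto
  obtain Cb where Cb: "0 \<le> Cb" "\<And>x. 1 \<le> x \<Longrightarrow> real m / (p / 2) * x powr (p / 2) \<le> \<delta> / 4 * x powr p + Cb"
    using powr_dominates[of "real m / (p / 2)" "p / 2" p "\<delta> / 4"] p \<delta> by auto
  define C where "C = Ca + Cb + \<Phi> (2 * q * qn F) + \<Phi> (q * (\<kappa> + qn L))"
  show ?thesis
  proof
    show "0 \<le> C" using Ca(1) Cb(1) \<Phi>_nonneg by (simp add: C_def add_nonneg_nonneg)
    show "0 < \<kappa>" by (rule \<kappa>)
    fix L' z assume L': "L' \<in> finite_rank_ops" "qn (L' - L) < \<kappa>"
    define G where "G = L' - F"
    have G: "G \<in> finite_rank_ops" using L' F by (auto simp: G_def)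
    have GF: "L' = G + F" by (simp add: G_def)
    note I = ideal_closed(5)[OF L'(1)] ideal_closed(5)[OF F(1)] L
    have "qn G \<le> q * (qn (L' - L) + qn (L - F))" unfolding G_def using I by (intro qn_triangle_diff) auto
    also have "\<dots> \<le> q * (\<kappa> + \<kappa>)"
      using L'(2) F(2) q(1) qn_minus_commute[of L F] I by (intro mult_left_mono add_mono) auto
    also have "\<dots> = g" using q(1) by (simp add: \<kappa>_def)
    finally have qG: "qn G \<le> g" .
    have generic: "cmod (det_p_id_minus p (z *\<^sub>C L')) \<le> exp (\<delta> * cmod z powr p + C)"
      if d: "det_id_minus (z *\<^sub>C G) \<noteq> 0" for z
    proof (cases "1 \<le> cmod z")
      case True
      let ?x = "cmod z"
      have "cmod (det_p_id_minus p (z *\<^sub>C (G + F))) \<le> ?x ^ m * exp (?x powr p * \<Phi> (2 * q * g) + \<Phi> (2 * q * qn F) + D * ?x powr real (?n - 1))"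
        unfolding m_def D_def by (rule det_pencil_generic_bound[OF F(1) G qG c(2,1) True d])
      also have "?x ^ m = exp (real m * ln ?x)"
      proof -
        have "0 < ?x" using True by linarith
        then have "exp (ln ?x) = ?x" by (rule exp_ln)
        then show ?thesis by (simp only: exp_of_nat_mult)
      qed
      also have "exp (real m * ln ?x) * exp (?x powr p * \<Phi> (2 * q * g) + \<Phi> (2 * q * qn F) + D * ?x powr real (?n - 1))
        \<le> exp (\<delta> * ?x powr p + C)"
      proof -
        have "ln ?x \<le> ?x powr (p / 2) / (p / 2)" using True p by (intro ln_powr_bound) auto
        then have "real m * ln ?x \<le> real m * (?x powr (p / 2) / (p / 2))" by (intro mult_left_mono) auto
        also have "\<dots> \<le> \<delta> / 4 * ?x powr p + Cb" using Cb(2)[OF True] by (simp add: mult.commute)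
        finally have 1: "real m * ln ?x \<le> \<delta> / 4 * ?x powr p + Cb" .
        have 2: "?x powr p * \<Phi> (2 * q * g) \<le> ?x powr p * (\<delta> / 2)" using gp by (intro mult_left_mono) auto
        have "real m * ln ?x + (?x powr p * \<Phi> (2 * q * g) + \<Phi> (2 * q * qn F) + D * ?x powr real (?n - 1)) \<le> \<delta> * ?x powr p + C"
          using 1 2 Ca(2)[OF True] \<Phi>_nonneg[of "q * (\<kappa> + qn L)"] by (simp add: C_def algebra_simps)
        then show ?thesis by (simp flip: exp_add)
      qed
      finally show ?thesis unfolding GF .
    next
      case False
      have "qn L' = qn ((L' - L) + L)" by simp
      also have "\<dots> \<le> q * (qn (L' - L) + qn L)" by (rule q(2)[OF ideal_closed(3)[OF I(1,3)] I(3)])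
      also have "\<dots> \<le> q * (\<kappa> + qn L)" using L'(2) q(1) by (intro mult_left_mono) auto
      finally have qL: "qn L' \<le> q * (\<kappa> + qn L)" .
      have "qn (z *\<^sub>C L') \<le> 1 * qn L'" using False nonneg[OF I(1)] unfolding homogeneous[OF I(1)]
        by (intro mult_right_mono) auto
      then have le: "\<Phi> (qn (z *\<^sub>C L')) \<le> \<Phi> (q * (\<kappa> + qn L))"
        using qL by (intro \<Phi>_mono nonneg[OF ideal_closed(2)[OF I(1)]]) simp
      have "cmod (det_p_id_minus p (z *\<^sub>C L')) \<le> exp (\<Phi> (qn (z *\<^sub>C L')))"
        using L'(1) by (intro det_p_bound) auto
      also have "\<dots> \<le> exp (\<delta> * cmod z powr p + C)"
      proof -
        have "0 \<le> \<delta> * cmod z powr p" using \<delta> by simp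
        then have "\<Phi> (qn (z *\<^sub>C L')) \<le> \<delta> * cmod z powr p + C"
          using le Ca(1) Cb(1) \<Phi>_nonneg[of "2 * q * qn F"] unfolding C_def by linarith
        then show ?thesis by simp
      qed
      finally show ?thesis .
    qed
    \<comment> \<open>The excluded points \<open>z\<close> are finite in number, and both sides of the estimate are continuous.\<close>
    let ?A = "{z. cmod (det_p_id_minus p (z *\<^sub>C L')) \<le> exp (\<delta> * cmod z powr p + C)}"
    have "continuous_on UNIV (\<lambda>\<zeta>. det_p_id_minus p (0 + \<zeta> *\<^sub>C L'))"
      by (intro holomorphic_on_imp_continuous_on det_p_pencil_holomorphic L' finite_rank_ops_intros)
    then have "continuous_on UNIV (\<lambda>\<zeta>. cmod (det_p_id_minus p (\<zeta> *\<^sub>C L')))"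
      by (intro continuous_on_norm) simp
    moreover have "continuous_on UNIV (\<lambda>z. exp (\<delta> * cmod z powr p + C))"
      by (intro continuous_on_exp continuous_on_add continuous_on_mult continuous_on_const
          continuous_on_powr' continuous_on_norm continuous_on_id) (use p in auto)
    ultimately have cl: "closed ?A" by (rule closed_Collect_le)
    obtain ls where ls: "eigenvalue_list G ls" by (rule eigenvalue_list_any[OF G])
    have "{z. det_id_minus (z *\<^sub>C G) = 0} \<subseteq> (\<lambda>l. 1 / l) ` set ls"
    proof
      fix z assume "z \<in> {z. det_id_minus (z *\<^sub>C G) = 0}"
      then have "(\<Prod>l\<leftarrow>ls. 1 - z * l) = 0" using ls by (simp add: eigenvalue_list_def)
      then obtain l where l: "l \<in> set ls" "z * l = 1" by (auto simp: prod_list_zero_iff)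
      then have "l \<noteq> 0" by auto
      then have "z = 1 / l" using l(2) by (simp add: nonzero_eq_divide_eq)
      then show "z \<in> (\<lambda>l. 1 / l) ` set ls" using l(1) by blast
    qed
    then have "finite {z. det_id_minus (z *\<^sub>C G) = 0}" by (rule finite_subset) simp
    then have "interior {z. det_id_minus (z *\<^sub>C G) = 0} = {}" by (rule empty_interior_finite)
    then have "closure (- {z. det_id_minus (z *\<^sub>C G) = 0}) = UNIV"
      by (simp only: closure_complement Compl_empty_eq)
    moreover have "- {z. det_id_minus (z *\<^sub>C G) = 0} \<subseteq> ?A" using generic by auto
    then have "closure (- {z. det_id_minus (z *\<^sub>C G) = 0}) \<subseteq> ?A" using cl by (rule closure_minimal)
    ultimately have "UNIV \<subseteq> ?A" by simp
    then show "cmod (det_p_id_minus p (z *\<^sub>C L')) \<le> exp (\<delta> * cmod z powr p + C)" by blast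
  qed
qed

section \<open>Spectrum of operators in the ideal\<close>

text \<open>Elements of the ideal are norm limits of finite rank operators, so the part that is not of finite
  rank can be made smaller than \<open>cmod z\<close>.\<close>

lemma ideal_spectral_point:
  assumes L: "L \<in> \<I>" and z: "z \<in> spectrum L" "z \<noteq> 0"
  shows "spectral_projection L z (riesz_projection L z)" "riesz_projection L z \<in> finite_rank_ops"
    "z \<in> discrete_eigenvalues L"
proof -
  obtain F where F: "F \<in> finite_rank_ops" "qn (F - L) < cmod z"
    using finite_rank_approximation[OF L, of "cmod z"] z(2) by auto
  define B where "B = L - F"
  have B: "B \<in> \<I>" unfolding B_def using L F ideal_closed by auto
  have "norm B \<le> qn B" by (rule norm_le[OF B])
  also have "\<dots> < cmod z" using F(2) qn_minus_commute[of L F] L ideal_closed(5)[OF F(1)] by (simp add: B_def)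
  finally have n: "norm B < cmod z" .
  have BF: "B + F = L" by (simp add: B_def)
  show "spectral_projection L z (riesz_projection L z)" "riesz_projection L z \<in> finite_rank_ops"
    "z \<in> discrete_eigenvalues L"
    using riesz_projection_spectral[of B F z, unfolded BF, OF ideal_closed(4)[OF B] F(1) z(1) n] by auto
qed

end

lemma eigenvalue_in_spectrum:
  assumes "v \<noteq> 0" "blinfun_apply T v = l *\<^sub>C v" shows "l \<in> spectrum T"
proof (rule ccontr)
  assume "l \<notin> spectrum T"
  then obtain S where S: "is_inverse_op (l *\<^sub>C id_blinfun - T) S" by (auto simp: spectrum_def)
  have "blinfun_apply (l *\<^sub>C id_blinfun - T) v = 0" using assms(2) by (simp add: blinfun.diff_left)
  then have "v = 0" using inverse_op_apply(1)[OF S, of v] by (simp add: blinfun.zero_right)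
  then show False using assms(1) by simp
qed

lemma closed_spectrum:
  fixes T :: "'a::complex_banach \<Rightarrow>\<^sub>L 'a"
  assumes "T \<in> bounded_ops" shows "closed (spectrum T)"
  unfolding closed_open open_contains_ball using resolvent_derivative(2)[OF assms] by (metis ComplD disjoint_eq_subset_Compl)

text \<open>A compact set without limit points.\<close>

lemma finite_spectrum_outside:
  fixes T :: "'a::complex_banach \<Rightarrow>\<^sub>L 'a"
  assumes T: "T \<in> bounded_ops" and iso: "\<And>z. z \<in> spectrum T \<Longrightarrow> c \<le> cmod z \<Longrightarrow> z isolated_in spectrum T"
  shows "finite {z \<in> spectrum T. c \<le> cmod z}"
proof (rule ccontr)
  let ?S = "{z \<in> spectrum T. c \<le> cmod z}"
  assume "infinite ?S"
  have "closed {z. c \<le> cmod z}" by (intro closed_Collect_le continuous_intros)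
  then have "closed ?S" using closed_Int[OF closed_spectrum[OF T]] by (simp add: Collect_conj_eq)
  moreover have "bounded ?S"
    using norm_spectrum_le[OF T] by (auto intro!: boundedI[of _ "norm T"])
  ultimately have "compact ?S" using compact_eq_bounded_closed by blast
  then obtain z where z: "z \<in> ?S" "z islimpt ?S"
    using \<open>infinite ?S\<close> unfolding compact_eq_Bolzano_Weierstrass by blast
  have "z islimpt spectrum T" using z(2) by (rule islimpt_subset) auto
  moreover have "z isolated_in spectrum T" using iso z(1) by auto
  ultimately show False by (simp add: isolated_in_islimpt_iff)
qed

lemma resolvent_bounded_outside:
  fixes T :: "'a::complex_banach \<Rightarrow>\<^sub>L 'a"
  assumes T: "T \<in> bounded_ops" and e: "0 < e" and out: "\<And>z. e \<le> cmod z \<Longrightarrow> z \<notin> spectrum T"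
  obtains C where "0 < C" "\<And>z. e \<le> cmod z \<Longrightarrow> norm (resolvent T z) \<le> C"
proof -
  let ?A = "{z. e \<le> cmod z} \<inter> cball 0 (norm T + 1)"
  have "closed {z. e \<le> cmod z}" by (intro closed_Collect_le continuous_intros)
  then have "compact ?A" by (intro closed_Int_compact) auto
  moreover have "continuous_on ?A (resolvent T)"
  proof (intro continuous_at_imp_continuous_on ballI)
    fix z assume "z \<in> ?A"
    then have "z \<notin> spectrum T" using out by auto
    then show "isCont (resolvent T) z" using resolvent_derivative(1)[OF T] has_op_derivative_continuous by blast
  qed
  ultimately have "bounded (resolvent T ` ?A)" by (intro compact_imp_bounded compact_continuous_image)
  then obtain C where C: "0 < C" "\<And>z. z \<in> ?A \<Longrightarrow> norm (resolvent T z) \<le> C"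
    unfolding bounded_pos by blast
  show ?thesis
  proof
    show "0 < max C 1" by simp
    fix z assume z: "e \<le> cmod z"
    show "norm (resolvent T z) \<le> max C 1"
    proof (cases "cmod z \<le> norm T + 1")
      case True
      then show ?thesis using C(2)[of z] z by auto
    next
      case False
      have i: "is_inverse_op (z *\<^sub>C id_blinfun - T) (resolvent T z)" using out[OF z] by (rule is_inverse_resolvent)
      have "norm (resolvent T z) \<le> 1"
      proof (rule norm_blinfun_bound)
        fix y
        let ?x = "blinfun_apply (resolvent T z) y"
        have "z *\<^sub>C ?x - blinfun_apply T ?x = y"
          using inverse_op_apply(2)[OF i, of y] by (simp add: blinfun.diff_left)
        then have "z *\<^sub>C ?x = y + blinfun_apply T ?x" by (simp add: diff_eq_eq)
        then have "cmod z * norm ?x = norm (y + blinfun_apply T ?x)" by (metis norm_scaleC)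
        then have "cmod z * norm ?x \<le> norm y + norm T * norm ?x"
          using norm_triangle_ineq[of y "blinfun_apply T ?x"] norm_blinfun[of T ?x] by linarith
        moreover have "(norm T + 1) * norm ?x \<le> cmod z * norm ?x" using False by (intro mult_right_mono) auto
        ultimately show "norm ?x \<le> 1 * norm y" by (simp add: algebra_simps)
      qed simp
      then show ?thesis by simp
    qed
  qed
qed

section \<open>Restriction to a spectral subspace\<close>

lemma op_power_sum_orthogonal:
  assumes "(H o\<^sub>L X) = 0" "(X o\<^sub>L H) = 0" "0 < k"
  shows "op_power (H + X) k = op_power H k + op_power X k"
  using assms(3)
proof (induction k)
  case (Suc k)
  show ?case
  proof (cases "k = 0")
    case False
    then obtain j where j: "k = Suc j" by (cases k) auto
    have "(H o\<^sub>L op_power X k) = 0" "(X o\<^sub>L op_power H k) = 0"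
      unfolding j using assms by (simp_all add: compose_assoc[symmetric])
    then show ?thesis using Suc False by (simp add: compose_add_left compose_add_right)
  qed simp
qed simp

lemma eigenvalue_list_sum:
  assumes H: "H \<in> finite_rank_ops" and X: "X \<in> finite_rank_ops" and orth: "(H o\<^sub>L X) = 0" "(X o\<^sub>L H) = 0"
    and ls: "eigenvalue_list H hs" "eigenvalue_list X xs"
  shows "eigenvalue_list (H + X) (xs @ hs)"
  unfolding eigenvalue_list_def
proof (intro conjI allI impI)
  fix z
  have zz: "((z *\<^sub>C H) o\<^sub>L (z *\<^sub>C X)) = 0"
    using finite_rank_ops_bounded[OF H] orth by (simp add: compose_scaleC_left compose_scaleC_right)
  have e: "z *\<^sub>C (H + X) = z *\<^sub>C H + z *\<^sub>C X - ((z *\<^sub>C H) o\<^sub>L (z *\<^sub>C X))"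
    unfolding zz by (simp add: complex_vector.scale_right_distrib)
  have "det_id_minus (z *\<^sub>C (H + X)) = det_id_minus (z *\<^sub>C H) * det_id_minus (z *\<^sub>C X)"
    unfolding e using H X by (intro det_id_minus_mult) auto
  then show "det_id_minus (z *\<^sub>C (H + X)) = (\<Prod>l\<leftarrow>xs @ hs. 1 - z * l)"
    using ls by (simp add: eigenvalue_list_def)
next
  fix k :: nat assume k: "0 < k"
  have "op_trace (op_power (H + X) k) = op_trace (op_power H k) + op_trace (op_power X k)"
    unfolding op_power_sum_orthogonal[OF orth k] using H X k by (intro op_trace_linear(1) finite_rank_ops_power)
  then show "op_trace (op_power (H + X) k) = (\<Sum>l\<leftarrow>xs @ hs. l ^ k)"
    using ls k by (simp add: eigenvalue_list_def)
qed

lemma op_rank_mono: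
  assumes P: "P \<in> finite_rank_ops" "(P o\<^sub>L P) = P" and Q: "Q \<in> finite_rank_ops" "(Q o\<^sub>L Q) = Q"
    and sub: "range (blinfun_apply P) \<subseteq> range (blinfun_apply Q)"
  shows "op_rank P \<le> op_rank Q"
proof -
  note bP = range_basis_list[OF P(1)] and bQ = range_basis_list[OF Q(1)]
  have "set (range_basis P) \<subseteq> lspan (range_basis Q)"
    using bP(2) bQ(2) sub complex_vector.span_superset[of "set (range_basis P)"] by simp
  then have "card (set (range_basis P)) \<le> card (set (range_basis Q))"
    using complex_vector.independent_span_bound[of "set (range_basis Q)" "set (range_basis P)"] bP(1)
    by (simp add: basis_list_def)
  then show ?thesis
    using op_rank_projection(2)[OF P] op_rank_projection(2)[OF Q] bP(1) bQ(1)
    by (simp add: basis_list_def distinct_card)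
qed

text \<open>Off the range of \<open>P\<close> the operator \<open>L P - z\<close> acts as multiplication by \<open>- z\<close>.\<close>

lemma restricted_generalized_eigenvector:
  fixes L P :: "'a::complex_normed_vector \<Rightarrow>\<^sub>L 'a"
  assumes L: "L \<in> bounded_ops" and P: "P \<in> bounded_ops" "(P o\<^sub>L P) = P" "(P o\<^sub>L L) = (L o\<^sub>L P)"
    and z: "z \<noteq> 0" and v: "blinfun_apply (op_power (shift (L o\<^sub>L P) z) m) v = 0"
  shows "blinfun_apply P v = v" "blinfun_apply (op_power (shift L z) m) v = 0"
proof -
  let ?T = "L o\<^sub>L P"
  have PT: "(P o\<^sub>L ?T) = ?T"
  proof -
    have "(P o\<^sub>L ?T) = ((P o\<^sub>L L) o\<^sub>L P)" by (simp add: compose_assoc)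
    also have "\<dots> = (L o\<^sub>L (P o\<^sub>L P))" by (simp only: P(3) compose_assoc)
    finally show ?thesis by (simp only: P(2))
  qed
  have 1: "((id_blinfun - P) o\<^sub>L op_power (shift ?T z) k) = ((- z) ^ k) *\<^sub>C (id_blinfun - P)" for k
  proof (induction k)
    case (Suc k)
    have "((id_blinfun - P) o\<^sub>L shift ?T z) = (- z) *\<^sub>C (id_blinfun - P)"
      using P(1) by (simp add: compose_diff_left compose_diff_right compose_scaleC_right PT
          complex_vector.scale_right_diff_distrib)
    then have "((id_blinfun - P) o\<^sub>L op_power (shift ?T z) (Suc k)) = ((- z) *\<^sub>C (id_blinfun - P)) o\<^sub>L op_power (shift ?T z) k"
      by (simp only: op_power_simps compose_assoc[symmetric])
    also have "\<dots> = (- z) *\<^sub>C ((- z) ^ k *\<^sub>C (id_blinfun - P))" by (simp only: compose_scaleC_left Suc)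
    finally show ?case by simp
  qed simp
  have "blinfun_apply ((- z) ^ m *\<^sub>C (id_blinfun - P)) v = 0"
    using compose_eq_apply[OF 1[of m], of v] v by (simp add: blinfun.zero_right)
  then have "(- z) ^ m *\<^sub>C (v - blinfun_apply P v) = 0" by (simp add: blinfun.diff_left)
  then show Pv: "blinfun_apply P v = v" using z by simp
  have 2: "(op_power (shift ?T z) k o\<^sub>L P) = (op_power (shift L z) k o\<^sub>L P)" for k
  proof (induction k)
    case (Suc k)
    have "(shift ?T z o\<^sub>L P) = (shift L z o\<^sub>L P)"
      by (simp add: compose_diff_left compose_assoc P(2))
    moreover have "(shift L z o\<^sub>L P) = (P o\<^sub>L shift L z)"
      using P(1,3) by (simp add: compose_diff_left compose_diff_right compose_scaleC_left compose_scaleC_right)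
    ultimately have e: "(shift ?T z o\<^sub>L P) = (P o\<^sub>L shift L z)" "(shift L z o\<^sub>L P) = (P o\<^sub>L shift L z)" by simp_all
    have "(op_power (shift ?T z) (Suc k) o\<^sub>L P) = ((op_power (shift ?T z) k o\<^sub>L P) o\<^sub>L shift L z)"
      by (simp only: op_power_Suc2 compose_assoc e(1))
    also have "\<dots> = (op_power (shift L z) (Suc k) o\<^sub>L P)"
      by (simp only: Suc) (simp only: op_power_Suc2 compose_assoc e(2))
    finally show ?case .
  qed simp
  show "blinfun_apply (op_power (shift L z) m) v = 0"
    using compose_eq_apply[OF 2[of m], of v] v Pv by simp
qed

context determinant_ideal
begin

text \<open>The spectral subspaces of \<open>L P\<close> at nonzero points lie in those of \<open>L\<close>; the point \<open>0\<close> has weight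
  zero.\<close>

lemma restricted_power_sum_le:
  assumes L: "L \<in> \<I>" and P: "P \<in> finite_rank_ops" "(P o\<^sub>L P) = P" "(P o\<^sub>L L) = (L o\<^sub>L P)"
  shows "eigenvalue_power_sum p (L o\<^sub>L P) \<le> eigenvalue_power_sum p L"
proof -
  let ?T = "L o\<^sub>L P"
  note Lb = ideal_closed(4)[OF L] and Pb = finite_rank_ops_bounded[OF P(1)]
  have Tf: "?T \<in> finite_rank_ops" using P(1) Lb by auto
  have main: "z \<in> discrete_eigenvalues L \<and> algebraic_multiplicity ?T z \<le> algebraic_multiplicity L z"
    if z: "z \<in> discrete_eigenvalues ?T" "z \<noteq> 0" for z
  proof -
    have zs: "z \<in> spectrum ?T" using z(1) by (auto simp: discrete_eigenvalues_def isolated_in_def)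
    obtain x where x: "x \<noteq> 0" "blinfun_apply ?T x = z *\<^sub>C x" using z(1) by (auto simp: discrete_eigenvalues_def)
    have "blinfun_apply (op_power (shift ?T z) 1) x = 0" using x(2) by (simp add: blinfun.diff_left)
    from restricted_generalized_eigenvector(2)[OF Lb Pb P(2,3) z(2) this]
    have "blinfun_apply L x = z *\<^sub>C x" by (simp add: blinfun.diff_left)
    then have zL: "z \<in> spectrum L" using x(1) by (rule eigenvalue_in_spectrum[rotated])
    note sL = ideal_spectral_point[OF L zL z(2)]
    note sT = ideal_spectral_point[OF ideal_closed(5)[OF Tf] zs z(2)]
    obtain m where m: "(op_power (shift ?T z) m o\<^sub>L riesz_projection ?T z) = 0"
      using sT(1) by (auto simp: spectral_projection_def)
    have "range (blinfun_apply (riesz_projection ?T z)) \<subseteq> range (blinfun_apply (riesz_projection L z))"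
    proof
      fix v assume "v \<in> range (blinfun_apply (riesz_projection ?T z))"
      then obtain y where y: "v = blinfun_apply (riesz_projection ?T z) y" by blast
      have "blinfun_apply (op_power (shift ?T z) m) v = 0" using compose_eq_apply[OF m, of y] by (simp add: y)
      from restricted_generalized_eigenvector(2)[OF Lb Pb P(2,3) z(2) this]
      have "blinfun_apply (riesz_projection L z) v = v" using sL(1) by (auto simp: spectral_projection_def)
      then show "v \<in> range (blinfun_apply (riesz_projection L z))" by (metis rangeI)
    qed
    then have "op_rank (riesz_projection ?T z) \<le> op_rank (riesz_projection L z)"
      using sL sT by (intro op_rank_mono) (auto simp: spectral_projection_def)
    then show ?thesis using sL(3) by (simp add: algebraic_multiplicity_def)
  qed
  show ?thesis
    unfolding eigenvalue_power_sum_def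
  proof (rule infsum_mono_neutral)
    show "(\<lambda>z. real (algebraic_multiplicity ?T z) * cmod z powr p) summable_on discrete_eigenvalues ?T"
      using eigenvalues_summable[OF ideal_closed(5)[OF Tf]] by (simp add: eigenvalues_p_summable_def)
    show "(\<lambda>z. real (algebraic_multiplicity L z) * cmod z powr p) summable_on discrete_eigenvalues L"
      using eigenvalues_summable[OF L] by (simp add: eigenvalues_p_summable_def)
    fix z
    show "real (algebraic_multiplicity ?T z) * cmod z powr p \<le> real (algebraic_multiplicity L z) * cmod z powr p"
      if "z \<in> discrete_eigenvalues ?T \<inter> discrete_eigenvalues L"
      using main[of z] that by (cases "z = 0") (auto intro!: mult_right_mono)
    show "real (algebraic_multiplicity ?T z) * cmod z powr p \<le> 0"
      if "z \<in> discrete_eigenvalues ?T - discrete_eigenvalues L"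
      using main[of z] that by (cases "z = 0") auto
  qed auto
qed

section \<open>The determinant bound in the limit\<close>

text \<open>The determinant bound survives the passage to the limit with the quasi-norm of the limit itself,
  although the quasi-norm need not be continuous. Let \<open>P\<close> be the spectral projection of \<open>L\<close> for the eigenvalues of
  modulus at least \<open>\<epsilon>\<close>, and replace \<open>L'\<close> by \<open>L''\<close>, the direct sum of \<open>L P\<close> and the compression \<open>H\<close> of \<open>L'\<close>
  to the complement. The eigenvalues of \<open>L P\<close> are eigenvalues of \<open>L\<close>, so this factor of the determinant obeys the
  bound with \<open>qn L\<close>. The eigenvalues of \<open>H\<close> are smaller than \<open>\<epsilon>\<close>, so that this factor is close to \<open>1\<close> by
  \<open>small_factor_product_bound\<close>. Finally \<open>L'\<close> and \<open>L''\<close> have nearby determinants by Cauchy's estimate on the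
  line through them.\<close>

lemma det_p_limit_bound:
  assumes L: "L \<in> \<I>" and \<eta>: "0 < \<eta>"
  obtains \<kappa> where "0 < \<kappa>"
    "\<And>L'. L' \<in> finite_rank_ops \<Longrightarrow> qn (L' - L) < \<kappa> \<Longrightarrow> cmod (det_p_id_minus p L') \<le> exp (\<Phi> (qn L)) + \<eta>"
proof -
  let ?n = "nat \<lceil>p\<rceil>"
  note Lb = ideal_closed(4)[OF L]
  define c0 where "c0 = 2 * 8 ^ ?n + 2 * exp p"
  have c0: "0 < c0" by (simp add: c0_def add_pos_pos)
  define E where "E = exp (\<Phi> (qn L))"
  have E: "0 < E" by (simp add: E_def)
  \<comment> \<open>The small eigenvalues may contribute a factor \<open>exp \<eta>1\<close>; half of \<open>\<eta>\<close> is kept for the passage from \<open>L''\<close> to \<open>L'\<close>.\<close>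
  define \<eta>1 where "\<eta>1 = ln (1 + \<eta> / (2 * E))"
  have \<eta>1: "0 < \<eta>1" "E * exp \<eta>1 = E + \<eta> / 2"
    using \<eta> E by (auto simp: \<eta>1_def field_simps add_pos_pos)
  define \<delta> where "\<delta> = \<eta>1 / (2 * c0)"
  have \<delta>: "0 < \<delta>" using \<eta>1 c0 by (simp add: \<delta>_def)
  obtain C \<kappa>1 where g: "0 \<le> C" "0 < \<kappa>1"
    "\<And>L' z. L' \<in> finite_rank_ops \<Longrightarrow> qn (L' - L) < \<kappa>1 \<Longrightarrow> cmod (det_p_id_minus p (z *\<^sub>C L')) \<le> exp (\<delta> * cmod z powr p + C)"
    by (rule det_p_growth[OF L \<delta>]) (rule that, assumption+)
  have "((\<lambda>R. C * R powr - p) \<longlongrightarrow> C * 0) at_top"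
    using p by (intro tendsto_mult tendsto_const tendsto_neg_powr filterlim_ident) auto
  then have "\<forall>\<^sub>F R in at_top. C * R powr - p < \<delta>" using \<delta> by (intro order_tendstoD(2)) auto
  then have "\<forall>\<^sub>F R in at_top. C * R powr - p < \<delta> \<and> (4::real) \<le> R"
    using eventually_ge_at_top[of "4::real"] by eventually_elim auto
  then obtain R where R: "C * R powr - p < \<delta>" "4 \<le> R" using eventually_happens'[OF trivial_limit_at_top_linorder] by blast
  define \<epsilon> where "\<epsilon> = 1 / R"
  have \<epsilon>: "0 < \<epsilon>" using R by (simp add: \<epsilon>_def)
  define S where "S = {z \<in> spectrum L. \<epsilon> \<le> cmod z}"
  have S0: "z \<noteq> 0" "z \<in> spectrum L" if "z \<in> S" for z using that \<epsilon> by (auto simp: S_def)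
  have "z isolated_in spectrum L" if "z \<in> spectrum L" "\<epsilon> \<le> cmod z" for z
  proof -
    have "z \<noteq> 0" using that(2) \<epsilon> by auto
    then show ?thesis using ideal_spectral_point(3)[OF L that(1)] by (simp add: discrete_eigenvalues_def)
  qed
  then have S: "finite S" unfolding S_def by (rule finite_spectrum_outside[OF Lb])
  define P where "P = (\<Sum>z\<in>S. riesz_projection L z)"
  note Pp = spectral_projection_sum[OF Lb S, of "riesz_projection L", folded P_def,
      OF ideal_spectral_point(1)[OF L S0(2) S0(1)] ideal_spectral_point(2)[OF L S0(2) S0(1)], simplified]
  have Pf: "P \<in> finite_rank_ops" and PP: "(P o\<^sub>L P) = P" and PL: "(P o\<^sub>L L) = (L o\<^sub>L P)"
    and Pev: "\<And>v l. v \<noteq> 0 \<Longrightarrow> blinfun_apply P v = v \<Longrightarrow> blinfun_apply L v = l *\<^sub>C v \<Longrightarrow> l \<in> S"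
    and Pgen: "\<And>z k x. z \<in> S \<Longrightarrow> blinfun_apply (op_power (shift L z) k) x = 0 \<Longrightarrow> blinfun_apply P x = x"
    using Pp by blast+
  note Pb = finite_rank_ops_bounded[OF Pf]
  define \<Theta> where "\<Theta> = (L o\<^sub>L P)"
  have \<Theta>f: "\<Theta> \<in> finite_rank_ops" unfolding \<Theta>_def using Pf Lb by auto
  let ?J = "id_blinfun - P"
  have Jb: "?J \<in> bounded_ops" using Pb by auto
  have JP: "(?J o\<^sub>L P) = 0" "(P o\<^sub>L ?J) = 0" by (simp_all add: compose_diff_left compose_diff_right PP)
  have P\<Theta>: "(P o\<^sub>L \<Theta>) = \<Theta>"
  proof -
    have "(P o\<^sub>L \<Theta>) = ((P o\<^sub>L L) o\<^sub>L P)" by (simp add: \<Theta>_def compose_assoc)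
    also have "\<dots> = (L o\<^sub>L (P o\<^sub>L P))" by (simp only: PL compose_assoc)
    finally show ?thesis by (simp only: PP \<Theta>_def)
  qed
  \<comment> \<open>An eigenvector of \<open>Z\<close> for an eigenvalue outside the disc would be an eigenvector of \<open>L\<close> annihilated by \<open>P\<close>,
    which is impossible. So the spectrum of \<open>Z\<close> lies in the disc of radius \<open>\<epsilon>\<close>.\<close>
  define Z where "Z = (?J o\<^sub>L (L o\<^sub>L ?J))"
  have LZ: "L = \<Theta> + Z" and ZL: "Z = (L o\<^sub>L ?J)"
    by (simp_all add: Z_def \<Theta>_def compose_diff_left compose_diff_right PL compose_assoc[symmetric])
      (simp_all add: compose_assoc PP)
  have ZI: "Z \<in> \<I>" unfolding Z_def using L Jb ideal_closed by auto
  note Zb = ideal_closed(4)[OF ZI]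
  have Zout: "z \<notin> spectrum Z" if z: "\<epsilon> \<le> cmod z" for z
  proof
    assume zs: "z \<in> spectrum Z"
    have z0: "z \<noteq> 0" using z \<epsilon> by auto
    have "z \<in> discrete_eigenvalues Z" by (rule ideal_spectral_point(3)[OF ZI zs z0])
    then obtain x where x: "x \<noteq> 0" "blinfun_apply Z x = z *\<^sub>C x" by (auto simp: discrete_eigenvalues_def)
    have "(P o\<^sub>L Z) = 0" unfolding Z_def compose_assoc[symmetric] JP by simp
    from compose_eq_apply[OF this, of x] have "z *\<^sub>C blinfun_apply P x = 0" using x(2) Pb by (simp add: bounded_ops_apply)
    then have Px: "blinfun_apply P x = 0" using z0 by simp
    then have Lx: "blinfun_apply L x = z *\<^sub>C x" using x(2) unfolding ZL by (simp add: blinfun.diff_left)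
    then have "z \<in> S" using eigenvalue_in_spectrum[OF x(1)] z by (auto simp: S_def)
    moreover have "blinfun_apply (op_power (shift L z) 1) x = 0" using Lx by (simp add: blinfun.diff_left)
    ultimately have "blinfun_apply P x = x" by (rule Pgen)
    then show False using Px x(1) by simp
  qed
  obtain CR where CR: "0 < CR" "\<And>z. \<epsilon> \<le> cmod z \<Longrightarrow> norm (resolvent Z z) \<le> CR"
    using resolvent_bounded_outside[OF Zb \<epsilon> Zout] by metis
  \<comment> \<open>In a basis of the range of \<open>P\<close> all eigenvalues of \<open>\<Theta>\<close> belong to \<open>S\<close>; no zeros are added to the list.\<close>
  have r\<Theta>: "range (blinfun_apply \<Theta>) \<subseteq> lspan (range_basis P)"
    unfolding range_basis_list(2)[OF Pf] using P\<Theta> by (metis blinfun_apply_blinfun_compose image_subset_iff rangeI)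
  obtain ls1 where ls1: "eigenvalue_list \<Theta> ls1"
    "\<And>l. l \<in> set ls1 \<Longrightarrow> \<exists>v\<in>lspan (range_basis P). v \<noteq> 0 \<and> blinfun_apply \<Theta> v = l *\<^sub>C v"
    using eigenvalue_list_exists[OF finite_rank_ops_bounded[OF \<Theta>f] range_basis_list(1)[OF Pf] r\<Theta>] by metis
  have big: "1 / R \<le> cmod l" if l: "l \<in> set ls1" for l
  proof -
    obtain v where v: "v \<in> range (blinfun_apply P)" "v \<noteq> 0" "blinfun_apply \<Theta> v = l *\<^sub>C v"
      using ls1(2)[OF l] unfolding range_basis_list(2)[OF Pf] by blast
    have Pv: "blinfun_apply P v = v" using v(1) compose_eq_apply[OF PP] by auto
    then have "blinfun_apply L v = l *\<^sub>C v" using v(3) by (simp add: \<Theta>_def)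
    then have "l \<in> S" using Pev v(2) Pv by blast
    then show ?thesis by (simp add: S_def \<epsilon>_def)
  qed
  have \<Theta>bound: "cmod (\<Prod>l\<leftarrow>ls1. primary ?n l) \<le> E"
  proof -
    have "(\<Prod>l\<leftarrow>ls1. primary ?n l) = det_p_id_minus p \<Theta>"
      using det_p_eigenvalue_list[OF \<Theta>f ls1(1), of p 1] by simp
    moreover have "\<Gamma> * eigenvalue_power_sum p \<Theta> \<le> \<Phi> (qn L)"
      unfolding \<Phi>_def \<Theta>_def using restricted_power_sum_le[OF L Pf PP PL] power_sum_le[OF L] \<Gamma>
      by (intro mult_left_mono) auto
    ultimately show ?thesis unfolding E_def using det_bound[OF \<Theta>f] by (metis exp_le_cancel_iff order_trans)
  qed
  \<comment> \<open>The choice of \<open>\<kappa>\<close> ensures in turn that the growth estimate applies to \<open>L''\<close>, that \<open>H\<close> and \<open>Z\<close> differ by less than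
    the inverse of the resolvent bound, and that \<open>L'\<close> and \<open>L''\<close> have distance at most \<open>\<tau>\<close>.\<close>
  define j where "j = norm ?J"
  have j0: "0 \<le> j" by (simp add: j_def)
  define W where "W = q * (q * (1 + qn L) + 1)"
  define \<rho> where "\<rho> = 2 * exp (\<Phi> W) / \<eta>"
  have \<rho>: "0 < \<rho>" "exp (\<Phi> W) / \<rho> = \<eta> / 2" using \<eta> by (auto simp: \<rho>_def)
  define \<tau> where "\<tau> = 1 / (\<rho> + 1)"
  have \<tau>: "0 < \<tau>" using \<rho> by (simp add: \<tau>_def)
  define \<kappa> where "\<kappa> = Min {1, \<kappa>1 / (j * j + 1), 1 / (CR * (j * j + 1)), \<tau> / (q * (j * j + 1))}"
  have jj: "0 < j * j + 1" by (simp add: add_nonneg_pos)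
  have q0: "0 < q" using q(1) by linarith
  have \<kappa>0: "0 < \<kappa>" unfolding \<kappa>_def using g(2) jj CR(1) \<tau> q0 by (simp add: divide_pos_pos)
  have \<kappa>le: "\<kappa> \<le> 1" "\<kappa> * (j * j + 1) \<le> \<kappa>1" "CR * (\<kappa> * (j * j + 1)) \<le> 1" "q * (\<kappa> * (j * j + 1)) \<le> \<tau>"
  proof -
    have m: "\<kappa> \<le> 1" "\<kappa> \<le> \<kappa>1 / (j * j + 1)" "\<kappa> \<le> 1 / (CR * (j * j + 1))" "\<kappa> \<le> \<tau> / (q * (j * j + 1))"
      unfolding \<kappa>_def by (rule Min_le; simp)+
    show "\<kappa> \<le> 1" by (rule m(1))
    show "\<kappa> * (j * j + 1) \<le> \<kappa>1" using m(2) jj by (simp add: pos_le_divide_eq)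
    have "0 < CR * (j * j + 1)" "0 < q * (j * j + 1)" using CR(1) q0 jj by auto
    then show "CR * (\<kappa> * (j * j + 1)) \<le> 1" "q * (\<kappa> * (j * j + 1)) \<le> \<tau>"
      using m(3,4) by (simp_all add: pos_le_divide_eq mult_ac)
  qed
  show ?thesis
  proof
    show "0 < \<kappa>" by (rule \<kappa>0)
    fix L' assume L': "L' \<in> finite_rank_ops" "qn (L' - L) < \<kappa>"
    define H where "H = (?J o\<^sub>L (L' o\<^sub>L ?J))"
    have Hf: "H \<in> finite_rank_ops" unfolding H_def using L'(1) Jb by auto
    define L'' where "L'' = H + \<Theta>"
    have L''f: "L'' \<in> finite_rank_ops" unfolding L''_def using Hf \<Theta>f by auto
    note I = ideal_closed(5)[OF L'(1)] ideal_closed(5)[OF L''f] L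
    have dI: "L' - L \<in> \<I>" using I ideal_closed by auto
    have HZ: "H - Z = (?J o\<^sub>L ((L' - L) o\<^sub>L ?J))"
      unfolding H_def Z_def by (rule blinfun_eqI) (simp add: blinfun.diff_left blinfun.diff_right)
    have qd: "qn (H - Z) \<le> j * j * qn (L' - L)"
    proof -
      have "qn (?J o\<^sub>L ((L' - L) o\<^sub>L ?J)) \<le> norm ?J * qn ((L' - L) o\<^sub>L ?J)"
        using dI Jb ideal_closed(6) by (intro qn_compose(2)) auto
      also have "\<dots> \<le> norm ?J * (qn (L' - L) * norm ?J)"
        using dI Jb by (intro mult_left_mono qn_compose(1)) auto
      finally show ?thesis unfolding HZ j_def by (simp add: mult_ac)
    qed
    have qd0: "0 \<le> qn (L' - L)" by (rule nonneg[OF dI])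
    have qd2: "qn (H - Z) \<le> j * j * \<kappa>"
      using qd L'(2) by (meson less_imp_le mult_left_mono order_trans zero_le_square)
    have L''L: "L'' - L = H - Z" unfolding L''_def LZ by simp
    have "j * j * \<kappa> < \<kappa> * (j * j + 1)" using \<kappa>0 by (simp add: algebra_simps)
    then have lt: "qn (H - Z) < \<kappa> * (j * j + 1)" using qd2 by linarith
    have near: "qn (L'' - L) < \<kappa>1" "CR * qn (H - Z) < 1"
      using lt \<kappa>le(2) mult_strict_left_mono[OF lt CR(1)] \<kappa>le(3) unfolding L''L by linarith+
    \<comment> \<open>An eigenvalue of \<open>H\<close> of modulus at least \<open>\<epsilon>\<close> would contradict the resolvent bound for the nearby operator \<open>Z\<close>.\<close>
    obtain ls2 where ls2: "eigenvalue_list H ls2"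
      "\<And>l. l \<in> set ls2 \<Longrightarrow> \<exists>v\<in>lspan (range_basis H). v \<noteq> 0 \<and> blinfun_apply H v = l *\<^sub>C v"
      using eigenvalue_list_exists[OF finite_rank_ops_bounded[OF Hf] range_basis_list(1)[OF Hf]]
        range_basis_list(2)[OF Hf] by (metis order_refl)
    have small: "cmod l < 1 / R" if l: "l \<in> set ls2" for l
    proof (rule ccontr)
      assume "\<not> ?thesis"
      then have le: "\<epsilon> \<le> cmod l" by (simp add: \<epsilon>_def)
      obtain v where v: "v \<noteq> 0" "blinfun_apply H v = l *\<^sub>C v" using ls2(2)[OF l] by blast
      have i: "is_inverse_op (l *\<^sub>C id_blinfun - Z) (resolvent Z l)" by (rule is_inverse_resolvent[OF Zout[OF le]])
      have "blinfun_apply (l *\<^sub>C id_blinfun - Z) v = blinfun_apply (H - Z) v" using v(2) by (simp add: blinfun.diff_left)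
      then have "v = blinfun_apply (resolvent Z l) (blinfun_apply (H - Z) v)"
        using inverse_op_apply(1)[OF i, of v] by simp
      then have "norm v \<le> norm (resolvent Z l) * norm (blinfun_apply (H - Z) v)" by (metis norm_blinfun)
      also have "\<dots> \<le> CR * (norm (H - Z) * norm v)"
        using CR le by (intro mult_mono norm_blinfun) auto
      also have "norm (H - Z) \<le> qn (H - Z)" by (rule norm_le[OF ideal_closed(3)[OF ideal_closed(5)[OF Hf] ZI]])
      finally have "norm v \<le> (CR * qn (H - Z)) * norm v"
        using CR(1) by (simp add: mult_right_mono mult.assoc)
      then have "1 \<le> CR * qn (H - Z)" using v(1) by simp
      then show False using near(2) by simp
    qed
    have "(H o\<^sub>L \<Theta>) = 0"
    proof -
      have "(H o\<^sub>L \<Theta>) = (?J o\<^sub>L (L' o\<^sub>L ((?J o\<^sub>L P) o\<^sub>L \<Theta>)))" by (simp only: H_def compose_assoc P\<Theta>)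
      then show ?thesis by (simp add: JP)
    qed
    moreover have "(\<Theta> o\<^sub>L H) = 0"
    proof -
      have "(\<Theta> o\<^sub>L H) = (L o\<^sub>L ((P o\<^sub>L ?J) o\<^sub>L (L' o\<^sub>L ?J)))" by (simp only: H_def \<Theta>_def compose_assoc)
      then show ?thesis by (simp add: JP)
    qed
    ultimately have ls: "eigenvalue_list L'' (ls1 @ ls2)"
      unfolding L''_def by (rule eigenvalue_list_sum[OF Hf \<Theta>f _ _ ls2(1) ls1(1)])
    have dp: "det_p_id_minus p (z *\<^sub>C L'') = (\<Prod>l\<leftarrow>ls1 @ ls2. primary ?n (z * l))" for z
      by (rule det_p_eigenvalue_list[OF L''f ls])
    have "cmod (\<Prod>l\<leftarrow>ls2. primary ?n l) \<le> exp (c0 * (\<delta> + C * R powr - p))"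
      unfolding c0_def
    proof (rule small_factor_product_bound[OF _ p ceiling_p(2) R(2) \<delta> g(1) big small])
      show "0 < ?n" using ceiling_p(1) by linarith
      show "cmod (\<Prod>l\<leftarrow>ls1 @ ls2. primary ?n (z * l)) \<le> exp (\<delta> * cmod z powr p + C)" for z
        unfolding dp[symmetric] by (rule g(3)[OF L''f near(1)])
    qed
    also have "\<dots> \<le> exp \<eta>1"
    proof -
      have "c0 * (\<delta> + C * R powr - p) \<le> c0 * (\<delta> + \<delta>)" using R(1) c0 by (intro mult_left_mono) auto
      also have "\<dots> = \<eta>1" using c0 by (simp add: \<delta>_def)
      finally show ?thesis by simp
    qed
    finally have sm: "cmod (\<Prod>l\<leftarrow>ls2. primary ?n l) \<le> exp \<eta>1" .
    have "det_p_id_minus p L'' = (\<Prod>l\<leftarrow>ls1. primary ?n l) * (\<Prod>l\<leftarrow>ls2. primary ?n l)" using dp[of 1] by simp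
    then have "cmod (det_p_id_minus p L'') \<le> E * exp \<eta>1"
      unfolding norm_mult using \<Theta>bound sm E by (simp add: norm_mult mult_mono)
    then have d1: "cmod (det_p_id_minus p L'') \<le> E + \<eta> / 2" using \<eta>1(2) by simp
    \<comment> \<open>On the line through \<open>L''\<close> and \<open>L'\<close> the determinant is bounded up to the parameter \<open>\<rho> + 1\<close>, because the
      step \<open>L' - L''\<close> has quasi-norm at most \<open>\<tau> = 1 / (\<rho> + 1)\<close>.\<close>
    let ?Y = "L' - L''"
    have Yf: "?Y \<in> finite_rank_ops" using L'(1) L''f by auto
    have qY: "qn ?Y \<le> \<tau>"
    proof -
      have "qn ?Y \<le> q * (qn (L' - L) + qn (L - L''))" using I by (intro qn_triangle_diff) auto
      also have "qn (L - L'') = qn (H - Z)" using qn_minus_commute[of L L''] I L''L by simp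
      also have "q * (qn (L' - L) + qn (H - Z)) \<le> q * (\<kappa> + j * j * \<kappa>)"
        using L'(2) qd2 q0 by (intro mult_left_mono add_mono) auto
      also have "\<dots> \<le> \<tau>" using \<kappa>le(4) by (simp add: algebra_simps)
      finally show ?thesis .
    qed
    have "cmod (det_p_id_minus p (L'' + 1 *\<^sub>C ?Y) - det_p_id_minus p (L'' + 0 *\<^sub>C ?Y)) \<le> exp (\<Phi> W) / \<rho>"
    proof (rule entire_difference_bound[of "\<lambda>\<zeta>. det_p_id_minus p (L'' + \<zeta> *\<^sub>C ?Y)"])
      show "(\<lambda>\<zeta>. det_p_id_minus p (L'' + \<zeta> *\<^sub>C ?Y)) holomorphic_on UNIV"
        by (rule det_p_pencil_holomorphic[OF L''f Yf])
      fix \<zeta> assume \<zeta>: "cmod \<zeta> \<le> \<rho> + 1"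
      have YI: "?Y \<in> \<I>" using Yf by (rule ideal_closed(5))
      have "qn L'' = qn ((L'' - L) + L)" by simp
      also have "\<dots> \<le> q * (qn (L'' - L) + qn L)" by (rule q(2)[OF ideal_closed(3)[OF I(2,3)] I(3)])
      also have "\<dots> \<le> q * (1 + qn L)"
      proof -
        have "qn (L'' - L) \<le> 1"
        proof -
          have "1 * (\<kappa> * (j * j + 1)) \<le> q * (\<kappa> * (j * j + 1))" using q(1) \<kappa>0 jj by (intro mult_right_mono) auto
          moreover have "\<tau> \<le> 1" using \<rho>(1) by (simp add: \<tau>_def)
          ultimately show ?thesis using lt \<kappa>le(4) unfolding L''L by linarith
        qed
        then show ?thesis using q0 by (intro mult_left_mono) auto
      qed
      finally have 1: "qn L'' \<le> q * (1 + qn L)" .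
      have 2: "qn (\<zeta> *\<^sub>C ?Y) \<le> 1"
      proof -
        have "cmod \<zeta> * qn ?Y \<le> (\<rho> + 1) * \<tau>" using \<zeta> qY nonneg[OF YI] \<rho>(1) by (intro mult_mono) auto
        also have "\<dots> = 1" using \<rho>(1) by (simp add: \<tau>_def)
        finally show ?thesis using homogeneous[OF YI] by simp
      qed
      have "qn (L'' + \<zeta> *\<^sub>C ?Y) \<le> q * (qn L'' + qn (\<zeta> *\<^sub>C ?Y))" by (rule q(2)[OF I(2) ideal_closed(2)[OF YI]])
      also have "\<dots> \<le> W" unfolding W_def using 1 2 q0 by (intro mult_left_mono add_mono) auto
      finally have "\<Phi> (qn (L'' + \<zeta> *\<^sub>C ?Y)) \<le> \<Phi> W"
        by (intro \<Phi>_mono nonneg[OF ideal_closed(1)[OF I(2) ideal_closed(2)[OF YI]]])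
      moreover have "cmod (det_p_id_minus p (L'' + \<zeta> *\<^sub>C ?Y)) \<le> exp (\<Phi> (qn (L'' + \<zeta> *\<^sub>C ?Y)))"
        using L''f Yf by (intro det_p_bound) auto
      ultimately show "cmod (det_p_id_minus p (L'' + \<zeta> *\<^sub>C ?Y)) \<le> exp (\<Phi> W)"
        by (meson exp_le_cancel_iff order_trans)
    qed (rule \<rho>(1))
    then have "cmod (det_p_id_minus p L' - det_p_id_minus p L'') \<le> \<eta> / 2" by (simp add: \<rho>(2))
    then show "cmod (det_p_id_minus p L') \<le> exp (\<Phi> (qn L)) + \<eta>"
      using d1 norm_triangle_ineq2[of "det_p_id_minus p L'" "det_p_id_minus p L''"] unfolding E_def by linarith
  qed
qed

end

section \<open>Counting eigenvalues\<close>

text \<open>The condition says that \<open>\<Theta>\<close> maps into a subspace on which \<open>A + F'\<close> and \<open>\<Theta>\<close> agree, whence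
  \<open>I - w (A + F') = (I - w (A + F' - \<Theta>)) (I - w \<Theta>)\<close>. Multiply by the inverse of \<open>I - w A\<close> from the right and conjugate the
  second factor.\<close>

lemma perturbation_determinant_factor:
  fixes A F' \<Theta> :: "'a::complex_banach \<Rightarrow>\<^sub>L 'a"
  assumes A: "A \<in> bounded_ops" and F': "F' \<in> finite_rank_ops" and \<Theta>: "\<Theta> \<in> finite_rank_ops"
    and orth: "((A + F') o\<^sub>L \<Theta>) = (\<Theta> o\<^sub>L \<Theta>)" and w: "cmod w * norm A < 1"
  shows "det_id_minus (w *\<^sub>C (F' o\<^sub>L neumann A w)) =
    det_id_minus (w *\<^sub>C ((F' - \<Theta>) o\<^sub>L neumann A w)) * det_id_minus (w *\<^sub>C \<Theta>)"
proof -
  let ?g = "neumann A w" and ?V = "id_blinfun - w *\<^sub>C A" and ?Y = "F' - \<Theta>"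
  note Fb = finite_rank_ops_bounded[OF F'] and \<Theta>b = finite_rank_ops_bounded[OF \<Theta>]
  have gV: "(?g o\<^sub>L ?V) = id_blinfun" "(?V o\<^sub>L ?g) = id_blinfun" and gb: "?g \<in> bounded_ops"
    using neumann_properties(1)[OF A w] by (auto simp: is_inverse_op_def)
  have Vb: "?V \<in> bounded_ops" using A by auto
  define F1 where "F1 = w *\<^sub>C (?Y o\<^sub>L ?g)"
  define G1 where "G1 = (?V o\<^sub>L (w *\<^sub>C (\<Theta> o\<^sub>L ?g)))"
  have f1: "F1 \<in> finite_rank_ops" and g1: "G1 \<in> finite_rank_ops" and f2: "w *\<^sub>C (\<Theta> o\<^sub>L ?g) \<in> finite_rank_ops"
    unfolding F1_def G1_def using F' \<Theta> gb Vb by auto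
  have "(?Y o\<^sub>L \<Theta>) + (A o\<^sub>L \<Theta>) = 0"
    using orth by (simp add: compose_diff_left compose_add_left algebra_simps)
  then have AY: "(A o\<^sub>L \<Theta>) = - (?Y o\<^sub>L \<Theta>)" by (simp add: eq_neg_iff_add_eq_0 add.commute)
  have FG: "(F1 o\<^sub>L G1) = w *\<^sub>C (w *\<^sub>C (?Y o\<^sub>L (\<Theta> o\<^sub>L ?g)))"
  proof -
    have "(F1 o\<^sub>L G1) = w *\<^sub>C (?Y o\<^sub>L ((?g o\<^sub>L ?V) o\<^sub>L (w *\<^sub>C (\<Theta> o\<^sub>L ?g))))"
      by (simp only: F1_def G1_def compose_scaleC_left compose_assoc)
    also have "\<dots> = w *\<^sub>C (w *\<^sub>C (?Y o\<^sub>L (\<Theta> o\<^sub>L ?g)))"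
      using Fb \<Theta>b by (simp add: gV compose_scaleC_right)
    finally show ?thesis .
  qed
  have "G1 = w *\<^sub>C (\<Theta> o\<^sub>L ?g) - w *\<^sub>C (w *\<^sub>C ((A o\<^sub>L \<Theta>) o\<^sub>L ?g))"
    using A by (simp add: G1_def compose_diff_left compose_scaleC_left compose_scaleC_right compose_assoc)
  also have "\<dots> = w *\<^sub>C (\<Theta> o\<^sub>L ?g) + w *\<^sub>C (w *\<^sub>C (?Y o\<^sub>L (\<Theta> o\<^sub>L ?g)))"
    unfolding AY by (rule blinfun_eqI) (simp add: blinfun.minus_left blinfun.diff_left blinfun.add_left
        complex_vector.scale_right_diff_distrib)
  finally have "F1 + G1 - (F1 o\<^sub>L G1) = F1 + w *\<^sub>C (\<Theta> o\<^sub>L ?g)" unfolding FG by simp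
  also have "\<dots> = w *\<^sub>C (F' o\<^sub>L ?g)"
    unfolding F1_def by (simp add: compose_diff_left complex_vector.scale_right_diff_distrib)
  finally have "det_id_minus (w *\<^sub>C (F' o\<^sub>L ?g)) = det_id_minus F1 * det_id_minus G1"
    using det_id_minus_mult[OF f1 g1] by simp
  also have "det_id_minus G1 = det_id_minus ((w *\<^sub>C (\<Theta> o\<^sub>L ?g)) o\<^sub>L ?V)"
    unfolding G1_def using det_id_minus_trace_commute(1)[OF f2 Vb] by simp
  also have "((w *\<^sub>C (\<Theta> o\<^sub>L ?g)) o\<^sub>L ?V) = w *\<^sub>C \<Theta>"
    by (simp only: compose_scaleC_left compose_assoc gV compose_id)
  finally show ?thesis unfolding F1_def .
qed

context determinant_ideal
begin

text \<open>On the circle \<open>cmod w = 1 / r\<close> the operator \<open>w K (I - w A)\<inverse>\<close> has quasi-norm at most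
  \<open>qn K / (r - norm A)\<close>. The limit bound holds locally in \<open>w\<close>, and compactness makes it uniform.\<close>

lemma perturbation_determinant_circle_bound:
  assumes A: "A \<in> bounded_ops" and K: "K \<in> \<I>" and r: "norm A < r" and \<eta>: "0 < \<eta>"
  obtains \<delta> where "0 < \<delta>" "\<And>F w. F \<in> finite_rank_ops \<Longrightarrow> qn (F - K) < \<delta> \<Longrightarrow> cmod w = 1 / r \<Longrightarrow>
    cmod (det_p_id_minus p (w *\<^sub>C (F o\<^sub>L neumann A w))) \<le> exp (\<Phi> (qn K / (r - norm A))) + \<eta>"
proof -
  let ?a = "norm A" and ?E = "exp (\<Phi> (qn K / (r - norm A)))"
  have r0: "0 < r" using r norm_ge_zero[of A] by linarith
  have ra: "0 < r - ?a" using r by simp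
  define Y where "Y w = w *\<^sub>C neumann A w" for w
  have wlt: "cmod w * ?a < 1" if w: "cmod w = 1 / r" for w
    unfolding w using r r0 by simp
  have Yb: "Y w \<in> bounded_ops" and Yn: "norm (Y w) \<le> 1 / (r - ?a)" and Yc: "isCont Y w" if w: "cmod w = 1 / r" for w
  proof -
    note g = neumann_properties[OF A wlt[OF w]]
    show "Y w \<in> bounded_ops" unfolding Y_def using g(3) by auto
    have "norm (Y w) \<le> (1 / r) * (1 / (1 - (1 / r) * ?a))"
      unfolding Y_def norm_scaleC w by (rule mult_left_mono[OF g(2)[unfolded w]]) (use r0 in simp)
    also have "\<dots> = 1 / (r - ?a)" using r0 ra by (simp add: field_simps)
    finally show "norm (Y w) \<le> 1 / (r - ?a)" .
    have "has_op_derivative Y (1 *\<^sub>C neumann A w + w *\<^sub>C (neumann A w o\<^sub>L A o\<^sub>L neumann A w)) w"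
      unfolding Y_def by (rule has_op_derivative_scale[OF _ g(4)]) (auto intro!: derivative_eq_intros)
    then show "isCont Y w" by (rule has_op_derivative_continuous)
  qed
  have e: "w *\<^sub>C (F o\<^sub>L neumann A w) = (F o\<^sub>L Y w)" if "F \<in> bounded_ops" for F w
    using that by (simp add: Y_def compose_scaleC_right)
  note Kb = ideal_closed(4)[OF K]
  have loc: "\<exists>\<delta>>0. \<forall>F w. F \<in> finite_rank_ops \<longrightarrow> qn (F - K) < \<delta> \<longrightarrow> cmod w = 1 / r \<longrightarrow> dist v w < \<delta> \<longrightarrow>
      cmod (det_p_id_minus p (F o\<^sub>L Y w)) \<le> ?E + \<eta>" if v: "cmod v = 1 / r" for v
  proof -
    let ?L = "K o\<^sub>L Y v"
    have L: "?L \<in> \<I>" using K Yb[OF v] by (rule ideal_closed(6))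
    obtain \<kappa> where \<kappa>: "0 < \<kappa>"
      "\<And>L'. L' \<in> finite_rank_ops \<Longrightarrow> qn (L' - ?L) < \<kappa> \<Longrightarrow> cmod (det_p_id_minus p L') \<le> exp (\<Phi> (qn ?L)) + \<eta>"
      by (rule det_p_limit_bound[OF L \<eta>]) (rule that, assumption+)
    have "qn ?L \<le> qn K * norm (Y v)" by (rule qn_compose(1)[OF K Yb[OF v]])
    also have "\<dots> \<le> qn K * (1 / (r - ?a))" using Yn[OF v] nonneg[OF K] by (rule mult_left_mono)
    finally have qL: "exp (\<Phi> (qn ?L)) \<le> ?E" using nonneg[OF L] by (simp add: \<Phi>_mono)
    define M where "M = q * (1 / (r - ?a) + qn K)"
    have M: "0 < M" unfolding M_def using q(1) ra nonneg[OF K] by (intro mult_pos_pos add_pos_nonneg) auto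
    define e0 where "e0 = \<kappa> / M"
    have e0: "0 < e0" using \<kappa>(1) M by (simp add: e0_def)
    obtain \<delta> where \<delta>: "0 < \<delta>" "\<And>w. dist w v < \<delta> \<Longrightarrow> dist (Y w) (Y v) < e0"
      using Yc[OF v] e0 unfolding continuous_at_eps_delta by blast
    show ?thesis
    proof (intro exI[of _ "min \<delta> e0"] conjI allI impI)
      show "0 < min \<delta> e0" using \<delta> e0 by simp
      fix F w assume F: "F \<in> finite_rank_ops" "qn (F - K) < min \<delta> e0" and w: "cmod w = 1 / r" "dist v w < min \<delta> e0"
      note FI = ideal_closed(5)[OF F(1)]
      have dI: "F - K \<in> \<I>" using FI K by (rule ideal_closed(3))
      have dY: "Y w - Y v \<in> bounded_ops" using Yb v w by auto
      have "(F o\<^sub>L Y w) - ?L = ((F - K) o\<^sub>L Y w) + (K o\<^sub>L (Y w - Y v))"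
        by (simp add: compose_diff_left compose_diff_right)
      then have "qn ((F o\<^sub>L Y w) - ?L) = qn (((F - K) o\<^sub>L Y w) + (K o\<^sub>L (Y w - Y v)))" by simp
      also have "\<dots> \<le> q * (qn ((F - K) o\<^sub>L Y w) + qn (K o\<^sub>L (Y w - Y v)))"
        using dI K dY Yb[OF w(1)] by (intro q(2) ideal_closed(6)) auto
      also have "\<dots> < q * (1 / (r - ?a) * e0 + qn K * e0)"
      proof -
        have 1: "qn ((F - K) o\<^sub>L Y w) \<le> qn (F - K) * (1 / (r - ?a))"
          using qn_compose(1)[OF dI Yb[OF w(1)]] mult_left_mono[OF Yn[OF w(1)] nonneg[OF dI]] by linarith
        have 2: "qn (F - K) * (1 / (r - ?a)) < e0 * (1 / (r - ?a))"
          using F(2) ra by (intro mult_strict_right_mono) auto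
        have "norm (Y w - Y v) \<le> e0" using \<delta>(2)[of w] w(2) by (simp add: dist_norm norm_minus_commute)
        then have 3: "qn (K o\<^sub>L (Y w - Y v)) \<le> qn K * e0"
          using qn_compose(1)[OF K dY] mult_left_mono[OF _ nonneg[OF K], of "norm (Y w - Y v)" e0] by linarith
        have "qn ((F - K) o\<^sub>L Y w) + qn (K o\<^sub>L (Y w - Y v)) < 1 / (r - ?a) * e0 + qn K * e0"
          using 1 2 3 by (simp add: mult.commute)
        then show ?thesis using q(1) by simp
      qed
      also have "\<dots> = M * e0" by (simp add: M_def algebra_simps)
      also have "\<dots> = \<kappa>" using M by (simp add: e0_def)
      finally have "qn ((F o\<^sub>L Y w) - ?L) < \<kappa>" .
      moreover have "F o\<^sub>L Y w \<in> finite_rank_ops" using F(1) Yb[OF w(1)] by auto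
      ultimately have "cmod (det_p_id_minus p (F o\<^sub>L Y w)) \<le> exp (\<Phi> (qn ?L)) + \<eta>" by (intro \<kappa>(2))
      then show "cmod (det_p_id_minus p (F o\<^sub>L Y w)) \<le> ?E + \<eta>" using qL by linarith
    qed
  qed
  then obtain d where d: "\<And>v. cmod v = 1 / r \<Longrightarrow> 0 < d v"
    "\<And>v F w. cmod v = 1 / r \<Longrightarrow> F \<in> finite_rank_ops \<Longrightarrow> qn (F - K) < d v \<Longrightarrow> cmod w = 1 / r \<Longrightarrow> dist v w < d v \<Longrightarrow>
      cmod (det_p_id_minus p (F o\<^sub>L Y w)) \<le> ?E + \<eta>"
    by metis
  have cp: "compact (sphere (0::complex) (1 / r))" by simp
  obtain V where V: "V \<subseteq> sphere 0 (1 / r)" "finite V" "sphere 0 (1 / r) \<subseteq> (\<Union>v\<in>V. ball v (d v))"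
    using compactE_image[OF cp, of "sphere 0 (1 / r)" "\<lambda>v. ball v (d v)"] d(1) by force
  show ?thesis
  proof
    show "0 < Min (insert 1 (d ` V))" using V d(1) by (subst Min_gr_iff) auto
    fix F w assume F: "F \<in> finite_rank_ops" "qn (F - K) < Min (insert 1 (d ` V))" and w: "cmod w = 1 / r"
    obtain v where v: "v \<in> V" "dist v w < d v" using V(3) w by (auto simp: subset_iff)
    have "Min (insert 1 (d ` V)) \<le> d v" using V(2) v(1) by (intro Min_le) auto
    then have "cmod (det_p_id_minus p (F o\<^sub>L Y w)) \<le> ?E + \<eta>"
      using d(2)[of v F w] V(1) v F w by auto
    then show "cmod (det_p_id_minus p (w *\<^sub>C (F o\<^sub>L neumann A w))) \<le> ?E + \<eta>"
      using e[OF finite_rank_ops_bounded[OF F(1)]] by simp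
  qed
qed

text \<open>Approximate \<open>K\<close> by a finite rank operator \<open>F'\<close> that agrees with \<open>K\<close> on the range of \<open>P\<close>. Then the
  determinant for \<open>F'\<close> has a zero at \<open>1 / l\<close> for each of the \<open>op_rank P\<close> eigenvalues \<open>l\<close> of \<open>A + K\<close> on that range,
  and Jensen's inequality applies.\<close>

lemma spectral_subspace_dimension_bound:
  assumes A: "A \<in> bounded_ops" and K: "K \<in> \<I>" and r: "norm A < r" and s: "r < s"
    and P: "P \<in> finite_rank_ops" "(P o\<^sub>L P) = P" "(P o\<^sub>L (A + K)) = ((A + K) o\<^sub>L P)"
    and ev: "\<And>v l. v \<noteq> 0 \<Longrightarrow> blinfun_apply P v = v \<Longrightarrow> blinfun_apply (A + K) v = l *\<^sub>C v \<Longrightarrow> s \<le> cmod l"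
  shows "(s / r) ^ op_rank P \<le> exp (\<Phi> (qn K / (r - norm A)))"
proof (rule field_le_epsilon)
  fix \<eta> :: real assume \<eta>: "0 < \<eta>"
  let ?a = "norm A" and ?T = "A + K" and ?J = "id_blinfun - P"
  let ?E = "exp (\<Phi> (qn K / (r - norm A)))"
  have r0: "0 < r" using r norm_ge_zero[of A] by linarith
  note Kb = ideal_closed(4)[OF K] and Pb = finite_rank_ops_bounded[OF P(1)]
  obtain \<delta> where \<delta>: "0 < \<delta>" "\<And>F w. F \<in> finite_rank_ops \<Longrightarrow> qn (F - K) < \<delta> \<Longrightarrow> cmod w = 1 / r \<Longrightarrow>
    cmod (det_p_id_minus p (w *\<^sub>C (F o\<^sub>L neumann A w))) \<le> ?E + \<eta>"
    by (rule perturbation_determinant_circle_bound[OF A K r \<eta>]) (rule that, assumption+)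
  have J1: "0 < norm ?J + 1" by (simp add: add_nonneg_pos)
  obtain F where F: "F \<in> finite_rank_ops" "qn (F - K) < \<delta> / (norm ?J + 1)"
    using finite_rank_approximation[OF K, of "\<delta> / (norm ?J + 1)"] \<delta>(1) J1 by auto
  note Fb = finite_rank_ops_bounded[OF F(1)]
  \<comment> \<open>\<open>F'\<close> agrees with \<open>K\<close> on the range of \<open>P\<close>, and \<open>F' - K = (F - K)(I - P)\<close> is still small.\<close>
  define F' where "F' = F + ((K - F) o\<^sub>L P)"
  have F'f: "F' \<in> finite_rank_ops" unfolding F'_def using F(1) P(1) Kb Fb by auto
  have dI: "F - K \<in> \<I>" using ideal_closed(5)[OF F(1)] K by (rule ideal_closed(3))
  have "F' - K = ((F - K) o\<^sub>L ?J)" unfolding F'_def by (simp add: compose_diff_left compose_diff_right)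
  then have "qn (F' - K) \<le> qn (F - K) * norm ?J" using qn_compose(1)[OF dI, of ?J] Pb by auto
  also have "\<dots> \<le> qn (F - K) * (norm ?J + 1)" using nonneg[OF dI] by (intro mult_left_mono) auto
  also have "\<dots> < \<delta>" using F(2) J1 by (simp add: pos_less_divide_eq)
  finally have F'K: "qn (F' - K) < \<delta>" .
  define \<Theta> where "\<Theta> = (?T o\<^sub>L P)"
  have Tb: "?T \<in> bounded_ops" using A Kb by auto
  have \<Theta>f: "\<Theta> \<in> finite_rank_ops" unfolding \<Theta>_def using P(1) Tb by auto
  have P\<Theta>: "(P o\<^sub>L \<Theta>) = \<Theta>"
  proof -
    have "(P o\<^sub>L \<Theta>) = ((P o\<^sub>L ?T) o\<^sub>L P)" by (simp only: \<Theta>_def compose_assoc)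
    also have "\<dots> = (?T o\<^sub>L (P o\<^sub>L P))" by (simp only: P(3) compose_assoc)
    finally show ?thesis by (simp only: P(2) \<Theta>_def)
  qed
  have "((A + F') o\<^sub>L P) = \<Theta>"
    unfolding F'_def \<Theta>_def by (simp add: compose_add_left compose_diff_left compose_assoc P(2))
  then have "(((A + F') o\<^sub>L P) o\<^sub>L \<Theta>) = (\<Theta> o\<^sub>L \<Theta>)" by simp
  then have orth: "((A + F') o\<^sub>L \<Theta>) = (\<Theta> o\<^sub>L \<Theta>)" by (simp only: compose_assoc P\<Theta>)
  have r\<Theta>: "range (blinfun_apply \<Theta>) \<subseteq> lspan (range_basis P)"
    unfolding range_basis_list(2)[OF P(1)] using P\<Theta> by (metis blinfun_apply_blinfun_compose image_subset_iff rangeI)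
  obtain ls where ls: "eigenvalue_list \<Theta> ls" "length ls = length (range_basis P)"
    "\<And>l. l \<in> set ls \<Longrightarrow> \<exists>v\<in>lspan (range_basis P). v \<noteq> 0 \<and> blinfun_apply \<Theta> v = l *\<^sub>C v"
    using eigenvalue_list_exists[OF finite_rank_ops_bounded[OF \<Theta>f] range_basis_list(1)[OF P(1)] r\<Theta>] by metis
  have len: "length ls = op_rank P" using ls(2) op_rank_projection(2)[OF P(1,2)] by simp
  have big: "s \<le> cmod l" if l: "l \<in> set ls" for l
  proof -
    obtain v where v: "v \<in> range (blinfun_apply P)" "v \<noteq> 0" "blinfun_apply \<Theta> v = l *\<^sub>C v"
      using ls(3)[OF l] unfolding range_basis_list(2)[OF P(1)] by blast
    have Pv: "blinfun_apply P v = v" using v(1) compose_eq_apply[OF P(2)] by auto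
    then have "blinfun_apply ?T v = l *\<^sub>C v" using v(3) by (simp add: \<Theta>_def)
    then show ?thesis using ev v(2) Pv by blast
  qed
  define U where "U = {w. cmod w * ?a < 1}"
  have U: "open U" "cball 0 (1 / r) \<subseteq> U"
  proof -
    show "open U" unfolding U_def by (rule resolvent_disc) simp
    show "cball 0 (1 / r) \<subseteq> U"
    proof
      fix w :: complex assume "w \<in> cball 0 (1 / r)"
      then have "cmod w * ?a \<le> 1 / r * ?a" by (intro mult_right_mono) auto
      also have "\<dots> < 1" using r r0 by simp
      finally show "w \<in> U" by (simp add: U_def)
    qed
  qed
  define t where "t w = (\<Sum>k = 1..nat \<lceil>p\<rceil> - 1. 1 / of_nat k * op_trace (op_power (w *\<^sub>C (F' o\<^sub>L neumann A w)) k))" for w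
  define h where "h w = det_id_minus (w *\<^sub>C ((F' - \<Theta>) o\<^sub>L neumann A w)) * exp (t w)" for w
  have Yf: "F' - \<Theta> \<in> finite_rank_ops" using F'f \<Theta>f by auto
  have h_hol: "h holomorphic_on U"
    unfolding h_def t_def U_def
    by (intro holomorphic_intros holomorphic_perturbation_determinant A Yf F'f) auto
  have hd: "h w * (\<Prod>l\<leftarrow>ls. 1 - w * l) = det_p_id_minus p (w *\<^sub>C (F' o\<^sub>L neumann A w))" if "w \<in> U" for w
  proof -
    have "det_id_minus (w *\<^sub>C \<Theta>) = (\<Prod>l\<leftarrow>ls. 1 - w * l)" using ls(1) by (simp add: eigenvalue_list_def)
    then show ?thesis
      using perturbation_determinant_factor[OF A F'f \<Theta>f orth, of w] that
      by (simp add: h_def t_def det_p_id_minus_def U_def)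
  qed
  have "cmod (h 0 * (\<Prod>l\<leftarrow>ls. of_real (1 / r) * cnj l - 0 / of_real (1 / r))) \<le> ?E + \<eta>"
  proof (rule blaschke_bound[OF _ U h_hol])
    fix w assume w: "cmod w = 1 / r"
    then have "w \<in> U" using U(2) by auto
    then show "cmod (h w * (\<Prod>l\<leftarrow>ls. 1 - w * l)) \<le> ?E + \<eta>"
      using \<delta>(2)[OF F'f F'K w] by (simp add: hd)
  qed (use r0 in auto)
  moreover have "h 0 = 1"
  proof -
    have "op_trace (op_power (0 :: 'a \<Rightarrow>\<^sub>L 'a) k) = 0" if "0 < k" for k
    proof -
      have "op_power (0 :: 'a \<Rightarrow>\<^sub>L 'a) k = 0" using that by (cases k) auto
      then show ?thesis using op_trace_linear(3)[of 0 0 0] by simp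
    qed
    then have "t 0 = 0" by (auto simp: t_def intro!: sum.neutral)
    then show ?thesis by (simp add: h_def)
  qed
  ultimately have "(\<Prod>l\<leftarrow>ls. cmod l / r) \<le> ?E + \<eta>"
    using r0 by (simp add: norm_prod_list norm_mult norm_divide)
  moreover have "(s / r) ^ op_rank P \<le> (\<Prod>l\<leftarrow>ls. cmod l / r)"
  proof -
    have "(\<Prod>l\<leftarrow>ls. s / r) \<le> (\<Prod>l\<leftarrow>ls. cmod l / r)"
      using big r0 s by (intro conjunct1[OF prod_list_mono_real]) (auto intro: divide_right_mono)
    then show ?thesis by (simp add: prod_list_const len)
  qed
  ultimately show "(s / r) ^ op_rank P \<le> ?E + \<eta>" by linarith
qed

text \<open>The radius \<open>r\<close> is chosen to maximize \<open>(r - norm A)^p (s - r)\<close>, after \<open>ln (s / r)\<close> has been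
  estimated from below by \<open>(s - r) / s\<close>.\<close>

lemma discrete_eigenvalue_sum_bound:
  assumes A: "A \<in> bounded_ops" and K: "K \<in> \<I>" and s: "norm A < s"
    and S: "finite S" "S \<subseteq> {z \<in> discrete_eigenvalues (A + K). s < cmod z}"
  shows "real (\<Sum>z\<in>S. algebraic_multiplicity (A + K) z)
           \<le> \<gamma> powr p * \<Gamma> * ((p + 1) powr (p + 1) / p powr p) * (s / (s - norm A) powr (p + 1)) * qn K powr p"
proof -
  let ?a = "norm A" and ?T = "A + K"
  note Kb = ideal_closed(4)[OF K]
  have Tb: "?T \<in> bounded_ops" using A Kb by auto
  have sa: "0 < s - ?a" using s by simp
  obtain F where F: "F \<in> finite_rank_ops" "qn (F - K) < s - ?a" using finite_rank_approximation[OF K sa] by blast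
  define B where "B = A + (K - F)"
  have BF: "B + F = ?T" by (simp add: B_def)
  have Bb: "B \<in> bounded_ops" unfolding B_def using A Kb finite_rank_ops_bounded[OF F(1)] by auto
  have nB: "norm B < s"
  proof -
    have I: "K - F \<in> \<I>" using K ideal_closed(5)[OF F(1)] by (rule ideal_closed(3))
    have "norm B \<le> ?a + norm (K - F)" unfolding B_def by (rule norm_triangle_ineq)
    also have "norm (K - F) \<le> qn (K - F)" by (rule norm_le[OF I])
    also have "qn (K - F) = qn (F - K)" using K ideal_closed(5)[OF F(1)] by (rule qn_minus_commute)
    finally show ?thesis using F(2) by linarith
  qed
  have Q: "spectral_projection ?T z (riesz_projection ?T z)" "riesz_projection ?T z \<in> finite_rank_ops" if "z \<in> S" for z
  proof -
    have z: "z \<in> spectrum ?T" "s < cmod z" using S(2) that by (auto simp: discrete_eigenvalues_def isolated_in_def)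
    have "norm B < cmod z" using nB z(2) by linarith
    then show "spectral_projection ?T z (riesz_projection ?T z)" "riesz_projection ?T z \<in> finite_rank_ops"
      using riesz_projection_spectral[of B F z, unfolded BF, OF Bb F(1) z(1)] by auto
  qed
  define P where "P = (\<Sum>z\<in>S. riesz_projection ?T z)"
  note Pp = spectral_projection_sum[OF Tb S(1) Q, folded P_def]
  have Pev: "l \<in> S" if "v \<noteq> 0" "blinfun_apply P v = v" "blinfun_apply ?T v = l *\<^sub>C v" for v l
    using Pp(5) that by blast
  have N: "op_rank P = (\<Sum>z\<in>S. algebraic_multiplicity ?T z)"
    using Pp(4) by (simp add: algebraic_multiplicity_def)
  define r where "r = ?a + p / (p + 1) * (s - ?a)"
  have ra: "r - ?a = p * (s - ?a) / (p + 1)" by (simp add: r_def)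
  have sr: "s - r = (s - ?a) / (p + 1)" using p by (simp add: r_def field_simps)
  have r: "?a < r" "r < s"
  proof -
    have "0 < r - ?a" unfolding ra using p sa by simp
    then show "?a < r" by simp
    have "0 < s - r" unfolding sr using p sa by simp
    then show "r < s" by simp
  qed
  have r0: "0 < r" "0 < s" using r norm_ge_zero[of A] by linarith+
  have "(s / r) ^ op_rank P \<le> exp (\<Phi> (qn K / (r - ?a)))"
  proof (rule spectral_subspace_dimension_bound[OF A K r Pp(1,2,3)])
    fix v l assume "v \<noteq> 0" "blinfun_apply P v = v" "blinfun_apply ?T v = l *\<^sub>C v"
    then have "l \<in> S" by (rule Pev)
    then show "s \<le> cmod l" using S(2) by auto
  qed
  then have "ln ((s / r) ^ op_rank P) \<le> ln (exp (\<Phi> (qn K / (r - ?a))))"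
    using r0 by (intro ln_le_cancel_iff[THEN iffD2]) auto
  then have 1: "real (op_rank P) * ln (s / r) \<le> \<Phi> (qn K / (r - ?a))"
    using r0 by (simp add: ln_realpow)
  have "(s - r) / s \<le> ln (s / r)"
  proof -
    have "ln (r / s) \<le> r / s - 1" using r0 by (intro ln_le_minus_one) simp
    moreover have "ln (r / s) = - ln (s / r)" using r0 by (simp add: ln_div)
    ultimately show ?thesis using r0 by (simp add: diff_divide_distrib)
  qed
  then have "real (op_rank P) * ((s - r) / s) \<le> \<Phi> (qn K / (r - ?a))"
    using 1 by (meson mult_left_mono of_nat_0_le_iff order_trans)
  then have "real (op_rank P) \<le> \<Phi> (qn K / (r - ?a)) * (s / (s - r))"
    using r r0 by (simp add: field_simps)
  also have "\<dots> = \<gamma> powr p * \<Gamma> * ((p + 1) powr (p + 1) / p powr p) * (s / (s - ?a) powr (p + 1)) * qn K powr p"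
  proof -
    have x: "(\<gamma> * (qn K / (r - ?a))) powr p = \<gamma> powr p * qn K powr p * ((p + 1) powr p / (p powr p * (s - ?a) powr p))"
      unfolding ra using \<gamma> nonneg[OF K] p sa by (simp add: powr_mult powr_divide)
    have y: "s / (s - r) = s * (p + 1) / (s - ?a)" unfolding sr using p by simp
    have z: "(p + 1) powr (p + 1) = (p + 1) powr p * (p + 1)" "(s - ?a) powr (p + 1) = (s - ?a) powr p * (s - ?a)"
      using p sa by (simp_all add: powr_add)
    show ?thesis unfolding \<Phi>_def x y z by (simp add: mult_ac)
  qed
  finally show ?thesis unfolding N .
qed

end

theorem corollary6p6:
  fixes A K :: "'a::complex_banach \<Rightarrow>\<^sub>L 'a"
    and \<I> :: "('a \<Rightarrow>\<^sub>L 'a) set"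
    and qn :: "('a \<Rightarrow>\<^sub>L 'a) \<Rightarrow> real"
    and p s \<gamma> \<Gamma> :: real
  assumes "p > 0"
    and "lp_ideal p \<I> qn \<gamma>"
    and "\<Gamma> > 0"
    and "\<forall>F \<in> (finite_rank_ops :: ('a \<Rightarrow>\<^sub>L 'a) set).
           cmod (det_p_id_minus p F) \<le> exp (\<Gamma> * eigenvalue_power_sum p F)"
    and "A \<in> bounded_ops"
    and "K \<in> \<I>"
    and "s > norm A"
  shows "eigenvalue_count (A + K) s
           \<le> ennreal (\<gamma> powr p * \<Gamma> * ((p + 1) powr (p + 1) / p powr p)
                        * (s / (s - norm A) powr (p + 1)) * qn K powr p)"
proof (cases "0 \<le> \<gamma>")
  case True
  interpret lp_ideal p \<I> qn \<gamma> by fact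
  interpret determinant_ideal p \<I> qn \<gamma> \<Gamma>
    by unfold_locales (use assms True in auto)
  let ?D = "{z \<in> discrete_eigenvalues (A + K). s < cmod z}"
  have "(\<Sum>z\<in>S. of_nat (algebraic_multiplicity (A + K) z)) \<le>
      ennreal (\<gamma> powr p * \<Gamma> * ((p + 1) powr (p + 1) / p powr p) * (s / (s - norm A) powr (p + 1)) * qn K powr p)"
    if "finite S" "S \<subseteq> ?D" for S
  proof -
    have "(\<Sum>z\<in>S. of_nat (algebraic_multiplicity (A + K) z)) = ennreal (real (\<Sum>z\<in>S. algebraic_multiplicity (A + K) z))"
      by (simp flip: of_nat_sum ennreal_of_nat_eq_real_of_nat)
    also have "\<dots> \<le> ennreal (\<gamma> powr p * \<Gamma> * ((p + 1) powr (p + 1) / p powr p) * (s / (s - norm A) powr (p + 1)) * qn K powr p)"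
      by (intro ennreal_leI discrete_eigenvalue_sum_bound assms that)
    finally show ?thesis .
  qed
  then show ?thesis
    unfolding eigenvalue_count_def by (subst nonneg_infsum_complete) (auto intro!: SUP_least)
next
  case False
  interpret lp_ideal p \<I> qn \<gamma> by fact
  \<comment> \<open>The eigenvalue inequality bounds a nonnegative number by \<open>\<gamma> * qn K\<close>.\<close>
  have "0 \<le> \<gamma> * qn K" using eigenvalue_bound[OF assms(6)] powr_ge_zero order_trans by blast
  then have "qn K = 0" using False nonneg[OF assms(6)] by (simp add: zero_le_mult_iff)
  then have K: "K = 0" using eq_zero_iff[OF assms(6)] by simp
  have "{z \<in> discrete_eigenvalues (A + K). s < cmod z} = {}"
    using norm_spectrum_le[OF assms(5)] assms(7) unfolding K discrete_eigenvalues_def isolated_in_def by fastforce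
  then have "eigenvalue_count (A + K) s = 0" unfolding eigenvalue_count_def by (simp only: infsum_empty)
  then show ?thesis by simp
qed

end
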